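(* Let $A$ be a real $m\times n$ matrix with singular values $\sigma_1\ge\sigma_2\ge\cdots\ge\sigma_{\min(m,n)}$, and let $k\ge1$, $p\ge2$ be integers with $k+p\le\min(m,n)$. Let $G$ be an $n\times(k+p)$ matrix with i.i.d. $\mathcal{N}(0,1)$ entries, and let the columns of $Q$ form an orthonormal basis of the range of $AG$. Let $\Sigma$ be a $k\times k$ diagonal random matrix whose diagonal entries are the singular values of a $(k+p)\times k$ matrix with i.i.d. $\mathcal{N}(0,1)$ entries. Then $$\mathbb{E}\,\|(I-QQ^* )A\| \;\le\; \Bigl(1+\sqrt{\tfrac{k}{p-1}}\Bigr)\sigma_{k+1} + \mathbb{E}\,\|\Sigma^{-1}\|\,\sqrt{\sum_{i>k}\sigma_i^2}.$$
   Context: $\|\cdot\|$ is the spectral norm (largest singular value). $QQ^*$ is the orthogonal projector onto the range (column space) of $AG$. The sum runs over $k<i\le\min(m,n)$. *)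

theory Defs
  imports "HOL-Probability.Probability" "HOL-Library.Multiset"
begin

definition eigenspace :: "real^'n^'n \<Rightarrow> real \<Rightarrow> (real^'n) set" where
  "eigenspace B \<mu> = {v. B *v v = \<mu> *\<^sub>R v}"

definition eigenvalues :: "real^'n^'n \<Rightarrow> real set" where
  "eigenvalues B = {\<mu>. \<exists>v \<in> eigenspace B \<mu>. v \<noteq> 0}"

text \<open>The singular values of an \<open>m \<times> n\<close> matrix \<open>A\<close> in decreasing order, i.e. the square roots of the
  \<open>min m n\<close> largest eigenvalues of \<open>A\<^sup>T A\<close> counted with multiplicity. As \<open>A\<^sup>T A\<close> is symmetric,
  the multiplicity of an eigenvalue is the dimension of its eigenspace; when \<open>m < n\<close>, \<open>take\<close>
  discards \<open>n - m\<close> zeros.\<close>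

definition singular_values :: "real^'n^'m \<Rightarrow> real list" where
  "singular_values A = take (min CARD('m) CARD('n)) (rev (sorted_list_of_multiset
     (\<Sum>\<mu> \<in> eigenvalues (transpose A ** A).
        replicate_mset (dim (eigenspace (transpose A ** A) \<mu>)) (sqrt \<mu>))))"

text \<open>Indices start at 1.\<close>

definition singular_value :: "real^'n^'m \<Rightarrow> nat \<Rightarrow> real" where
  "singular_value A i = singular_values A ! (i - 1)"

definition spectral_norm :: "real^'n^'m \<Rightarrow> real" where
  "spectral_norm A = singular_value A 1"

definition std_gaussian_matrix :: "'a measure \<Rightarrow> ('a \<Rightarrow> real^'n^'m) \<Rightarrow> bool" where
  "std_gaussian_matrix M G \<longleftrightarrow>
     prob_space.indep_vars M (\<lambda>_. borel) (\<lambda>(i, j) \<omega>. G \<omega> $ i $ j) UNIV \<and>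
     (\<forall>i j. distributed M lborel (\<lambda>\<omega>. G \<omega> $ i $ j) std_normal_density)"

text \<open>The range of a random matrix has no fixed dimension, so a matrix \<open>Q\<close> whose columns are a
  basis of it is represented by the list of its columns; \<open>Q Q\<^sup>T\<close> is the sum of \<open>q q\<^sup>T\<close> over
  these columns.\<close>

definition orthonormal_basis :: "(real^'m) list \<Rightarrow> (real^'m) set \<Rightarrow> bool" where
  "orthonormal_basis Q V \<longleftrightarrow>
     (\<forall>i < length Q. \<forall>j < length Q. Q ! i \<bullet> Q ! j = (if i = j then 1 else 0)) \<and> span (set Q) = V"

definition times_transpose :: "(real^'m) list \<Rightarrow> real^'m^'m" where
  "times_transpose Q = (\<Sum>q\<leftarrow>Q. \<chi> i j. q $ i * q $ j)"

text \<open>The order of the diagonal entries is left open.\<close>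

definition diagonal_of_singular_values :: "real^'k^'k \<Rightarrow> real^'k^'l \<Rightarrow> bool" where
  "diagonal_of_singular_values S H \<longleftrightarrow>
     (\<forall>i j. i \<noteq> j \<longrightarrow> S $ i $ j = 0) \<and>
     image_mset (\<lambda>i. S $ i $ i) (mset_set UNIV) = mset (singular_values H)"

end

theory Submission
  imports Defs
begin

text \<open>For any \<open>X\<close> the projection error of \<open>A\<close> equals that of \<open>A - A G X\<close>. In an orthonormal basis of right singular
  vectors \<open>G\<close> splits into independent Gaussian blocks \<open>H\<^sup>T\<close> (leading \<open>k\<close> rows) and \<open>W\<close> (the others), and choosing
  \<open>X\<close> by the pseudo-inverse \<open>Z\<close> of \<open>H\<^sup>T\<close> bounds the error by \<open>\<sigma>\<^sub>k\<^sub>+\<^sub>1\<close> plus the norm of \<open>S W Z\<close>, where \<open>S\<close> is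
  diagonal with the trailing singular values. For fixed \<open>Z\<close>, Chevet's inequality bounds the mean of this norm by
  \<open>\<sigma>\<^sub>k\<^sub>+\<^sub>1\<close> times the Frobenius norm of \<open>Z\<close> plus the spectral norm of \<open>Z\<close> times the Frobenius norm of \<open>S\<close>. The Frobenius
  norm of \<open>Z\<close> has mean square \<open>k / (p - 1)\<close>, because a column of \<open>Z\<close> has length the inverse of the distance of a Gaussian vector to a
  subspace; the spectral norm of \<open>Z\<close> is distributed like that of \<open>\<Sigma>\<^sup>-\<^sup>1\<close>. Chevet's inequality follows from the
  Sudakov-Fernique comparison, proved by swapping one Gaussian increment at a time in the smooth maximum
  \<open>ln (\<Sum>i. exp w\<^sub>i)\<close>. Gaussian vectors are handled through a single invariance: the standard Gaussian measure is mapped to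
  the standard Gaussian measure by every linear map \<open>f\<close> with \<open>f \<circ> f' = id\<close> for the adjoint \<open>f'\<close>.\<close>

section \<open>Gaussian measure on a Euclidean space\<close>

text \<open>For an arbitrary choice of \<open>Q\<close>, the error is bounded pointwise by a
  measurable function of the Gaussian blocks, so its expectation can be estimated as a nonnegative
  integral. The norm of \<open>S W Z\<close> enters as a countable supremum of bilinear forms over
  dense sequences in two unit balls, because the comparison principle speaks of finite maxima;
  monotone convergence passes to the supremum. The process is indexed by rank one matrices
  \<open>b a^T\<close>. Their mutual distances are dominated by those of the vectors
  \<open>(|b| a, |a| b)\<close>, whose process is a sum of one term in \<open>a\<close> and one in
  \<open>b\<close>: hence the two summands of Chevet's bound. The constant
  \<open>k / (p - 1)\<close> is \<open>k\<close> times the mean of an inverse chi-squared variable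
  with \<open>p + 1\<close> degrees of freedom: a column of \<open>H\<close> has
  \<open>k + p\<close> coordinates, and the other columns span at most \<open>k - 1\<close>
  dimensions. Finiteness of this mean is where \<open>p >= 2\<close> enters. After the passage from
  \<open>M\<close> and \<open>N\<close> to \<open>gauss\<close>, independence is just Fubini on
  product types, and conditioning is the resampling of one component.\<close>

lemma borel_measurable_linear:
  fixes f :: "'a::euclidean_space \<Rightarrow> 'b::euclidean_space"
  assumes "linear f"
  shows "f \<in> borel_measurable borel"
  using assms by (intro borel_measurable_continuous_onI linear_continuous_on) (simp add: linear_conv_bounded_linear)

lemma borel_measurable_fst_snd:
  "fst \<in> borel_measurable (borel :: ('a::euclidean_space \<times> 'b::euclidean_space) measure)"
  "snd \<in> borel_measurable (borel :: ('a::euclidean_space \<times> 'b::euclidean_space) measure)"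
  by (intro borel_measurable_linear linear_fst linear_snd)+

section \<open>Invariance of Lebesgue measure under isometries\<close>

lemma nn_integral_lborel_plus:
  fixes c :: "'a::euclidean_space" and f :: "'a \<Rightarrow> ennreal"
  assumes [measurable]: "f \<in> borel_measurable borel"
  shows "(\<integral>\<^sup>+x. f (c + x) \<partial>lborel) = (\<integral>\<^sup>+x. f x \<partial>lborel)"
  by (subst (2) lborel_distr_plus[of c, symmetric]) (simp add: nn_integral_distr)

lemma nn_integral_lborel_uminus:
  fixes f :: "'a::euclidean_space \<Rightarrow> ennreal"
  assumes [measurable]: "f \<in> borel_measurable borel"
  shows "(\<integral>\<^sup>+x. f (- x) \<partial>lborel) = (\<integral>\<^sup>+x. f x \<partial>lborel)"
proof -
  have "lborel = distr lborel borel (uminus :: 'a \<Rightarrow> 'a)"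
    using lborel_affine[of "-1" "0::'a"] by (simp add: density_1)
  then have "(\<integral>\<^sup>+x. f x \<partial>lborel) = (\<integral>\<^sup>+x. f x \<partial>distr lborel borel (uminus :: 'a \<Rightarrow> 'a))"
    by simp
  also have "\<dots> = (\<integral>\<^sup>+x. f (- x) \<partial>lborel)"
    by (rule nn_integral_distr) measurable
  finally show ?thesis by simp
qed

text \<open>This is uniqueness of a translation-invariant measure, run through Fubini. With B the
  unit ball, the double integral of 1_A(f x) 1_B(f x + y) is the image measure of A times the
  Lebesgue measure of B if y is integrated first, and the Lebesgue measure of A times the image
  measure of B after a shift of x. Both measures agree on B because \<open>f\<close> preserves
  norms, and the common value is finite and positive.\<close>

lemma lborel_distr_orthogonal_transformation:
  fixes f :: "'a::euclidean_space \<Rightarrow> 'a"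
  assumes f: "orthogonal_transformation f"
  shows "distr lborel borel f = (lborel :: 'a measure)"
proof (rule measure_eqI)
  have lin: "linear f" using f by (rule orthogonal_transformation_linear)
  note [measurable] = borel_measurable_linear[OF lin]
  fix A :: "'a set" assume "A \<in> sets (distr lborel borel f)"
  then have [measurable]: "A \<in> sets borel" by simp
  let ?B = "ball 0 1 :: 'a set"
  let ?\<mu> = "emeasure (distr lborel borel f)"
  have B: "?\<mu> ?B = emeasure lborel ?B"
  proof -
    have "f -` ?B = ?B" using orthogonal_transformation_norm[OF f] by auto
    then show ?thesis by (subst emeasure_distr) auto
  qed
  have eq: "?\<mu> C = (\<integral>\<^sup>+x. indicator C (f x) \<partial>lborel)" if [measurable]: "C \<in> sets borel" for C
    by (subst nn_integral_distr[symmetric, of _ _ borel]) auto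
  define g :: "'a \<Rightarrow> ennreal" where "g = indicator ?B"
  have [measurable]: "g \<in> borel_measurable borel"
    unfolding g_def by (rule borel_measurable_indicator) simp
  have "?\<mu> A * emeasure lborel ?B = (\<integral>\<^sup>+x. (\<integral>\<^sup>+y. indicator A (f x) * g (f x + y) \<partial>lborel) \<partial>lborel)"
  proof -
    have "(\<integral>\<^sup>+y. indicator A (f x) * g (f x + y) \<partial>lborel) = indicator A (f x) * emeasure lborel ?B" for x
    proof -
      have "(\<integral>\<^sup>+y. g (f x + y) \<partial>lborel) = emeasure lborel ?B"
        using nn_integral_indicator[of ?B lborel] nn_integral_lborel_plus[OF \<open>g \<in> borel_measurable borel\<close>] by (simp add: g_def)
      moreover have "(\<integral>\<^sup>+y. indicator A (f x) * g (f x + y) \<partial>lborel)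
          = indicator A (f x) * (\<integral>\<^sup>+y. g (f x + y) \<partial>lborel)"
        by (rule nn_integral_cmult) measurable
      ultimately show ?thesis by simp
    qed
    then show ?thesis by (simp add: eq nn_integral_multc)
  qed
  also have "\<dots> = (\<integral>\<^sup>+y. (\<integral>\<^sup>+x. indicator A (f x) * g (f x + y) \<partial>lborel) \<partial>lborel)"
    by (rule lborel_pair.Fubini'[symmetric]) measurable
  also have "\<dots> = (\<integral>\<^sup>+y. (\<integral>\<^sup>+x. indicator A (f x - y) * g (f x) \<partial>lborel) \<partial>lborel)"
  proof (rule nn_integral_cong)
    fix y :: 'a
    \<comment> \<open>Surjectivity turns a translation by \<open>y\<close> behind \<open>f\<close>
      into a translation of the variable \<open>x\<close>, under which \<open>lborel\<close> is
      invariant.\<close>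
    obtain z where z: "f z = y" using orthogonal_transformation_surj[OF f] by (metis surjD)
    have "(\<integral>\<^sup>+x. indicator A (f x - y) * g (f x) \<partial>lborel)
        = (\<integral>\<^sup>+x. indicator A (f (z + x) - y) * g (f (z + x)) \<partial>lborel)"
      by (rule nn_integral_lborel_plus[symmetric]) measurable
    also have "\<dots> = (\<integral>\<^sup>+x. indicator A (f x) * g (f x + y) \<partial>lborel)"
      by (simp add: linear_add[OF lin] z add.commute)
    finally show "(\<integral>\<^sup>+x. indicator A (f x) * g (f x + y) \<partial>lborel)
      = (\<integral>\<^sup>+x. indicator A (f x - y) * g (f x) \<partial>lborel)" by simp
  qed
  also have "\<dots> = (\<integral>\<^sup>+x. (\<integral>\<^sup>+y. indicator A (f x - y) * g (f x) \<partial>lborel) \<partial>lborel)"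
    by (rule lborel_pair.Fubini') measurable
  also have "\<dots> = (\<integral>\<^sup>+x. emeasure lborel A * g (f x) \<partial>lborel)"
  proof (rule nn_integral_cong)
    fix x :: 'a
    have "(\<integral>\<^sup>+y. indicator A (f x - y) \<partial>lborel) = (\<integral>\<^sup>+y. indicator A (f x + y) \<partial>lborel)"
      by (subst nn_integral_lborel_uminus[symmetric]) auto
    also have "\<dots> = emeasure lborel A"
      by (subst nn_integral_lborel_plus) auto
    finally show "(\<integral>\<^sup>+y. indicator A (f x - y) * g (f x) \<partial>lborel) = emeasure lborel A * g (f x)"
      by (subst nn_integral_multc) auto
  qed
  also have "\<dots> = emeasure lborel A * ?\<mu> ?B"
    by (simp add: nn_integral_cmult eq[of ?B] g_def[symmetric])
  finally have "?\<mu> A * emeasure lborel ?B = emeasure lborel A * emeasure lborel ?B"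
    unfolding B .
  moreover have "emeasure lborel ?B \<noteq> 0" "emeasure lborel ?B \<noteq> \<infinity>"
    by (simp_all add: emeasure_ball less_imp_neq[THEN not_sym])
  ultimately show "?\<mu> A = emeasure lborel A"
    by (simp add: ennreal_mult_cancel_left mult.commute[of _ "emeasure lborel ?B"])
qed simp

text \<open>A density on an arbitrary Euclidean space: vectors, matrices and pairs of them are
  covered at once, and linear maps between different types can be compared.\<close>

definition gauss :: "'a::euclidean_space measure" where
  "gauss = density lborel (\<lambda>x. ennreal (exp (- (norm x)\<^sup>2 / 2) / sqrt (2 * pi) ^ DIM('a)))"

lemma sets_gauss[measurable_cong, simp]: "sets gauss = sets borel"
  and space_gauss[simp]: "space gauss = UNIV"
  by (simp_all add: gauss_def)

lemma gauss_real: "gauss = std_normal_distribution"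
  by (simp add: gauss_def normal_density_def field_simps)

lemma gauss_density_prod:
  fixes x :: "'a::euclidean_space"
  shows "exp (- (norm x)\<^sup>2 / 2) / sqrt (2 * pi) ^ DIM('a) = (\<Prod>b\<in>Basis. std_normal_density (x \<bullet> b))"
proof -
  have "(norm x)\<^sup>2 = (\<Sum>b\<in>Basis. (x \<bullet> b)\<^sup>2)"
    unfolding norm_eq_sqrt_inner by (subst euclidean_inner) (simp add: power2_eq_square sum_nonneg)
  then have "exp (- (norm x)\<^sup>2 / 2) = (\<Prod>b\<in>Basis. exp (- (x \<bullet> b)\<^sup>2 / 2))"
    by (subst exp_sum[symmetric]) (simp_all add: sum_negf sum_divide_distrib)
  moreover have "(\<Prod>b\<in>Basis. std_normal_density (x \<bullet> b))
      = (\<Prod>b\<in>(Basis :: 'a set). 1 / sqrt (2 * pi)) * (\<Prod>b\<in>Basis. exp (- (x \<bullet> b)\<^sup>2 / 2))"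
    by (subst prod.distrib[symmetric]) (simp add: normal_density_def)
  ultimately show ?thesis
    by (simp add: power_one_over)
qed

lemma prob_space_gauss: "prob_space (gauss :: 'a::euclidean_space measure)"
proof
  interpret prob_space std_normal_distribution by (rule prob_space_normal_density) simp
  have *: "(\<integral>\<^sup>+t. ennreal (std_normal_density t) \<partial>lborel) = 1"
    using emeasure_space_1 by (simp add: emeasure_density)
  have "emeasure (gauss :: 'a measure) (space gauss) = (\<integral>\<^sup>+x. (\<Prod>b\<in>Basis. ennreal (std_normal_density ((x::'a) \<bullet> b))) \<partial>lborel)"
    unfolding gauss_def gauss_density_prod by (simp add: emeasure_density prod_ennreal)
  also have "\<dots> = 1"
    by (subst nn_integral_lborel_prod) (simp_all add: *)
  finally show "emeasure (gauss :: 'a measure) (space gauss) = 1" .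
qed

interpretation gauss: prob_space "gauss :: 'a::euclidean_space measure"
  by (rule prob_space_gauss)

interpretation gauss_pair: pair_sigma_finite "gauss :: 'a::euclidean_space measure" "gauss :: 'b::euclidean_space measure"
  by unfold_locales

text \<open>The form in which independence is used: the two components of a standard Gaussian point
  of a product type are independent and standard Gaussian, because the density is
  multiplicative.\<close>

lemma gauss_prod: "(gauss :: 'a::euclidean_space measure) \<Otimes>\<^sub>M (gauss :: 'b::euclidean_space measure) = gauss"
proof -
  have "(gauss :: 'a measure) \<Otimes>\<^sub>M (gauss :: 'b measure) = density (lborel \<Otimes>\<^sub>M lborel) (\<lambda>(x, y).
     ennreal (exp (- (norm x)\<^sup>2 / 2) / sqrt (2 * pi) ^ DIM('a)) * ennreal (exp (- (norm y)\<^sup>2 / 2) / sqrt (2 * pi) ^ DIM('b)))"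
    unfolding gauss_def
  proof (subst pair_measure_density)
    show "sigma_finite_measure (density lborel (\<lambda>x::'b. ennreal (exp (- (norm x)\<^sup>2 / 2) / sqrt (2 * pi) ^ DIM('b))))"
      unfolding gauss_def[symmetric] by unfold_locales
  qed (auto intro: lborel.sigma_finite_measure_axioms)
  also have "\<dots> = gauss"
    unfolding gauss_def lborel_prod
  proof (rule arg_cong[where f="density lborel"], rule ext)
    fix z :: "'a \<times> 'b"
    obtain x y where z: "z = (x, y)" by (cases z)
    have "exp (- (norm z)\<^sup>2 / 2) = exp (- (norm x)\<^sup>2 / 2) * exp (- (norm y)\<^sup>2 / 2)"
      by (simp add: z norm_prod_def exp_add[symmetric] add_divide_distrib)
    then show "(case z of (x, y) \<Rightarrow> ennreal (exp (- (norm x)\<^sup>2 / 2) / sqrt (2 * pi) ^ DIM('a)) *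
        ennreal (exp (- (norm y)\<^sup>2 / 2) / sqrt (2 * pi) ^ DIM('b)))
      = ennreal (exp (- (norm z)\<^sup>2 / 2) / sqrt (2 * pi) ^ DIM('a \<times> 'b))"
      by (simp add: z ennreal_mult[symmetric] power_add)
  qed
  finally show ?thesis .
qed

lemma gauss_distr_orthogonal_transformation:
  fixes f :: "'a::euclidean_space \<Rightarrow> 'a"
  assumes f: "orthogonal_transformation f"
  shows "distr gauss borel f = (gauss :: 'a measure)"
proof -
  have lin: "linear f" using f by (rule orthogonal_transformation_linear)
  note [measurable] = borel_measurable_linear[OF lin]
  have "density (distr lborel borel f) (\<lambda>x. ennreal (exp (- (norm x)\<^sup>2 / 2) / sqrt (2 * pi) ^ DIM('a))) = distr gauss borel f"
    by (subst density_distr) (auto simp: gauss_def orthogonal_transformation_norm[OF f])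
  then show ?thesis
    by (simp add: lborel_distr_orthogonal_transformation[OF f] gauss_def)
qed

text \<open>With \<open>f'\<close> the adjoint, \<open>f \<circ> f' = id\<close> makes \<open>(x, y) \<mapsto> (x - f' (f x) + f' y, f x)\<close> an orthogonal
  transformation of the product space whose second component is \<open>f\<close>.\<close>

lemma gauss_distr_coisometry:
  fixes f :: "'a::euclidean_space \<Rightarrow> 'b::euclidean_space" and f' :: "'b \<Rightarrow> 'a"
  assumes adj: "\<And>x y. f x \<bullet> y = x \<bullet> f' y" and inv: "\<And>y. f (f' y) = y"
  shows "distr gauss borel f = gauss" and "f \<in> borel_measurable borel"
proof -
  have lin: "linear f"
  proof (rule linearI)
    show "f (x + y) = f x + f y" for x y
      by (rule vector_eq_rdot[THEN iffD1]) (simp add: adj inner_add_left)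
    show "f (c *\<^sub>R x) = c *\<^sub>R f x" for c x
      by (rule vector_eq_rdot[THEN iffD1]) (simp add: adj)
  qed
  have lin': "linear f'"
  proof (rule linearI)
    show "f' (x + y) = f' x + f' y" for x y
      by (rule vector_eq_ldot[THEN iffD1]) (simp add: adj[symmetric] inner_add_right)
    show "f' (c *\<^sub>R x) = c *\<^sub>R f' x" for c x
      by (rule vector_eq_ldot[THEN iffD1]) (simp add: adj[symmetric])
  qed
  show meas[measurable]: "f \<in> borel_measurable borel"
    using lin by (rule borel_measurable_linear)
  define T where "T = (\<lambda>(x, y). (x - f' (f x) + f' y, f x))"
  have T: "orthogonal_transformation T"
    unfolding orthogonal_transformation
  proof (intro conjI allI)
    show "linear T"
      by (rule linearI) (auto simp: T_def linear_add[OF lin] linear_add[OF lin'] linear_scale[OF lin] linear_scale[OF lin'] algebra_simps)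
    show "norm (T v) = norm v" for v
    proof -
      obtain x y where v: "v = (x, y)" by (cases v)
      have 1: "f' a \<bullet> f' b = a \<bullet> b" for a b by (simp add: adj[symmetric] inv)
      have 2: "x \<bullet> f' b = f x \<bullet> b" "f' b \<bullet> x = f x \<bullet> b" for b
        by (metis adj inner_commute)+
      have "T v \<bullet> T v = v \<bullet> v"
        by (simp add: v T_def inner_prod_def inner_add_left inner_add_right inner_diff_left inner_diff_right 1 2 inner_commute)
      then show ?thesis by (simp add: norm_eq_sqrt_inner)
    qed
  qed
  have Tm[measurable]: "T \<in> borel_measurable borel"
    by (intro borel_measurable_linear orthogonal_transformation_linear T)
  note [measurable] = borel_measurable_fst_snd
  have fstg: "distr (gauss :: ('a \<times> 'b) measure) borel fst = gauss"
  proof (rule measure_eqI)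
    fix A assume "A \<in> sets (distr (gauss :: ('a \<times> 'b) measure) borel fst)"
    then have A: "A \<in> sets borel" by simp
    moreover have "fst -` A = A \<times> (UNIV :: 'b set)" by auto
    ultimately show "emeasure (distr (gauss :: ('a \<times> 'b) measure) borel fst) A = emeasure gauss A"
      using gauss.emeasure_space_1[where 'a='b]
      by (simp add: emeasure_distr gauss_prod[symmetric] gauss.emeasure_pair_measure_Times)
  qed simp
  have sndg: "distr (gauss :: ('a \<times> 'b) measure) borel snd = gauss"
  proof (rule measure_eqI)
    fix A assume "A \<in> sets (distr (gauss :: ('a \<times> 'b) measure) borel snd)"
    then have A: "A \<in> sets borel" by simp
    moreover have "snd -` A = (UNIV :: 'a set) \<times> A" by auto
    ultimately show "emeasure (distr (gauss :: ('a \<times> 'b) measure) borel snd) A = emeasure gauss A"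
      using gauss.emeasure_space_1[where 'a='a]
      by (simp add: emeasure_distr gauss_prod[symmetric] gauss.emeasure_pair_measure_Times)
  qed simp
  have "gauss = distr (distr (gauss :: ('a \<times> 'b) measure) borel T) borel snd"
    by (simp add: gauss_distr_orthogonal_transformation[OF T] sndg)
  also have "\<dots> = distr (distr (gauss :: ('a \<times> 'b) measure) borel fst) borel f"
  proof -
    have "snd \<circ> T = f \<circ> fst" by (auto simp: T_def)
    then show ?thesis by (simp add: distr_distr)
  qed
  finally show "distr gauss borel f = gauss" by (simp add: fstg)
qed

lemma nn_integral_gauss_coisometry:
  fixes f :: "'a::euclidean_space \<Rightarrow> 'b::euclidean_space" and f' :: "'b \<Rightarrow> 'a" and \<phi> :: "'b \<Rightarrow> ennreal"
  assumes "\<And>x y. f x \<bullet> y = x \<bullet> f' y" and "\<And>y. f (f' y) = y" and [measurable]: "\<phi> \<in> borel_measurable borel"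
  shows "(\<integral>\<^sup>+x. \<phi> (f x) \<partial>gauss) = (\<integral>\<^sup>+y. \<phi> y \<partial>gauss)"
proof -
  note [measurable] = gauss_distr_coisometry(2)[OF assms(1,2)]
  show ?thesis
    by (subst gauss_distr_coisometry(1)[OF assms(1,2), symmetric]) (simp_all add: nn_integral_distr)
qed

lemma nn_integral_gauss_prod:
  fixes \<phi> :: "'a::euclidean_space \<times> 'b::euclidean_space \<Rightarrow> ennreal"
  assumes "\<phi> \<in> borel_measurable borel"
  shows "(\<integral>\<^sup>+z. \<phi> z \<partial>gauss) = (\<integral>\<^sup>+x. (\<integral>\<^sup>+y. \<phi> (x, y) \<partial>gauss) \<partial>gauss)"
  using assms by (simp add: gauss_prod[symmetric] gauss.nn_integral_fst borel_prod[symmetric] cong: measurable_cong_sets)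

text \<open>The bridge to independent coordinates: \<open>indep_vars\<close> is characterised by a
  product measure \<open>PiM\<close>, whereas \<open>gauss\<close> is given by a density with
  respect to \<open>lborel\<close>.\<close>

lemma gauss_eq_distr_PiM:
  "distr (\<Pi>\<^sub>M b\<in>Basis. std_normal_distribution) borel (\<lambda>f. \<Sum>b\<in>Basis. f b *\<^sub>R b) = (gauss :: 'a::euclidean_space measure)"
proof -
  let ?D = "density (\<Pi>\<^sub>M b\<in>Basis. lborel) (\<lambda>f. ennreal (\<Prod>b\<in>Basis. std_normal_density (f b)))"
  let ?g = "\<lambda>f. \<Sum>b\<in>(Basis :: 'a set). f b *\<^sub>R b"
  interpret std: prob_space std_normal_distribution
    by (rule prob_space_normal_density) simp
  interpret std: product_sigma_finite "\<lambda>_::'a. std_normal_distribution" by unfold_locales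
  interpret lb: product_sigma_finite "\<lambda>_::'a. lborel :: real measure" by unfold_locales
  have P: "?D
      = (\<Pi>\<^sub>M b\<in>(Basis :: 'a set). std_normal_distribution)"
  proof (rule std.PiM_eqI)
    fix A :: "'a \<Rightarrow> real set" assume A: "\<And>i. i \<in> Basis \<Longrightarrow> A i \<in> sets std_normal_distribution"
    then have [measurable]: "Pi\<^sub>E Basis A \<in> sets (\<Pi>\<^sub>M b\<in>Basis. lborel)"
      by (intro sets_PiM_I_finite) auto
    have "emeasure (?D) (Pi\<^sub>E Basis A)
        = (\<integral>\<^sup>+f. (\<Prod>b\<in>Basis. ennreal (std_normal_density (f b)) * indicator (A b) (f b)) \<partial>(\<Pi>\<^sub>M b\<in>Basis. lborel))"
    proof (subst emeasure_density, measurable, rule nn_integral_cong)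
      fix f :: "'a \<Rightarrow> real" assume f: "f \<in> space (\<Pi>\<^sub>M b\<in>Basis. lborel)"
      have "(\<Prod>b\<in>Basis. indicator (A b) (f b)) = (indicator (Pi\<^sub>E Basis A) f :: ennreal)"
      proof (cases "f \<in> Pi\<^sub>E Basis A")
        case True
        then show ?thesis by (auto intro!: prod.neutral simp: PiE_iff)
      next
        case False
        then obtain b where "b \<in> Basis" "f b \<notin> A b" using f by (auto simp: space_PiM PiE_iff)
        then have "(\<Prod>b\<in>Basis. indicator (A b) (f b)) = (0 :: ennreal)"
          by (intro prod_zero) (auto intro!: bexI[of _ b])
        then show ?thesis using False by simp
      qed
      then show "ennreal (\<Prod>b\<in>Basis. std_normal_density (f b)) * indicator (Pi\<^sub>E Basis A) f
          = (\<Prod>b\<in>Basis. ennreal (std_normal_density (f b)) * indicator (A b) (f b))"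
        by (simp add: prod.distrib prod_ennreal)
    qed
    also have "\<dots> = (\<Prod>b\<in>Basis. \<integral>\<^sup>+t. ennreal (std_normal_density t) * indicator (A b) t \<partial>lborel)"
      using A by (intro lb.product_nn_integral_prod) auto
    also have "\<dots> = (\<Prod>b\<in>Basis. emeasure std_normal_distribution (A b))"
      using A by (intro prod.cong) (auto simp: emeasure_density)
    finally show "emeasure (?D) (Pi\<^sub>E Basis A)
        = (\<Prod>b\<in>Basis. emeasure std_normal_distribution (A b))" .
  qed (auto intro!: sets_PiM_cong)
  have [measurable]: "?g \<in> borel_measurable (\<Pi>\<^sub>M b\<in>Basis. lborel)" by measurable
  have "gauss = density (distr (\<Pi>\<^sub>M b\<in>Basis. lborel) borel ?g) (\<lambda>x. ennreal (\<Prod>b\<in>Basis. std_normal_density (x \<bullet> b)))"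
    unfolding gauss_def gauss_density_prod by (subst lborel_eq[where 'a='a]) (rule refl)
  also have "\<dots> = distr (density (\<Pi>\<^sub>M b\<in>Basis. lborel) (\<lambda>f. ennreal (\<Prod>b\<in>Basis. std_normal_density (?g f \<bullet> b)))) borel ?g"
    by (subst density_distr) simp_all
  also have "(\<lambda>f. ennreal (\<Prod>b\<in>Basis. std_normal_density (?g f \<bullet> b))) = (\<lambda>f. ennreal (\<Prod>b\<in>Basis. std_normal_density (f b)))"
    by (intro ext arg_cong[where f=ennreal] prod.cong) auto
  finally show ?thesis unfolding P by simp
qed

text \<open>Independence gives a product measure indexed by pairs of row and column, while the
  coordinates of the matrix space are indexed by the basis elements
  \<open>axis i (axis j 1)\<close>. The map \<open>h\<close> translates the latter into the former,
  so the two products are reindexings of each other.\<close>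

lemma std_gaussian_matrix_distr:
  fixes X :: "'a \<Rightarrow> real^'m^'n"
  assumes "prob_space M" and G: "std_gaussian_matrix M X"
  shows "X \<in> borel_measurable M" and "distr M borel X = gauss"
proof -
  interpret prob_space M by fact
  have ind: "indep_vars (\<lambda>_. borel) (\<lambda>(i, j) \<omega>. X \<omega> $ i $ j) UNIV"
    and dis: "\<And>i j. distributed M lborel (\<lambda>\<omega>. X \<omega> $ i $ j) std_normal_density"
    using G by (auto simp: std_gaussian_matrix_def)
  define h where "h = the_inv (\<lambda>(i::'n, j::'m). axis i (axis j (1::real)))"
  have inj: "inj (\<lambda>(i::'n, j::'m). axis i (axis j (1::real)))"
    by (auto simp: inj_on_def axis_eq_axis)
  have h: "h (axis i (axis j 1)) = (i, j)" for i j
    using the_inv_f_f[OF inj, of "(i, j)"] by (simp add: h_def)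
  have B: "(b :: real^'m^'n) \<in> Basis \<Longrightarrow> \<exists>i j. b = axis i (axis j 1)" for b
    by (auto simp: Basis_vec_def)
  have Xb: "X \<omega> \<bullet> b = (case h b of (i, j) \<Rightarrow> X \<omega> $ i $ j)" if "b \<in> Basis" for \<omega> b
    using B[OF that] by (auto simp: h inner_axis)
  have db: "distributed M lborel (\<lambda>\<omega>. X \<omega> \<bullet> b) std_normal_density" if "b \<in> Basis" for b
    using B[OF that] dis by (auto simp: inner_axis)
  then have mb: "(\<lambda>\<omega>. X \<omega> \<bullet> b) \<in> borel_measurable M" if "b \<in> Basis" for b
    using that distributed_measurable by fastforce
  then show X[measurable]: "X \<in> borel_measurable M"
    by (subst borel_measurable_euclidean_space) auto
  have inj_h: "inj_on h Basis"
    by (auto simp: inj_on_def h dest!: B)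
  have std: "prob_space std_normal_distribution"
    by (rule prob_space_normal_density) simp
  let ?Y = "\<lambda>\<omega>. \<lambda>(i, j)\<in>UNIV. X \<omega> $ i $ j"
  let ?r = "\<lambda>f. \<lambda>b\<in>Basis. f (h b)" and ?s = "\<lambda>f. \<Sum>b\<in>(Basis :: (real^'m^'n) set). f b *\<^sub>R b"
  have "distr M (\<Pi>\<^sub>M p\<in>UNIV. borel) (\<lambda>\<omega>. \<lambda>p\<in>UNIV. (case p of (i, j) \<Rightarrow> \<lambda>\<omega>. X \<omega> $ i $ j) \<omega>)
      = (\<Pi>\<^sub>M p\<in>UNIV. distr M borel (case p of (i, j) \<Rightarrow> \<lambda>\<omega>. X \<omega> $ i $ j))"
    using ind dis[THEN distributed_measurable] by (subst (asm) indep_vars_iff_distr_eq_PiM) auto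
  also have "\<dots> = (\<Pi>\<^sub>M p\<in>UNIV. std_normal_distribution)"
  proof (rule PiM_cong[OF refl])
    fix p :: "'n \<times> 'm"
    obtain i j where p: "p = (i, j)" by (cases p)
    have "distr M borel (\<lambda>\<omega>. X \<omega> $ i $ j) = distr M lborel (\<lambda>\<omega>. X \<omega> $ i $ j)"
      by (rule distr_cong) auto
    then show "distr M borel (case p of (i, j) \<Rightarrow> \<lambda>\<omega>. X \<omega> $ i $ j) = std_normal_distribution"
      using distributed_distr_eq_density[OF dis] by (simp add: p)
  qed
  finally have D: "distr M (\<Pi>\<^sub>M p\<in>UNIV. borel) ?Y = (\<Pi>\<^sub>M p\<in>UNIV. std_normal_distribution)"
    by (simp add: split_beta restrict_def)
  have "(gauss :: (real^'m^'n) measure) = distr (\<Pi>\<^sub>M b\<in>Basis. std_normal_distribution) borel ?s"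
    by (rule gauss_eq_distr_PiM[symmetric])
  also have "(\<Pi>\<^sub>M b\<in>(Basis :: (real^'m^'n) set). std_normal_distribution)
      = distr (\<Pi>\<^sub>M p\<in>UNIV. std_normal_distribution) (\<Pi>\<^sub>M b\<in>Basis. std_normal_distribution) ?r"
    by (rule distr_PiM_reindex[symmetric]) (auto simp: std inj_h)
  also have "\<dots> = distr (distr M (\<Pi>\<^sub>M p\<in>UNIV. borel) ?Y) (\<Pi>\<^sub>M b\<in>Basis. borel) ?r"
    unfolding D by (rule distr_cong) (auto intro!: sets_PiM_cong)
  also have "distr (distr (distr M (\<Pi>\<^sub>M p\<in>UNIV. borel) ?Y) (\<Pi>\<^sub>M b\<in>Basis. borel) ?r) borel ?s = distr M borel (?s \<circ> (?r \<circ> ?Y))"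
  proof -
    have [measurable]: "?Y \<in> M \<rightarrow>\<^sub>M (\<Pi>\<^sub>M p\<in>UNIV. borel)"
      using dis[THEN distributed_measurable] by (intro measurable_restrict) auto
    have [measurable]: "?r \<in> (\<Pi>\<^sub>M p\<in>UNIV. borel) \<rightarrow>\<^sub>M (\<Pi>\<^sub>M b\<in>Basis. borel)"
      by (intro measurable_restrict measurable_component_singleton) auto
    show ?thesis by (simp add: distr_distr)
  qed
  also have "?s \<circ> (?r \<circ> ?Y) = X"
  proof
    fix \<omega>
    have "(?s \<circ> (?r \<circ> ?Y)) \<omega> = (\<Sum>b\<in>Basis. (X \<omega> \<bullet> b) *\<^sub>R b)"
      by (simp add: Xb restrict_def)
    then show "(?s \<circ> (?r \<circ> ?Y)) \<omega> = X \<omega>" by (simp add: euclidean_representation)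
  qed
  finally show "distr M borel X = gauss" by simp
qed

section \<open>Moments of the Gaussian measure\<close>

lemma nn_integral_gauss_inner:
  fixes c :: "'a::euclidean_space" and \<phi> :: "real \<Rightarrow> ennreal"
  assumes "norm c = 1" and "\<phi> \<in> borel_measurable borel"
  shows "(\<integral>\<^sup>+x. \<phi> (c \<bullet> x) \<partial>gauss) = (\<integral>\<^sup>+t. \<phi> t \<partial>gauss)"
  using assms
  by (intro nn_integral_gauss_coisometry[where f'="\<lambda>t. t *\<^sub>R c"]) (auto simp: inner_commute norm_eq_1)

text \<open>The component along the unit vector \<open>w\<close> is independent of the orthogonal
  component, so it may be replaced by a fresh variable \<open>t\<close>. In this form the hyperplane
  orthogonal to \<open>w\<close> needs no type of its own.\<close>

lemma nn_integral_gauss_replace_direction: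
  fixes w :: "'a::euclidean_space" and \<phi> :: "'a \<Rightarrow> ennreal"
  assumes w: "norm w = 1" and [measurable]: "\<phi> \<in> borel_measurable borel"
  shows "(\<integral>\<^sup>+x. \<phi> x \<partial>gauss) = (\<integral>\<^sup>+x. (\<integral>\<^sup>+t. \<phi> (x - (w \<bullet> x) *\<^sub>R w + t *\<^sub>R w) \<partial>gauss) \<partial>gauss)"
proof -
  let ?f = "\<lambda>z :: 'a \<times> real. fst z - (w \<bullet> fst z) *\<^sub>R w + snd z *\<^sub>R w"
  have "(\<integral>\<^sup>+x. \<phi> x \<partial>gauss) = (\<integral>\<^sup>+z. \<phi> (?f z) \<partial>gauss)"
    using w by (intro nn_integral_gauss_coisometry[where f'="\<lambda>x. (x - (w \<bullet> x) *\<^sub>R w, w \<bullet> x)", symmetric])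
      (auto simp: inner_prod_def inner_simps norm_eq_1 inner_commute)
  also have "\<dots> = (\<integral>\<^sup>+x. (\<integral>\<^sup>+t. \<phi> (x - (w \<bullet> x) *\<^sub>R w + t *\<^sub>R w) \<partial>gauss) \<partial>gauss)"
  proof (subst nn_integral_gauss_prod)
    have "?f \<in> borel_measurable borel"
      by (intro borel_measurable_continuous_onI continuous_intros)
    then show "(\<lambda>z. \<phi> (?f z)) \<in> borel_measurable borel" by measurable
  qed simp
  finally show ?thesis .
qed

text \<open>Tilting the standard density by exp(-s t^2) gives \<open>\<sigma>\<close> times the
  centred normal density of variance 1 / (1 + 2 s); the total mass \<open>\<sigma>\<close>
  remains.\<close>

lemma nn_integral_gauss_exp_square:
  assumes s: "s > - 1 / 2"
  shows "(\<integral>\<^sup>+t. ennreal (exp (- (s * t\<^sup>2))) \<partial>gauss) = ennreal (1 / sqrt (1 + 2 * s))"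
proof -
  define \<sigma> where "\<sigma> = 1 / sqrt (1 + 2 * s)"
  have \<sigma>: "\<sigma> > 0" "\<sigma>\<^sup>2 = 1 / (1 + 2 * s)" using s by (simp_all add: \<sigma>_def power_divide)
  interpret prob_space "density lborel (normal_density 0 \<sigma>)" by (rule prob_space_normal_density) fact
  have 1: "(\<integral>\<^sup>+t. ennreal (normal_density 0 \<sigma> t) \<partial>lborel) = 1"
    using emeasure_space_1 by (simp add: emeasure_density)
  have eq: "std_normal_density t * exp (- (s * t\<^sup>2)) = \<sigma> * normal_density 0 \<sigma> t" for t
  proof -
    have "exp (- t\<^sup>2 / 2) * exp (- (s * t\<^sup>2)) = exp (- (t - 0)\<^sup>2 / (2 * \<sigma>\<^sup>2))"
      using s by (simp add: \<sigma> exp_add[symmetric] field_simps)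
    then show ?thesis using \<sigma> s
      by (simp add: normal_density_def \<sigma>(2)) (simp add: \<sigma>_def real_sqrt_mult real_sqrt_divide)
  qed
  have "(\<integral>\<^sup>+t. ennreal (exp (- (s * t\<^sup>2))) \<partial>gauss) = (\<integral>\<^sup>+t. ennreal (std_normal_density t * exp (- (s * t\<^sup>2))) \<partial>lborel)"
    by (simp add: gauss_real nn_integral_density ennreal_mult')
  also have "\<dots> = ennreal \<sigma>"
    using \<sigma> by (simp add: eq ennreal_mult nn_integral_cmult 1)
  finally show ?thesis by (simp add: \<sigma>_def)
qed

text \<open>The value at negative \<open>s\<close> provides the exponential moments used for integrability, the integral over
  positive \<open>s\<close> the moments of the inverse.\<close>

lemma nn_integral_gauss_exp_sum_squares:
  fixes R :: "'a::euclidean_space set"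
  assumes s: "s > - 1 / 2" and "finite R" and "pairwise orthogonal R" and "\<And>w. w \<in> R \<Longrightarrow> norm w = 1"
  shows "(\<integral>\<^sup>+x. ennreal (exp (- (s * (\<Sum>w\<in>R. (w \<bullet> x)\<^sup>2)))) \<partial>gauss) = ennreal ((1 / sqrt (1 + 2 * s)) ^ card R)"
  using assms(2-)
proof (induction R)
  case empty
  then show ?case using gauss.emeasure_space_1[where 'a='a] by simp
next
  case (insert u R)
  let ?q = "\<lambda>x. \<Sum>w\<in>R. (w \<bullet> x)\<^sup>2"
  have u: "norm u = 1" using insert by auto
  have orth: "w \<bullet> u = 0" if "w \<in> R" for w
    using insert that by (auto simp: pairwise_insert orthogonal_def)
  have IH: "(\<integral>\<^sup>+x. ennreal (exp (- (s * ?q x))) \<partial>gauss) = ennreal ((1 / sqrt (1 + 2 * s)) ^ card R)"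
    using insert by (intro insert.IH) (auto simp: pairwise_insert)
  have eq: "exp (- (s * (\<Sum>w\<in>insert u R. (w \<bullet> (x - (u \<bullet> x) *\<^sub>R u + t *\<^sub>R u))\<^sup>2))) = exp (- (s * ?q x)) * exp (- (s * t\<^sup>2))" for x t
  proof -
    have "(\<Sum>w\<in>insert u R. (w \<bullet> (x - (u \<bullet> x) *\<^sub>R u + t *\<^sub>R u))\<^sup>2) = t\<^sup>2 + ?q x"
      using insert(1,2) u by (simp add: inner_add_right inner_diff_right orth norm_eq_1)
    then show ?thesis by (simp add: exp_add[symmetric] algebra_simps)
  qed
  have "(\<integral>\<^sup>+x. ennreal (exp (- (s * (\<Sum>w\<in>insert u R. (w \<bullet> x)\<^sup>2)))) \<partial>gauss)
      = (\<integral>\<^sup>+x. (\<integral>\<^sup>+t. ennreal (exp (- (s * ?q x))) * ennreal (exp (- (s * t\<^sup>2))) \<partial>gauss) \<partial>gauss)"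
    by (subst nn_integral_gauss_replace_direction[OF u], measurable) (simp only: eq ennreal_mult' exp_ge_zero)
  also have "\<dots> = (\<integral>\<^sup>+x. ennreal (exp (- (s * ?q x))) \<partial>gauss) * (\<integral>\<^sup>+t. ennreal (exp (- (s * t\<^sup>2))) \<partial>gauss)"
    by (simp add: nn_integral_cmult nn_integral_multc)
  also have "\<dots> = ennreal ((1 / sqrt (1 + 2 * s)) ^ card (insert u R))"
    using s insert(1,2) by (simp add: IH nn_integral_gauss_exp_square ennreal_mult'[symmetric] mult.commute)
  finally show ?case .
qed

lemma norm_sq_eq_sum_Basis: "(norm x)\<^sup>2 = (\<Sum>b\<in>Basis. (b \<bullet> x)\<^sup>2)" for x :: "'a::euclidean_space"
  unfolding power2_norm_eq_inner by (subst euclidean_inner) (simp add: power2_eq_square inner_commute)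

lemma integrable_gauss_exp: "integrable gauss (\<lambda>x::'a::euclidean_space. exp ((norm x)\<^sup>2 / 4))"
proof (rule integrableI_nonneg)
  have "(\<integral>\<^sup>+(x::'a). ennreal (exp ((norm x)\<^sup>2 / 4)) \<partial>gauss) = ennreal ((1 / sqrt (1 + 2 * (- 1 / 4))) ^ card (Basis :: 'a set))"
    using nn_integral_gauss_exp_sum_squares[of "- 1 / 4" "Basis :: 'a set"]
    by (simp add: norm_sq_eq_sum_Basis pairwise_def orthogonal_def inner_Basis)
  then show "(\<integral>\<^sup>+(x::'a). ennreal (exp ((norm x)\<^sup>2 / 4)) \<partial>gauss) < \<infinity>"
    by (simp add: ennreal_less_top)
qed auto

lemma cube_le_exp: "\<bar>t\<bar> ^ 3 \<le> 16 * exp (t\<^sup>2 / 4)" for t :: real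
proof -
  define u where "u = \<bar>t\<bar> / 2"
  have u: "u \<ge> 0" "\<bar>t\<bar> = 2 * u" "t\<^sup>2 / 4 = u\<^sup>2"
    by (simp_all add: u_def power2_eq_square)
  have "1 + u\<^sup>2 + (u\<^sup>2)\<^sup>2 / 2 \<le> exp (u\<^sup>2)"
    by (rule exp_lower_Taylor_quadratic) simp
  moreover have "2 * (u * u\<^sup>2) \<le> u\<^sup>2 + (u\<^sup>2)\<^sup>2"
    using zero_le_power2[of "u * (u - 1)"] by (simp add: algebra_simps power2_eq_square)
  moreover have "0 \<le> u\<^sup>2" "0 \<le> exp (u\<^sup>2)" by simp_all
  \<comment> \<open>Substituting t = 2 u in the cube contributes a factor 8, this crude bound a
    factor 2; together they make 16.\<close>
  ultimately have "u * u\<^sup>2 \<le> 2 * exp (u\<^sup>2)" by linarith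
  moreover have "\<bar>t\<bar> ^ 3 = 8 * (u * u\<^sup>2)"
    unfolding u(2) by (simp add: power3_eq_cube power2_eq_square)
  ultimately show ?thesis unfolding u(3) by linarith
qed

text \<open>The third power controls the Taylor remainder in
  \<open>integral_gauss_lse_expansion\<close>, the first power all functions of linear
  growth.\<close>

lemma integrable_gauss_power_le_3:
  assumes "k \<le> 3"
  shows "integrable gauss (\<lambda>x::'a::euclidean_space. norm x ^ k)"
proof (rule Bochner_Integration.integrable_bound)
  show "integrable gauss (\<lambda>x::'a. 17 * exp ((norm x)\<^sup>2 / 4))"
    using integrable_gauss_exp by (intro integrable_mult_right)
  show "AE x::'a in gauss. norm (norm x ^ k) \<le> norm (17 * exp ((norm x)\<^sup>2 / 4))"
  proof (intro AE_I2)
    fix x :: 'a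
    have "norm x ^ k \<le> 1 + norm x ^ 3"
    proof (cases "norm x \<le> 1")
      case True
      then have "norm x ^ k \<le> 1" by (simp add: power_le_one)
      then show ?thesis by (smt (verit) norm_ge_zero zero_le_power)
    next
      case False
      then have "norm x ^ k \<le> norm x ^ 3" using assms by (intro power_increasing) auto
      then show ?thesis by simp
    qed
    moreover have "norm x ^ 3 \<le> 16 * exp ((norm x)\<^sup>2 / 4)" using cube_le_exp[of "norm x"] by simp
    moreover have "1 \<le> exp ((norm x)\<^sup>2 / 4)" by simp
    ultimately have "norm x ^ k \<le> 17 * exp ((norm x)\<^sup>2 / 4)" by linarith
    then show "norm (norm x ^ k) \<le> norm (17 * exp ((norm x)\<^sup>2 / 4))" by simp
  qed
qed simp

lemma integrable_gauss_linear_growth: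
  fixes f :: "'a::euclidean_space \<Rightarrow> real"
  assumes "f \<in> borel_measurable borel" and "\<And>x. \<bar>f x\<bar> \<le> a + b * norm x"
  shows "integrable gauss f"
proof (rule Bochner_Integration.integrable_bound)
  show "integrable gauss (\<lambda>x::'a. a + b * norm x)"
    using integrable_gauss_power_le_3[of 1] by (intro Bochner_Integration.integrable_add integrable_mult_right) auto
  show "AE x in gauss. norm (f x) \<le> norm (a + b * norm x)"
    using assms(2) by (intro AE_I2) (metis abs_ge_self order_trans real_norm_def)
qed (use assms in simp)

lemma integrable_gauss_inner: "integrable gauss (\<lambda>x. c \<bullet> x)"
  by (rule integrable_gauss_linear_growth[where a=0 and b="norm c"]) (auto simp: Cauchy_Schwarz_ineq2)

lemma integral_gauss_inner: "(\<integral>x. c \<bullet> x \<partial>gauss) = (0::real)"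
proof -
  have "orthogonal_transformation (uminus :: 'a \<Rightarrow> 'a)"
    by (simp add: orthogonal_transformation_def linear_uminus)
  then have "(\<integral>x. c \<bullet> x \<partial>gauss) = (\<integral>x. c \<bullet> x \<partial>distr gauss borel (uminus :: 'a \<Rightarrow> 'a))"
    by (simp add: gauss_distr_orthogonal_transformation)
  also have "\<dots> = - (\<integral>x. c \<bullet> x \<partial>gauss)"
    by (subst integral_distr) auto
  finally show ?thesis by simp
qed

lemma nn_integral_gauss_inner_sq: "(\<integral>\<^sup>+x. ennreal ((c \<bullet> x)\<^sup>2) \<partial>gauss) = ennreal ((norm c)\<^sup>2)"
proof (cases "c = 0")
  case False
  define u where "u = c /\<^sub>R norm c"
  have u: "norm u = 1" "c = norm c *\<^sub>R u" using False by (simp_all add: u_def)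
  have "(\<integral>\<^sup>+t. ennreal (t\<^sup>2) \<partial>(gauss :: real measure)) = 1"
    using std_normal_distribution_even_moments[of 1] unfolding gauss_real
    by (subst nn_integral_eq_integral) auto
  then have 1: "(\<integral>\<^sup>+x. ennreal ((u \<bullet> x)\<^sup>2) \<partial>gauss) = 1"
    by (subst nn_integral_gauss_inner[OF u(1)]) simp_all
  have "(c \<bullet> x)\<^sup>2 = (norm c)\<^sup>2 * (u \<bullet> x)\<^sup>2" for x
    by (subst u(2)) (simp add: power_mult_distrib)
  then show ?thesis
    by (simp add: ennreal_mult nn_integral_cmult 1)
qed simp

lemma integrable_gauss_inner_sq: "integrable gauss (\<lambda>x. (c \<bullet> x)\<^sup>2)"
  by (rule integrableI_nonneg) (auto simp: nn_integral_gauss_inner_sq)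

lemma integral_gauss_inner_sq: "(\<integral>x. (c \<bullet> x)\<^sup>2 \<partial>gauss) = (norm c)\<^sup>2"
  by (subst integral_eq_nn_integral) (auto simp: nn_integral_gauss_inner_sq)

text \<open>The Laplace representation of 1 / y. In \<open>ennreal\<close> it includes y = 0, where
  both sides are infinite, so no null set has to be removed before integrating over
  \<open>y\<close>.\<close>

lemma inverse_eq_nn_integral_exp:
  assumes "y \<ge> 0"
  shows "inverse (ennreal y) = (\<integral>\<^sup>+s. ennreal (exp (- (s * y))) * indicator {0..} s \<partial>lborel)"
proof (cases "y = 0")
  case True
  have "(\<integral>\<^sup>+s. indicator {0::real..} s \<partial>lborel) = \<infinity>"
  proof (rule ccontr)
    assume "(\<integral>\<^sup>+s. indicator {0::real..} s \<partial>lborel) \<noteq> \<infinity>"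
    then obtain r where r: "r \<ge> 0" "emeasure lborel {0::real..} = ennreal r"
      by (cases "emeasure lborel {0::real..}") auto
    have "emeasure lborel {0..r + 1} \<le> emeasure lborel {0::real..}"
      by (rule emeasure_mono) auto
    then show False using r by (simp add: ennreal_le_iff)
  qed
  then show ?thesis using True by simp
next
  case False
  then have y: "y > 0" using assms by simp
  have "(\<integral>\<^sup>+s. ennreal (exp (- (s * y))) * indicator {0..} s \<partial>lborel) = ennreal (0 - (- exp (- (0 * y)) / y))"
  proof (rule nn_integral_FTC_atLeast)
    show "DERIV (\<lambda>s. - exp (- (s * y)) / y) s :> exp (- (s * y))" for s
      using y by (auto intro!: derivative_eq_intros)
    show "((\<lambda>s. - exp (- (s * y)) / y) \<longlongrightarrow> 0) at_top"
    proof -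
      have "filterlim (\<lambda>s. - (s * y)) at_bot at_top"
        using y by (auto simp: filterlim_uminus_at_bot intro!: filterlim_at_top_mult_tendsto_pos[OF tendsto_const] filterlim_ident)
      then have "((\<lambda>s. exp (- (s * y))) \<longlongrightarrow> 0) at_top"
        by (rule filterlim_compose[OF exp_at_bot])
      then have "((\<lambda>s. - exp (- (s * y)) / y) \<longlongrightarrow> - 0 / y) at_top"
        using y by (intro tendsto_intros) auto
      then show ?thesis by simp
    qed
  qed auto
  then show ?thesis using y by (simp add: inverse_ennreal divide_inverse)
qed

text \<open>The mean of an inverse chi-squared variable with d = \<open>card R\<close> degrees of
  freedom. The Laplace representation and Fubini reduce it to the integral of (1 + 2 s)^(-d/2) over
  s >= 0, which is finite for d >= 3 and then equals 1 / (d - 2).\<close>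

lemma nn_integral_gauss_inverse_sum_squares:
  fixes R :: "'a::euclidean_space set"
  assumes R: "finite R" "pairwise orthogonal R" "\<And>w. w \<in> R \<Longrightarrow> norm w = 1" and card: "card R \<ge> 3"
  shows "(\<integral>\<^sup>+x. inverse (ennreal (\<Sum>w\<in>R. (w \<bullet> x)\<^sup>2)) \<partial>gauss) = ennreal (1 / (real (card R) - 2))"
proof -
  let ?q = "\<lambda>x. \<Sum>w\<in>R. (w \<bullet> x)\<^sup>2"
  define a where "a = real (card R) / 2"
  have a: "a > 1" using card by (simp add: a_def)
  interpret pair_sigma_finite "gauss :: 'a measure" "lborel :: real measure" by unfold_locales
  have "(\<integral>\<^sup>+x. inverse (ennreal (?q x)) \<partial>gauss)
      = (\<integral>\<^sup>+x. (\<integral>\<^sup>+s. ennreal (exp (- (s * ?q x))) * indicator {0..} s \<partial>lborel) \<partial>gauss)"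
    by (intro nn_integral_cong inverse_eq_nn_integral_exp sum_nonneg) auto
  also have "\<dots> = (\<integral>\<^sup>+s. (\<integral>\<^sup>+x. ennreal (exp (- (s * ?q x))) * indicator {0..} s \<partial>gauss) \<partial>lborel)"
    by (rule Fubini'[symmetric]) measurable
  also have "\<dots> = (\<integral>\<^sup>+s. ennreal ((1 + 2 * s) powr (- a)) * indicator {0..} s \<partial>lborel)"
  proof (rule nn_integral_cong)
    fix s :: real
    show "(\<integral>\<^sup>+x. ennreal (exp (- (s * ?q x))) * indicator {0..} s \<partial>gauss) = ennreal ((1 + 2 * s) powr (- a)) * indicator {0..} s"
    proof (cases "s \<ge> 0")
      case True
      have "(1 / sqrt (1 + 2 * s)) ^ card R = (1 + 2 * s) powr (- a)"
        using True by (simp add: powr_half_sqrt[symmetric] powr_minus power_one_over powr_realpow[symmetric] powr_powr a_def inverse_eq_divide)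
      then show ?thesis using nn_integral_gauss_exp_sum_squares[of s R] R True by simp
    qed simp
  qed
  also have "\<dots> = ennreal (0 - (- ((1 + 2 * 0) powr (1 - a)) / (2 * (a - 1))))"
  proof (rule nn_integral_FTC_atLeast)
    show "DERIV (\<lambda>s. - ((1 + 2 * s) powr (1 - a)) / (2 * (a - 1))) s :> (1 + 2 * s) powr (- a)" if "0 \<le> s" for s
    proof -
      have "DERIV (\<lambda>s. 1 + 2 * s) s :> 2" by (auto intro!: derivative_eq_intros)
      then have "DERIV (\<lambda>s. (1 + 2 * s) powr (1 - a)) s :> (1 - a) * (1 + 2 * s) powr (1 - a - of_nat 1) * 2"
        using that by (intro DERIV_fun_powr) auto
      then have "DERIV (\<lambda>s. - ((1 + 2 * s) powr (1 - a)) / (2 * (a - 1))) s :>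
          - ((1 - a) * (1 + 2 * s) powr (1 - a - of_nat 1) * 2) / (2 * (a - 1))"
        by (intro DERIV_cdivide DERIV_minus)
      moreover have "- ((1 - a) * (1 + 2 * s) powr (1 - a - of_nat 1) * 2) / (2 * (a - 1)) = (1 + 2 * s) powr (- a)"
        using a by (simp add: field_simps)
      ultimately show ?thesis by simp
    qed
    show "((\<lambda>s. - ((1 + 2 * s) powr (1 - a)) / (2 * (a - 1))) \<longlongrightarrow> 0) at_top"
    proof -
      have "filterlim (\<lambda>s. 1 + 2 * s :: real) at_top at_top"
        by (intro filterlim_tendsto_add_at_top[OF tendsto_const] filterlim_tendsto_pos_mult_at_top[OF tendsto_const]) (auto intro: filterlim_ident)
      then have "((\<lambda>s. (1 + 2 * s) powr (1 - a)) \<longlongrightarrow> 0) at_top"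
        using a by (intro tendsto_neg_powr) auto
      then have "((\<lambda>s. - ((1 + 2 * s) powr (1 - a)) / (2 * (a - 1))) \<longlongrightarrow> - 0 / (2 * (a - 1))) at_top"
        using a by (intro tendsto_intros) auto
      then show ?thesis by simp
    qed
  qed auto
  also have "0 - (- ((1 + 2 * 0) powr (1 - a)) / (2 * (a - 1))) = 1 / (real (card R) - 2)"
    by (simp add: a_def right_diff_distrib)
  finally show ?thesis .
qed

section \<open>Comparison of Gaussian processes\<close>

text \<open>It exceeds the maximum by at most \<open>ln (card I)\<close>, a constant independent of
  \<open>w\<close>, so the excess becomes negligible once the arguments are scaled up.\<close>

definition lse :: "'i set \<Rightarrow> ('i \<Rightarrow> real) \<Rightarrow> real" where
  "lse I w = ln (\<Sum>i\<in>I. exp (w i))"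

lemma lse_ge:
  assumes "finite I" "i \<in> I"
  shows "w i \<le> lse I w"
proof -
  have "exp (w i) \<le> (\<Sum>i\<in>I. exp (w i))"
    using assms by (intro member_le_sum) auto
  then have "ln (exp (w i)) \<le> lse I w"
    unfolding lse_def by (subst ln_le_cancel_iff) (auto intro: less_le_trans[OF exp_gt_zero])
  then show ?thesis by simp
qed

lemma lse_le:
  assumes "finite I" "I \<noteq> {}" and "\<And>i. i \<in> I \<Longrightarrow> w i \<le> b"
  shows "lse I w \<le> ln (card I) + b"
proof -
  have "(\<Sum>i\<in>I. exp (w i)) \<le> card I * exp b"
    using assms sum_bounded_above[of I "\<lambda>i. exp (w i)" "exp b"] by simp
  then have "lse I w \<le> ln (card I * exp b)"
    unfolding lse_def using assms by (subst ln_le_cancel_iff) (auto intro!: sum_pos simp: card_gt_0_iff)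
  then show ?thesis using assms by (simp add: ln_mult card_gt_0_iff)
qed

lemma abs_lse_le:
  assumes "finite I" "I \<noteq> {}"
  shows "\<bar>lse I w\<bar> \<le> ln (card I) + (\<Sum>i\<in>I. \<bar>w i\<bar>)"
proof -
  obtain j where j: "j \<in> I" using assms by auto
  have le: "\<bar>w i\<bar> \<le> (\<Sum>i\<in>I. \<bar>w i\<bar>)" if "i \<in> I" for i
    using assms that by (intro member_le_sum) auto
  have "lse I w \<le> ln (card I) + (\<Sum>i\<in>I. \<bar>w i\<bar>)"
    using assms le by (intro lse_le) (auto simp: abs_le_iff)
  moreover have "- (\<Sum>i\<in>I. \<bar>w i\<bar>) \<le> lse I w"
    using lse_ge[OF assms(1) j, of w] le[OF j] by linarith
  moreover have "0 \<le> ln (real (card I))"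
    using assms by (simp add: Suc_le_eq card_gt_0_iff)
  ultimately show ?thesis by linarith
qed

text \<open>As a function of \<delta> this is the cumulant generating function of \<open>u\<close>
  under the weights \<open>q\<close>. Its derivatives are the mean, the variance and the third
  cumulant under tilted weights. The third cumulant is at most (1 + 3 + 2) B^3 in absolute value,
  and this 6 cancels the 3! of the remainder.\<close>

lemma log_sum_exp_Taylor:
  fixes q u :: "'i \<Rightarrow> real"
  assumes "finite I" and q: "\<And>i. i \<in> I \<Longrightarrow> q i \<ge> 0" "sum q I = 1"
    and u: "\<And>i. i \<in> I \<Longrightarrow> \<bar>u i\<bar> \<le> B" and "\<delta> > 0"
  defines "m k \<equiv> \<Sum>i\<in>I. q i * u i ^ k"
  shows "\<bar>ln (\<Sum>i\<in>I. q i * exp (\<delta> * u i)) - (\<delta> * m 1 + \<delta>\<^sup>2 / 2 * (m 2 - (m 1)\<^sup>2))\<bar> \<le> \<delta> ^ 3 * B ^ 3"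
proof -
  \<comment> \<open>\<open>N 0\<close> is the moment generating function of \<open>u\<close> under
    \<open>q\<close>, and \<open>N k\<close> is its k-th derivative.\<close>
  define N where "N k s = (\<Sum>i\<in>I. q i * u i ^ k * exp (s * u i))" for k s
  have I: "I \<noteq> {}" using q by auto
  then have B: "B \<ge> 0" using u by fastforce
  have N0: "N 0 s > 0" for s
  proof -
    obtain i where i: "i \<in> I" "q i > 0"
      using q by (metis less_eq_real_def sum.neutral zero_neq_one)
    then have "0 < q i * u i ^ 0 * exp (s * u i)" by simp
    also have "\<dots> \<le> N 0 s" unfolding N_def
      using i assms(1) q(1) by (intro member_le_sum) auto
    finally show ?thesis .
  qed
  have dN: "DERIV (N k) s :> N (Suc k) s" for k s
    unfolding N_def by (rule derivative_eq_intros refl | simp add: mult_ac)+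
  have bd: "\<bar>N k s / N 0 s\<bar> \<le> B ^ k" for k s
  proof -
    have "\<bar>N k s\<bar> \<le> (\<Sum>i\<in>I. \<bar>q i * u i ^ k * exp (s * u i)\<bar>)"
      unfolding N_def by (rule sum_abs)
    also have "\<dots> \<le> (\<Sum>i\<in>I. B ^ k * (q i * u i ^ 0 * exp (s * u i)))"
    proof (rule sum_mono)
      fix i assume i: "i \<in> I"
      have "(q i * exp (s * u i)) * \<bar>u i\<bar> ^ k \<le> (q i * exp (s * u i)) * B ^ k"
        using q(1)[OF i] u[OF i] by (intro mult_left_mono power_mono) auto
      then show "\<bar>q i * u i ^ k * exp (s * u i)\<bar> \<le> B ^ k * (q i * u i ^ 0 * exp (s * u i))"
        using q(1)[OF i] by (simp add: abs_mult power_abs mult_ac)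
    qed
    also have "\<dots> = B ^ k * N 0 s" by (simp add: N_def sum_distrib_left)
    finally show ?thesis using N0[of s] by (simp add: abs_divide divide_le_eq)
  qed
  \<comment> \<open>The derivatives of \<open>ln (N 0 s)\<close> written out in moments: for j = 1,
    2, 3 these are the cumulants. The formula for j = 3 also fills the larger indices, which
    Maclaurin's formula of order 3 does not reach.\<close>
  define D :: "nat \<Rightarrow> real \<Rightarrow> real" where "D = (\<lambda>j s. if j = 0 then ln (N 0 s)
    else if j = 1 then N 1 s / N 0 s
    else if j = 2 then N 2 s / N 0 s - (N 1 s / N 0 s)\<^sup>2
    else N 3 s / N 0 s - 3 * (N 1 s / N 0 s) * (N 2 s / N 0 s) + 2 * (N 1 s / N 0 s) ^ 3)"
  have dq: "DERIV (\<lambda>s. N k s / N 0 s) s :> N (Suc k) s / N 0 s - (N k s / N 0 s) * (N 1 s / N 0 s)" for k s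
    using N0[of s] by (auto intro!: derivative_eq_intros dN simp: field_simps)
  have der: "DERIV (D j) s :> D (Suc j) s" if j3: "j < 3" for j s
  proof -
    consider "j = 0" | "j = 1" | "j = 2" using j3 by linarith
    then show ?thesis
    proof cases
      case 1
      then have "D j = (\<lambda>s. ln (N 0 s))" "D (Suc j) s = N 1 s / N 0 s" by (simp_all add: D_def fun_eq_iff)
      then show ?thesis using N0[of s] dN[of 0 s] by (auto intro!: derivative_eq_intros)
    next
      case 2
      then have "D j = (\<lambda>s. N 1 s / N 0 s)" "D (Suc j) s = N (Suc 1) s / N 0 s - (N 1 s / N 0 s) * (N 1 s / N 0 s)"
        by (simp_all add: D_def fun_eq_iff power2_eq_square numeral_2_eq_2)
      then show ?thesis using dq[of 1 s] by simp
    next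
      case 3
      then have "D j = (\<lambda>s. N 2 s / N 0 s - (N 1 s / N 0 s)\<^sup>2)" by (simp add: D_def fun_eq_iff)
      moreover have "DERIV (\<lambda>s. N 2 s / N 0 s - (N 1 s / N 0 s)\<^sup>2) s :>
          (N (Suc 2) s / N 0 s - (N 2 s / N 0 s) * (N 1 s / N 0 s)) -
          of_nat 2 * ((N (Suc 1) s / N 0 s - (N 1 s / N 0 s) * (N 1 s / N 0 s)) * (N 1 s / N 0 s) ^ (2 - Suc 0))"
        by (intro DERIV_diff DERIV_power dq)
      moreover have "N (Suc 2) = N 3" "N (Suc 1) = N 2" by (simp_all add: numeral_3_eq_3 numeral_2_eq_2)
      ultimately show ?thesis using 3 by (simp add: D_def algebra_simps power3_eq_cube)
    qed
  qed
  obtain t where t: "0 < t" "t < \<delta>"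
    "ln (N 0 \<delta>) = (\<Sum>j<3. D j 0 / fact j * \<delta> ^ j) + D 3 t / fact 3 * \<delta> ^ 3"
    using Maclaurin[of \<delta> 3 D "\<lambda>s. ln (N 0 s)"] \<open>\<delta> > 0\<close> der by (auto simp: D_def fun_eq_iff)
  have m: "N k 0 = m k" for k by (simp add: N_def m_def)
  have m0: "m 0 = 1" using q by (simp add: m_def)
  have "(\<Sum>j<3. D j 0 / fact j * \<delta> ^ j) = \<delta> * m 1 + \<delta>\<^sup>2 / 2 * (m 2 - (m 1)\<^sup>2)"
    by (simp add: D_def numeral_3_eq_3 m m0) (simp add: numeral_2_eq_2)
  moreover have "\<bar>D 3 t\<bar> \<le> 6 * B ^ 3"
  proof -
    let ?a = "N 1 t / N 0 t" and ?b = "N 2 t / N 0 t" and ?c = "N 3 t / N 0 t"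
    have a: "\<bar>?a\<bar> \<le> B" and b: "\<bar>?b\<bar> \<le> B\<^sup>2" and c: "\<bar>?c\<bar> \<le> B ^ 3"
      using bd[of 1 t] bd[of 2 t] bd[of 3 t] by simp_all
    have "\<bar>?a * ?b\<bar> \<le> B * B\<^sup>2" unfolding abs_mult using a b B by (intro mult_mono) auto
    moreover have "\<bar>?a ^ 3\<bar> \<le> B ^ 3" unfolding power_abs using a by (intro power_mono) auto
    moreover have "B * B\<^sup>2 = B ^ 3" by (simp add: power2_eq_square power3_eq_cube)
    moreover have "D 3 t = ?c - 3 * (?a * ?b) + 2 * ?a ^ 3" by (simp add: D_def)
    ultimately show ?thesis using c by linarith
  qed
  then have "\<bar>D 3 t / fact 3 * \<delta> ^ 3\<bar> \<le> \<delta> ^ 3 * B ^ 3"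
    using \<open>\<delta> > 0\<close> by (simp add: abs_mult fact_numeral mult.commute)
  moreover have "(\<Sum>i\<in>I. q i * exp (\<delta> * u i)) = N 0 \<delta>" by (simp add: N_def)
  ultimately show ?thesis using t(3) by simp
qed

text \<open>The variance is half the mean squared distance of two independent copies. It turns the
  second order term of the expansion into pairwise distances, which is all that the comparison
  hypothesis controls.\<close>

lemma weighted_variance_pairs:
  fixes c :: "'i \<Rightarrow> 'a::real_inner"
  assumes q: "sum q I = (1::real)"
  shows "(\<Sum>i\<in>I. q i * (norm (c i))\<^sup>2) - (norm (\<Sum>i\<in>I. q i *\<^sub>R c i))\<^sup>2 = (\<Sum>i\<in>I. \<Sum>j\<in>I. q i * q j * (norm (c i - c j))\<^sup>2) / 2"
proof -
  have "(\<Sum>i\<in>I. \<Sum>j\<in>I. q i * q j * (norm (c i - c j))\<^sup>2)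
      = (\<Sum>i\<in>I. \<Sum>j\<in>I. q j * (q i * (norm (c i))\<^sup>2)) + (\<Sum>i\<in>I. \<Sum>j\<in>I. q i * (q j * (norm (c j))\<^sup>2))
        - 2 * (\<Sum>i\<in>I. \<Sum>j\<in>I. (q i *\<^sub>R c i) \<bullet> (q j *\<^sub>R c j))"
    unfolding sum_distrib_left sum.distrib[symmetric] sum_subtractf[symmetric]
    by (intro sum.cong refl) (simp add: power2_norm_eq_inner inner_diff_left inner_diff_right inner_commute algebra_simps)
  also have "(\<Sum>i\<in>I. \<Sum>j\<in>I. q j * (q i * (norm (c i))\<^sup>2)) = (\<Sum>i\<in>I. q i * (norm (c i))\<^sup>2)"
    by (simp add: sum_distrib_right[symmetric] q)
  also have "(\<Sum>i\<in>I. \<Sum>j\<in>I. q i * (q j * (norm (c j))\<^sup>2)) = (\<Sum>i\<in>I. q i * (norm (c i))\<^sup>2)"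
    by (simp add: sum_distrib_left[symmetric] sum_distrib_right[symmetric] q)
  also have "(\<Sum>i\<in>I. \<Sum>j\<in>I. (q i *\<^sub>R c i) \<bullet> (q j *\<^sub>R c j)) = (norm (\<Sum>i\<in>I. q i *\<^sub>R c i))\<^sup>2"
    unfolding power2_norm_eq_inner inner_sum_left inner_sum_right by (rule sum.swap)
  finally show ?thesis by simp
qed

lemma integrable_gauss_lse:
  fixes c :: "'i \<Rightarrow> 'a::euclidean_space"
  assumes "finite I" "I \<noteq> {}"
  shows "integrable gauss (\<lambda>x. lse I (\<lambda>i. w i + c i \<bullet> x))"
proof (rule integrable_gauss_linear_growth)
  show "(\<lambda>x. lse I (\<lambda>i. w i + c i \<bullet> x)) \<in> borel_measurable borel"
    unfolding lse_def by measurable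
  show "\<bar>lse I (\<lambda>i. w i + c i \<bullet> x)\<bar> \<le> (ln (card I) + (\<Sum>i\<in>I. \<bar>w i\<bar>)) + (\<Sum>i\<in>I. norm (c i)) * norm x" for x
  proof -
    have "(\<Sum>i\<in>I. \<bar>w i + c i \<bullet> x\<bar>) \<le> (\<Sum>i\<in>I. \<bar>w i\<bar> + norm (c i) * norm x)"
      by (intro sum_mono) (metis Cauchy_Schwarz_ineq2 abs_triangle_ineq add_left_mono order_trans)
    then show ?thesis using abs_lse_le[OF assms, of "\<lambda>i. w i + c i \<bullet> x"] by (simp add: sum.distrib sum_distrib_right)
  qed
qed

text \<open>Dividing the exponentials by their sum at \<open>w\<close> turns the increment of
  \<open>lse\<close> into the logarithm of a weighted mean with weights \<open>q\<close>. In the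
  integrated Taylor polynomial the linear term vanishes by symmetry, and the quadratic one becomes
  the variance of the vectors \<open>c i\<close> under \<open>q\<close>. The factor 1/4 is the
  Taylor coefficient 1/2 times the 1/2 of the pair formula.\<close>

lemma integral_gauss_lse_expansion:
  fixes c :: "'i \<Rightarrow> 'a::euclidean_space" and w :: "'i \<Rightarrow> real"
  assumes I: "finite I" "I \<noteq> {}" and "\<delta> > 0"
  defines "q i \<equiv> exp (w i) / (\<Sum>j\<in>I. exp (w j))"
  shows "\<bar>(\<integral>x. lse I (\<lambda>i. w i + (\<delta> *\<^sub>R c i) \<bullet> x) \<partial>gauss)
      - (lse I w + \<delta>\<^sup>2 / 4 * (\<Sum>i\<in>I. \<Sum>j\<in>I. q i * q j * (norm (c i - c j))\<^sup>2))\<bar>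
    \<le> \<delta> ^ 3 * ((\<Sum>i\<in>I. norm (c i)) ^ 3 * (\<integral>(x::'a). norm x ^ 3 \<partial>gauss))"
proof -
  let ?S = "\<Sum>j\<in>I. exp (w j)" and ?L = "\<Sum>i\<in>I. norm (c i)"
  let ?c = "\<Sum>i\<in>I. q i *\<^sub>R c i"
  let ?m2 = "\<lambda>x. \<Sum>i\<in>I. q i * (c i \<bullet> x)\<^sup>2"
  let ?p = "\<lambda>x. lse I w + (\<delta> * (?c \<bullet> x) + \<delta>\<^sup>2 / 2 * (?m2 x - (?c \<bullet> x)\<^sup>2))"
  have S: "?S > 0" using I by (intro sum_pos) auto
  have q: "q i \<ge> 0" for i using S by (simp add: q_def)
  have q1: "sum q I = 1" using S by (simp add: q_def sum_divide_distrib[symmetric])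
  have pt: "\<bar>lse I (\<lambda>i. w i + (\<delta> *\<^sub>R c i) \<bullet> x) - ?p x\<bar>
      \<le> \<delta> ^ 3 * (?L ^ 3 * norm x ^ 3)" for x
  proof -
    have u: "\<bar>c i \<bullet> x\<bar> \<le> ?L * norm x" if "i \<in> I" for i
    proof -
      have "\<bar>c i \<bullet> x\<bar> \<le> norm (c i) * norm x" by (rule Cauchy_Schwarz_ineq2)
      also have "\<dots> \<le> ?L * norm x" using I that by (intro mult_right_mono member_le_sum) auto
      finally show ?thesis .
    qed
    have "\<bar>ln (\<Sum>i\<in>I. q i * exp (\<delta> * (c i \<bullet> x))) -
        (\<delta> * (\<Sum>i\<in>I. q i * (c i \<bullet> x) ^ 1) + \<delta>\<^sup>2 / 2 * ((\<Sum>i\<in>I. q i * (c i \<bullet> x) ^ 2) - (\<Sum>i\<in>I. q i * (c i \<bullet> x) ^ 1)\<^sup>2))\<bar>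
      \<le> \<delta> ^ 3 * (?L * norm x) ^ 3"
      using I(1) q q1 u \<open>\<delta> > 0\<close> by (intro log_sum_exp_Taylor) auto
    moreover have "lse I (\<lambda>i. w i + (\<delta> *\<^sub>R c i) \<bullet> x) = lse I w + ln (\<Sum>i\<in>I. q i * exp (\<delta> * (c i \<bullet> x)))"
    proof -
      have "(\<Sum>i\<in>I. exp (w i + (\<delta> *\<^sub>R c i) \<bullet> x)) = ?S * (\<Sum>i\<in>I. q i * exp (\<delta> * (c i \<bullet> x)))"
        using S by (simp add: sum_distrib_left q_def exp_add)
      moreover have "(\<Sum>i\<in>I. exp (w i + (\<delta> *\<^sub>R c i) \<bullet> x)) > 0" using I by (intro sum_pos) auto
      ultimately show ?thesis unfolding lse_def using S
        by (simp add: ln_mult zero_less_mult_iff)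
    qed
    moreover have "?c \<bullet> x = (\<Sum>i\<in>I. q i * (c i \<bullet> x) ^ 1)" by (simp add: inner_sum_left)
    ultimately show ?thesis by (simp add: power_mult_distrib)
  qed
  note int_intros = Bochner_Integration.integrable_add Bochner_Integration.integrable_diff integrable_mult_right
    Bochner_Integration.integrable_sum integrable_gauss_inner integrable_gauss_inner_sq
  have i1: "integrable gauss (\<lambda>x. lse I (\<lambda>i. w i + (\<delta> *\<^sub>R c i) \<bullet> x))"
    using integrable_gauss_lse[OF I] .
  have i2: "integrable gauss (\<lambda>x. ?p x)"
    by (intro int_intros) simp_all
  have "(\<integral>x. ?p x \<partial>gauss)
      = lse I w + \<delta>\<^sup>2 / 2 * ((\<Sum>i\<in>I. q i * (norm (c i))\<^sup>2) - (norm ?c)\<^sup>2)"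
    by (subst Bochner_Integration.integral_add Bochner_Integration.integral_diff Bochner_Integration.integral_sum integral_mult_right
        | intro int_intros
        | simp add: integral_gauss_inner integral_gauss_inner_sq gauss.prob_space[simplified])+
  also have "\<dots> = lse I w + \<delta>\<^sup>2 / 4 * (\<Sum>i\<in>I. \<Sum>j\<in>I. q i * q j * (norm (c i - c j))\<^sup>2)"
    by (simp add: weighted_variance_pairs[OF q1])
  finally have e2: "(\<integral>x. ?p x \<partial>gauss)
      = lse I w + \<delta>\<^sup>2 / 4 * (\<Sum>i\<in>I. \<Sum>j\<in>I. q i * q j * (norm (c i - c j))\<^sup>2)" .
  have "\<bar>(\<integral>x. lse I (\<lambda>i. w i + (\<delta> *\<^sub>R c i) \<bullet> x) \<partial>gauss) - (\<integral>x. ?p x \<partial>gauss)\<bar>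
      = \<bar>\<integral>x. lse I (\<lambda>i. w i + (\<delta> *\<^sub>R c i) \<bullet> x) - ?p x \<partial>gauss\<bar>"
    using i1 i2 by (subst Bochner_Integration.integral_diff) auto
  also have "\<dots> \<le> (\<integral>x. \<bar>lse I (\<lambda>i. w i + (\<delta> *\<^sub>R c i) \<bullet> x) - ?p x\<bar> \<partial>gauss)"
    by (rule integral_abs_bound)
  also have "\<dots> \<le> (\<integral>(x::'a). \<delta> ^ 3 * (?L ^ 3 * norm x ^ 3) \<partial>gauss)"
    using pt i1 i2 integrable_gauss_power_le_3[of 3, where 'a='a]
    by (intro integral_mono integrable_abs Bochner_Integration.integrable_diff integrable_mult_right) auto
  finally show ?thesis unfolding e2 by simp
qed

lemma integral_gauss_coisometry:
  fixes f :: "'a::euclidean_space \<Rightarrow> 'b::euclidean_space" and f' :: "'b \<Rightarrow> 'a" and \<phi> :: "'b \<Rightarrow> real"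
  assumes "\<And>x y. f x \<bullet> y = x \<bullet> f' y" and "\<And>y. f (f' y) = y" and [measurable]: "\<phi> \<in> borel_measurable borel"
  shows "(\<integral>x. \<phi> (f x) \<partial>gauss) = (\<integral>y. \<phi> y \<partial>gauss)"
proof -
  note [measurable] = gauss_distr_coisometry(2)[OF assms(1,2)]
  show ?thesis
    by (subst gauss_distr_coisometry(1)[OF assms(1,2), symmetric]) (simp_all add: integral_distr)
qed

lemma integral_gauss_prod:
  fixes \<phi> :: "'a::euclidean_space \<times> 'b::euclidean_space \<Rightarrow> real"
  assumes "integrable gauss \<phi>"
  shows "integrable gauss (\<lambda>x. \<integral>y. \<phi> (x, y) \<partial>gauss)"
    and "(\<integral>x. (\<integral>y. \<phi> (x, y) \<partial>gauss) \<partial>gauss) = (\<integral>z. \<phi> z \<partial>gauss)"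
  using gauss_pair.integrable_fst'[of \<phi>] gauss_pair.integral_fst'[of \<phi>] assms by (simp_all add: gauss_prod)

text \<open>In \<open>a \<delta> r m\<close> below, \<open>r\<close> independent increments of size \<open>\<delta>\<close> follow \<open>c\<close> and \<open>m\<close> follow \<open>d\<close>. Swapping one of them costs
  \<open>O(\<delta>\<^sup>3)\<close> since first order terms have mean zero and second order terms are compared by \<open>le\<close>; with \<open>\<delta>\<^sup>2 = 1 / n\<close>,
  the total cost of \<open>n\<close> swaps tends to zero.\<close>

lemma integral_gauss_lse_le:
  fixes c :: "'i \<Rightarrow> 'a::euclidean_space" and d :: "'i \<Rightarrow> 'b::euclidean_space"
  assumes I: "finite I" "I \<noteq> {}"
    and le: "\<And>i j. i \<in> I \<Longrightarrow> j \<in> I \<Longrightarrow> norm (c i - c j) \<le> norm (d i - d j)"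
  shows "(\<integral>x. lse I (\<lambda>i. c i \<bullet> x) \<partial>gauss) \<le> (\<integral>y. lse I (\<lambda>i. d i \<bullet> y) \<partial>gauss)"
proof -
  \<comment> \<open>The remainder constants of both expansions. They do not depend on
    \<open>w\<close>, so the bound for one swap survives integration over all the other
    increments.\<close>
  define K where "K = (\<Sum>i\<in>I. norm (c i)) ^ 3 * (\<integral>(x::'a). norm x ^ 3 \<partial>gauss)
      + (\<Sum>i\<in>I. norm (d i)) ^ 3 * (\<integral>(x::'b). norm x ^ 3 \<partial>gauss)"
  have step: "(\<integral>x. lse I (\<lambda>i. w i + (\<delta> *\<^sub>R c i) \<bullet> x) \<partial>gauss) \<le> (\<integral>y. lse I (\<lambda>i. w i + (\<delta> *\<^sub>R d i) \<bullet> y) \<partial>gauss) + \<delta> ^ 3 * K"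
    if "\<delta> > 0" for w \<delta>
  proof -
    define q where "q i = exp (w i) / (\<Sum>j\<in>I. exp (w j))" for i
    have "q i \<ge> 0" for i by (auto simp: q_def intro!: divide_nonneg_nonneg sum_nonneg)
    then have "(\<Sum>i\<in>I. \<Sum>j\<in>I. q i * q j * (norm (c i - c j))\<^sup>2) \<le> (\<Sum>i\<in>I. \<Sum>j\<in>I. q i * q j * (norm (d i - d j))\<^sup>2)"
      using le by (intro sum_mono mult_left_mono power_mono) auto
    then have "\<delta>\<^sup>2 / 4 * (\<Sum>i\<in>I. \<Sum>j\<in>I. q i * q j * (norm (c i - c j))\<^sup>2) \<le> \<delta>\<^sup>2 / 4 * (\<Sum>i\<in>I. \<Sum>j\<in>I. q i * q j * (norm (d i - d j))\<^sup>2)"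
      by (rule mult_left_mono) simp
    then show ?thesis
      using integral_gauss_lse_expansion[OF I that, of w c] integral_gauss_lse_expansion[OF I that, of w d]
      unfolding q_def K_def distrib_left by linarith
  qed
  \<comment> \<open>A sum of r independent increments of size \<delta> has the law of \<delta> sqrt
    r times a single Gaussian vector, so one vector of each kind represents any number of
    increments.\<close>
  define a where "a \<delta> r m = (\<integral>z. lse I (\<lambda>i. (\<delta> * sqrt (real r)) * (c i \<bullet> fst z) + (\<delta> * sqrt (real m)) * (d i \<bullet> snd z)) \<partial>(gauss :: ('a \<times> 'b) measure))"
    for \<delta> r m
  note [measurable] = borel_measurable_fst_snd
  have int: "integrable gauss (\<lambda>z :: ('a \<times> 'b) \<times> 'e::euclidean_space. lse I (\<lambda>i. s * (c i \<bullet> fst (fst z)) + t * (d i \<bullet> snd (fst z)) + (\<delta> *\<^sub>R e i) \<bullet> snd z))"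
    for s t \<delta> and e :: "'i \<Rightarrow> 'e::euclidean_space"
  proof -
    have "(\<lambda>z. lse I (\<lambda>i. s * (c i \<bullet> fst (fst z)) + t * (d i \<bullet> snd (fst z)) + (\<delta> *\<^sub>R e i) \<bullet> snd z))
      = (\<lambda>z :: ('a \<times> 'b) \<times> 'e. lse I (\<lambda>i. 0 + ((s *\<^sub>R c i, t *\<^sub>R d i), \<delta> *\<^sub>R e i) \<bullet> z))"
      by (simp add: inner_prod_def)
    then show ?thesis
      using integrable_gauss_lse[OF I, of "\<lambda>_. 0" "\<lambda>i. ((s *\<^sub>R c i, t *\<^sub>R d i), \<delta> *\<^sub>R e i)"] by simp
  qed
  have swap: "a \<delta> (Suc r) m \<le> a \<delta> r (Suc m) + \<delta> ^ 3 * K" if "\<delta> > 0" for \<delta> r m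
  proof -
    let ?w = "\<lambda>z i. (\<delta> * sqrt (real r)) * (c i \<bullet> fst z) + (\<delta> * sqrt (real m)) * (d i \<bullet> snd z)"
    let ?C = "\<lambda>z. \<integral>x. lse I (\<lambda>i. ?w z i + (\<delta> *\<^sub>R c i) \<bullet> x) \<partial>gauss" and ?D = "\<lambda>z. \<integral>x. lse I (\<lambda>i. ?w z i + (\<delta> *\<^sub>R d i) \<bullet> x) \<partial>gauss"
    have split: "(\<integral>z. (\<integral>x. lse I (\<lambda>i. ?w z i + (\<delta> *\<^sub>R e i) \<bullet> x) \<partial>gauss) \<partial>gauss) = (\<integral>z. lse I (\<lambda>i. ?w (fst z) i + (\<delta> *\<^sub>R e i) \<bullet> snd z) \<partial>gauss)"
      "integrable gauss (\<lambda>z. \<integral>x. lse I (\<lambda>i. ?w z i + (\<delta> *\<^sub>R e i) \<bullet> x) \<partial>gauss)" for e :: "'i \<Rightarrow> 'e::euclidean_space"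
      using integral_gauss_prod[OF int[of "\<delta> * sqrt (real r)" "\<delta> * sqrt (real m)" \<delta> e]] by simp_all
    have unit: "(sqrt (real n) / sqrt (real (Suc n)))\<^sup>2 + (1 / sqrt (real (Suc n)))\<^sup>2 = 1" for n
      by (simp add: power_divide add_divide_distrib[symmetric])
    have meas: "(\<lambda>z. lse I (\<lambda>i. s * (c i \<bullet> fst z) + t * (d i \<bullet> snd z))) \<in> borel_measurable borel" for s t
      unfolding lse_def by measurable
    have "a \<delta> (Suc r) m = (\<integral>z. lse I (\<lambda>i. ?w (fst z) i + (\<delta> *\<^sub>R c i) \<bullet> snd z) \<partial>gauss)"
    proof -
      \<comment> \<open>With these weights \<open>\<alpha> g + \<beta> g'\<close> is again standard
        Gaussian, and multiplied by sqrt (r + 1) it is sqrt r times \<open>g\<close> plus one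
        separate increment \<open>g'\<close>.\<close>
      define \<alpha> \<beta> where "\<alpha> = sqrt (real r) / sqrt (real (Suc r))" and "\<beta> = 1 / sqrt (real (Suc r))"
      have ab: "\<alpha> * \<alpha> + \<beta> * \<beta> = 1" using unit[of r] by (simp add: \<alpha>_def \<beta>_def power2_eq_square)
      have s: "sqrt (real (Suc r)) * \<alpha> = sqrt (real r)" "sqrt (real (Suc r)) * \<beta> = 1"
        by (simp_all add: \<alpha>_def \<beta>_def)
      let ?f = "\<lambda>z :: ('a \<times> 'b) \<times> 'a. (\<alpha> *\<^sub>R fst (fst z) + \<beta> *\<^sub>R snd z, snd (fst z))"
      let ?f' = "\<lambda>y :: 'a \<times> 'b. ((\<alpha> *\<^sub>R fst y, snd y), \<beta> *\<^sub>R fst y)"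
      have "a \<delta> (Suc r) m = (\<integral>z. lse I (\<lambda>i. (\<delta> * sqrt (real (Suc r))) * (c i \<bullet> fst (?f z)) + (\<delta> * sqrt (real m)) * (d i \<bullet> snd (?f z))) \<partial>gauss)"
        unfolding a_def
      proof (rule integral_gauss_coisometry[where f'="?f'", symmetric])
        show "?f x \<bullet> y = x \<bullet> ?f' y" for x y
          by (simp add: inner_prod_def inner_add_left)
        show "?f (?f' y) = y" for y
          using ab by (simp add: prod_eq_iff scaleR_add_left[symmetric])
      qed (rule meas)
      also have "(\<lambda>z i. (\<delta> * sqrt (real (Suc r))) * (c i \<bullet> fst (?f z)) + (\<delta> * sqrt (real m)) * (d i \<bullet> snd (?f z)))
          = (\<lambda>z i. ?w (fst z) i + (\<delta> *\<^sub>R c i) \<bullet> snd z)"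
      proof (intro ext)
        fix z i
        have "(\<delta> * sqrt (real (Suc r))) * (c i \<bullet> fst (?f z))
            = \<delta> * (sqrt (real (Suc r)) * \<alpha>) * (c i \<bullet> fst (fst z)) + \<delta> * (sqrt (real (Suc r)) * \<beta>) * (c i \<bullet> snd z)"
          by (simp add: inner_add_right algebra_simps)
        then show "(\<delta> * sqrt (real (Suc r))) * (c i \<bullet> fst (?f z)) + (\<delta> * sqrt (real m)) * (d i \<bullet> snd (?f z))
          = ?w (fst z) i + (\<delta> *\<^sub>R c i) \<bullet> snd z" unfolding s by simp
      qed
      finally show ?thesis .
    qed
    moreover have "a \<delta> r (Suc m) = (\<integral>z. lse I (\<lambda>i. ?w (fst z) i + (\<delta> *\<^sub>R d i) \<bullet> snd z) \<partial>gauss)"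
    proof -
      define \<alpha> \<beta> where "\<alpha> = sqrt (real m) / sqrt (real (Suc m))" and "\<beta> = 1 / sqrt (real (Suc m))"
      have ab: "\<alpha> * \<alpha> + \<beta> * \<beta> = 1" using unit[of m] by (simp add: \<alpha>_def \<beta>_def power2_eq_square)
      have s: "sqrt (real (Suc m)) * \<alpha> = sqrt (real m)" "sqrt (real (Suc m)) * \<beta> = 1"
        by (simp_all add: \<alpha>_def \<beta>_def)
      let ?f = "\<lambda>z :: ('a \<times> 'b) \<times> 'b. (fst (fst z), \<alpha> *\<^sub>R snd (fst z) + \<beta> *\<^sub>R snd z)"
      let ?f' = "\<lambda>y :: 'a \<times> 'b. ((fst y, \<alpha> *\<^sub>R snd y), \<beta> *\<^sub>R snd y)"
      have "a \<delta> r (Suc m) = (\<integral>z. lse I (\<lambda>i. (\<delta> * sqrt (real r)) * (c i \<bullet> fst (?f z)) + (\<delta> * sqrt (real (Suc m))) * (d i \<bullet> snd (?f z))) \<partial>gauss)"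
        unfolding a_def
      proof (rule integral_gauss_coisometry[where f'="?f'", symmetric])
        show "?f x \<bullet> y = x \<bullet> ?f' y" for x y
          by (simp add: inner_prod_def inner_add_left)
        show "?f (?f' y) = y" for y
          using ab by (simp add: prod_eq_iff scaleR_add_left[symmetric])
      qed (rule meas)
      also have "(\<lambda>z i. (\<delta> * sqrt (real r)) * (c i \<bullet> fst (?f z)) + (\<delta> * sqrt (real (Suc m))) * (d i \<bullet> snd (?f z)))
          = (\<lambda>z i. ?w (fst z) i + (\<delta> *\<^sub>R d i) \<bullet> snd z)"
      proof (intro ext)
        fix z i
        have "(\<delta> * sqrt (real (Suc m))) * (d i \<bullet> snd (?f z))
            = \<delta> * (sqrt (real (Suc m)) * \<alpha>) * (d i \<bullet> snd (fst z)) + \<delta> * (sqrt (real (Suc m)) * \<beta>) * (d i \<bullet> snd z)"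
          by (simp add: inner_add_right algebra_simps)
        then show "(\<delta> * sqrt (real r)) * (c i \<bullet> fst (?f z)) + (\<delta> * sqrt (real (Suc m))) * (d i \<bullet> snd (?f z))
          = ?w (fst z) i + (\<delta> *\<^sub>R d i) \<bullet> snd z" unfolding s by simp
      qed
      finally show ?thesis .
    qed
    moreover have "(\<integral>z. ?C z \<partial>gauss)
        \<le> (\<integral>z. ?D z + \<delta> ^ 3 * K \<partial>gauss)"
      using step[OF that] by (intro integral_mono split(2) Bochner_Integration.integrable_add) simp_all
    moreover have "(\<integral>z. ?D z + \<delta> ^ 3 * K \<partial>gauss)
        = (\<integral>z. ?D z \<partial>gauss) + \<delta> ^ 3 * K"
      using split(2)[of d] gauss.prob_space[where 'a="'a \<times> 'b", simplified] by simp
    ultimately show ?thesis unfolding split by simp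
  qed
  have tele: "a \<delta> n m \<le> a \<delta> 0 (n + m) + real n * (\<delta> ^ 3 * K)" if "\<delta> > 0" for \<delta> n m
  proof (induction n arbitrary: m)
    case (Suc n)
    show ?case using swap[OF that, of n m] Suc.IH[of "Suc m"] by (simp add: algebra_simps)
  qed simp
  have bound: "(\<integral>x. lse I (\<lambda>i. c i \<bullet> x) \<partial>gauss) \<le> (\<integral>y. lse I (\<lambda>i. d i \<bullet> y) \<partial>gauss) + K / sqrt (real (Suc n))" for n
  proof -
    define \<delta> where "\<delta> = 1 / sqrt (real (Suc n))"
    have d: "\<delta> > 0" "\<delta> * sqrt (real (Suc n)) = 1" by (simp_all add: \<delta>_def)
    have "a \<delta> (Suc n) 0 = (\<integral>z. lse I (\<lambda>i. c i \<bullet> fst z) \<partial>(gauss :: ('a \<times> 'b) measure))"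
      using d by (simp add: a_def del: of_nat_Suc)
    also have "\<dots> = (\<integral>x. lse I (\<lambda>i. c i \<bullet> x) \<partial>gauss)"
      by (rule integral_gauss_coisometry[where f'="\<lambda>x. (x, 0)"]) (auto simp: inner_prod_def lse_def)
    finally have 1: "a \<delta> (Suc n) 0 = (\<integral>x. lse I (\<lambda>i. c i \<bullet> x) \<partial>gauss)" .
    have "a \<delta> 0 (Suc n) = (\<integral>z. lse I (\<lambda>i. d i \<bullet> snd z) \<partial>(gauss :: ('a \<times> 'b) measure))"
      using d by (simp add: a_def del: of_nat_Suc)
    also have "\<dots> = (\<integral>x. lse I (\<lambda>i. d i \<bullet> x) \<partial>gauss)"
      by (rule integral_gauss_coisometry[where f'="\<lambda>x. (0, x)"]) (auto simp: inner_prod_def lse_def)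
    finally have 2: "a \<delta> 0 (Suc n) = (\<integral>x. lse I (\<lambda>i. d i \<bullet> x) \<partial>gauss)" .
    have "real (Suc n) = sqrt (real (Suc n)) * sqrt (real (Suc n))" by (simp add: real_sqrt_mult[symmetric])
    then have "real (Suc n) * \<delta> ^ 3 = (\<delta> * sqrt (real (Suc n))) * (\<delta> * sqrt (real (Suc n))) * \<delta>"
      by (simp only: power3_eq_cube ac_simps)
    then have "real (Suc n) * (\<delta> ^ 3 * K) = K / sqrt (real (Suc n))"
      using d by (simp add: \<delta>_def mult.assoc[symmetric] del: of_nat_Suc)
    then show ?thesis using tele[OF d(1), of "Suc n" 0] by (simp only: add_0_right 1 2)
  qed
  have "(\<lambda>n. (\<integral>y. lse I (\<lambda>i. d i \<bullet> y) \<partial>gauss) + K / sqrt (real (Suc n))) \<longlonglongrightarrow> (\<integral>y. lse I (\<lambda>i. d i \<bullet> y) \<partial>gauss) + K * 0"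
    unfolding divide_inverse
    by (intro tendsto_intros tendsto_inverse_0_at_top filterlim_compose[OF sqrt_at_top]
      filterlim_compose[OF filterlim_real_sequentially filterlim_Suc])
  then show ?thesis using bound by (intro LIMSEQ_le_const) auto
qed

text \<open>Applied to the coefficients scaled by \<open>\<beta>\<close>, the comparison for
  \<open>lse\<close> bounds \<open>\<beta>\<close> times the difference of the two means by
  \<open>ln (card I)\<close>; then \<open>\<beta>\<close> tends to infinity. The two processes may
  live on different spaces, which allows a matrix process to be compared with one built from a pair
  of vectors.\<close>

lemma Sudakov_Fernique:
  fixes c :: "'i \<Rightarrow> 'a::euclidean_space" and d :: "'i \<Rightarrow> 'b::euclidean_space"
  assumes I: "finite I" "I \<noteq> {}"
    and le: "\<And>i j. i \<in> I \<Longrightarrow> j \<in> I \<Longrightarrow> norm (c i - c j) \<le> norm (d i - d j)"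
  shows "(\<integral>x. (MAX i\<in>I. c i \<bullet> x) \<partial>gauss) \<le> (\<integral>y. (MAX i\<in>I. d i \<bullet> y) \<partial>gauss)"
    and "integrable gauss (\<lambda>x. MAX i\<in>I. c i \<bullet> x)"
proof -
  have int: "integrable gauss (\<lambda>x. MAX i\<in>I. e i \<bullet> x)" for e :: "'i \<Rightarrow> 'e::euclidean_space"
  proof (rule integrable_gauss_linear_growth[where a=0 and b="\<Sum>i\<in>I. norm (e i)"])
    show "(\<lambda>x. MAX i\<in>I. e i \<bullet> x) \<in> borel_measurable borel"
      using I by (intro borel_measurable_Max) auto
    fix x
    have "(MAX i\<in>I. e i \<bullet> x) \<in> (\<lambda>i. e i \<bullet> x) ` I" using I by (intro Max_in) auto
    then obtain j where j: "j \<in> I" "(MAX i\<in>I. e i \<bullet> x) = e j \<bullet> x" by auto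
    have "\<bar>e j \<bullet> x\<bar> \<le> norm (e j) * norm x" by (rule Cauchy_Schwarz_ineq2)
    also have "\<dots> \<le> (\<Sum>i\<in>I. norm (e i)) * norm x"
      using I j(1) by (intro mult_right_mono member_le_sum) auto
    finally show "\<bar>MAX i\<in>I. e i \<bullet> x\<bar> \<le> 0 + (\<Sum>i\<in>I. norm (e i)) * norm x" by (simp add: j)
  qed
  show "integrable gauss (\<lambda>x. MAX i\<in>I. c i \<bullet> x)" by (rule int)
  have bound: "(\<integral>x. (MAX i\<in>I. c i \<bullet> x) \<partial>gauss) \<le> (\<integral>y. (MAX i\<in>I. d i \<bullet> y) \<partial>gauss) + ln (card I) * inverse (real (Suc n))" for n
  proof -
    define \<beta> where "\<beta> = real (Suc n)"
    have b: "\<beta> > 0" by (simp add: \<beta>_def)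
    have lint: "integrable gauss (\<lambda>x. lse I (\<lambda>i. (\<beta> *\<^sub>R e i) \<bullet> x))" for e :: "'i \<Rightarrow> 'e::euclidean_space"
      using integrable_gauss_lse[OF I, of "\<lambda>_. 0" "\<lambda>i. \<beta> *\<^sub>R e i"] by simp
    have "\<beta> * (\<integral>x. (MAX i\<in>I. c i \<bullet> x) \<partial>gauss) = (\<integral>x. \<beta> * (MAX i\<in>I. c i \<bullet> x) \<partial>gauss)" by simp
    also have "\<dots> \<le> (\<integral>x. lse I (\<lambda>i. (\<beta> *\<^sub>R c i) \<bullet> x) \<partial>gauss)"
    proof (rule integral_mono)
      fix x
      have "(MAX i\<in>I. c i \<bullet> x) \<in> (\<lambda>i. c i \<bullet> x) ` I" using I by (intro Max_in) auto
      then obtain j where "j \<in> I" "(MAX i\<in>I. c i \<bullet> x) = c j \<bullet> x" by auto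
      then show "\<beta> * (MAX i\<in>I. c i \<bullet> x) \<le> lse I (\<lambda>i. (\<beta> *\<^sub>R c i) \<bullet> x)"
        using lse_ge[OF I(1), of j "\<lambda>i. (\<beta> *\<^sub>R c i) \<bullet> x"] by simp
    qed (intro integrable_mult_right int lint)+
    also have "\<dots> \<le> (\<integral>y. lse I (\<lambda>i. (\<beta> *\<^sub>R d i) \<bullet> y) \<partial>gauss)"
      using b le by (intro integral_gauss_lse_le[OF I]) (simp add: scaleR_diff_right[symmetric])
    also have "\<dots> \<le> (\<integral>y. ln (card I) + \<beta> * (MAX i\<in>I. d i \<bullet> y) \<partial>gauss)"
      using I b by (intro integral_mono lint Bochner_Integration.integrable_add integrable_mult_right int lse_le) auto
    also have "\<dots> = ln (card I) + \<beta> * (\<integral>y. (MAX i\<in>I. d i \<bullet> y) \<partial>gauss)"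
      using int[of d] gauss.prob_space[where 'a='b, simplified] by simp
    finally have "\<beta> * (\<integral>x. (MAX i\<in>I. c i \<bullet> x) \<partial>gauss) \<le> ln (card I) + \<beta> * (\<integral>y. (MAX i\<in>I. d i \<bullet> y) \<partial>gauss)" .
    then show ?thesis unfolding \<beta>_def[symmetric] using b by (simp add: field_simps)
  qed
  have "(\<lambda>n. (\<integral>y. (MAX i\<in>I. d i \<bullet> y) \<partial>gauss) + ln (card I) * inverse (real (Suc n)))
      \<longlonglongrightarrow> (\<integral>y. (MAX i\<in>I. d i \<bullet> y) \<partial>gauss) + ln (card I) * 0"
    by (intro tendsto_intros LIMSEQ_inverse_real_of_nat)
  then show "(\<integral>x. (MAX i\<in>I. c i \<bullet> x) \<partial>gauss) \<le> (\<integral>y. (MAX i\<in>I. d i \<bullet> y) \<partial>gauss)"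
    using bound by (intro LIMSEQ_le_const) auto
qed

section \<open>Chevet's inequality\<close>

text \<open>Jensen's inequality for the square root, obtained from Cauchy-Schwarz against the
  constant 1. Finiteness of the left side is part of the conclusion.\<close>

lemma (in prob_space) nn_integral_sqrt_le:
  assumes [measurable]: "f \<in> borel_measurable M" and "\<And>x. f x \<ge> 0" and "(\<integral>\<^sup>+x. ennreal (f x) \<partial>M) \<le> ennreal c" and "c \<ge> 0"
  shows "(\<integral>\<^sup>+x. ennreal (sqrt (f x)) \<partial>M) \<le> ennreal (sqrt c)"
proof -
  have "(\<integral>\<^sup>+x. ennreal (sqrt (f x)) * 1 \<partial>M)\<^sup>2 \<le> (\<integral>\<^sup>+x. (ennreal (sqrt (f x)))\<^sup>2 \<partial>M) * (\<integral>\<^sup>+x. 1\<^sup>2 \<partial>M)"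
    by (rule Cauchy_Schwarz_nn_integral) measurable
  also have "\<dots> = (\<integral>\<^sup>+x. ennreal (f x) \<partial>M)"
    using assms(2) by (simp add: emeasure_space_1 ennreal_power)
  finally have le: "(\<integral>\<^sup>+x. ennreal (sqrt (f x)) \<partial>M)\<^sup>2 \<le> ennreal c"
    using assms(3) by simp
  show ?thesis
  proof (cases "\<integral>\<^sup>+x. ennreal (sqrt (f x)) \<partial>M")
    case (real r)
    then show ?thesis using le assms(4) by (simp add: ennreal_power ennreal_le_iff real_le_rsqrt)
  next
    case top
    then show ?thesis using le by (simp add: power2_eq_square ennreal_top_mult top_unique)
  qed
qed

text \<open>The rank one matrix \<open>b a^T\<close>. Its inner product with \<open>W\<close> is the
  bilinear form \<open>b^T W a\<close>, so suprema of such forms are maxima of a Gaussian process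
  indexed by rank one matrices.\<close>

definition outer :: "real^'n \<Rightarrow> real^'l \<Rightarrow> real^'l^'n" where
  "outer b a = (\<chi> j. b $ j *\<^sub>R a)"

lemma outer_inner: "outer b a \<bullet> W = (\<Sum>j\<in>UNIV. b $ j * (W $ j \<bullet> a))"
  by (subst inner_vec_def) (simp add: outer_def inner_commute)

lemma outer_inner_outer: "outer b a \<bullet> outer b' a' = (b \<bullet> b') * (a \<bullet> a')"
  by (simp add: outer_inner) (simp add: outer_def inner_vec_def[of b b'] sum_distrib_right inner_commute[of a'] mult.assoc)

text \<open>Writing \<open>P = \<bar>a\<bar> \<bar>a'\<bar> - a \<bullet> a'\<close> and \<open>R = \<bar>b\<bar> \<bar>b'\<bar> - b \<bullet> b'\<close>, the squares of the two sides differ by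
  \<open>(\<bar>a\<bar> \<bar>b\<bar> - \<bar>a'\<bar> \<bar>b'\<bar>)\<^sup>2 + 2 P R\<close>.\<close>

lemma norm_outer_diff_le:
  "norm (outer b a - outer b' a') \<le> norm ((norm b *\<^sub>R a, norm a *\<^sub>R b) - (norm b' *\<^sub>R a', norm a' *\<^sub>R b'))"
proof -
  have "0 \<le> (norm a * norm b - norm a' * norm b')\<^sup>2 + 2 * ((norm a * norm a' - a \<bullet> a') * (norm b * norm b' - b \<bullet> b'))"
    using norm_cauchy_schwarz[of a a'] norm_cauchy_schwarz[of b b'] by simp
  also have "\<dots> = (norm ((norm b *\<^sub>R a, norm a *\<^sub>R b) - (norm b' *\<^sub>R a', norm a' *\<^sub>R b')))\<^sup>2 - (norm (outer b a - outer b' a'))\<^sup>2"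
  proof -
    have n: "a \<bullet> a = norm a * norm a" "a' \<bullet> a' = norm a' * norm a'" "b \<bullet> b = norm b * norm b" "b' \<bullet> b' = norm b' * norm b'"
      by (simp_all add: power2_norm_eq_inner[symmetric] power2_eq_square)
    show ?thesis
      unfolding power2_norm_eq_inner
      by (simp add: inner_diff_left inner_diff_right outer_inner_outer inner_prod_def n inner_commute[of a' a] inner_commute[of b' b])
        (simp add: algebra_simps power2_eq_square)
  qed
  finally show ?thesis by (intro power2_le_imp_le[OF _ norm_ge_zero]) simp
qed

text \<open>The comparison process is \<open>|b| (a . h) + |a| (b . g)\<close> with independent
  Gaussian \<open>h\<close> and \<open>g\<close>; its maximum is at most
  \<open>\<beta> u(h) + \<alpha> v(g)\<close>, where \<open>u\<close> and \<open>v\<close> dominate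
  the two linear forms. Since \<open>a 0 = 0\<close>, both processes vanish at index 0 and their
  maxima are nonnegative, so nothing is lost in \<open>ennreal\<close>. The supremum is reached by
  monotone convergence along initial segments.\<close>

lemma nn_integral_gauss_SUP_outer_le:
  fixes a :: "nat \<Rightarrow> real^'l" and b :: "nat \<Rightarrow> real^'n" and u :: "real^'l \<Rightarrow> real" and v :: "real^'n \<Rightarrow> real"
  assumes a: "\<And>n. norm (a n) \<le> \<alpha>" and b: "\<And>n. norm (b n) \<le> \<beta>" and "a 0 = 0"
    and [measurable]: "u \<in> borel_measurable borel" "v \<in> borel_measurable borel"
    and u: "\<And>n h. a n \<bullet> h \<le> u h" and v: "\<And>n g. b n \<bullet> g \<le> v g" and v0: "\<And>g. v g \<ge> 0"
  shows "(\<integral>\<^sup>+W. (SUP n. ennreal (outer (b n) (a n) \<bullet> W)) \<partial>gauss)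
    \<le> ennreal \<beta> * (\<integral>\<^sup>+h. ennreal (u h) \<partial>gauss) + ennreal \<alpha> * (\<integral>\<^sup>+g. ennreal (v g) \<partial>gauss)"
    (is "_ \<le> ?B")
proof -
  define X where "X N W = (MAX n\<in>{..N}. outer (b n) (a n) \<bullet> W)" for N :: nat and W
  define d where "d n = (norm (b n) *\<^sub>R a n, norm (a n) *\<^sub>R b n)" for n
  have u0: "u h \<ge> 0" for h using u[of 0 h] \<open>a 0 = 0\<close> by simp
  have ab: "\<alpha> \<ge> 0" "\<beta> \<ge> 0" using a[of 0] b[of 0] norm_ge_zero order_trans by blast+
  have o0: "outer (b 0) (a 0) = 0" by (simp add: \<open>a 0 = 0\<close> outer_def vec_eq_iff)
  have d0: "d 0 = 0" by (simp add: d_def \<open>a 0 = 0\<close> zero_prod_def)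
  have X0: "X N W \<ge> 0" for N W
  proof -
    have "0 \<in> (\<lambda>n. outer (b n) (a n) \<bullet> W) ` {..N}" by (rule image_eqI[where x=0]) (simp_all add: o0)
    then show ?thesis unfolding X_def by (intro Max_ge) auto
  qed
  have bound: "(\<integral>\<^sup>+W. ennreal (X N W) \<partial>gauss) \<le> ?B" for N
  proof -
    have le: "(\<integral>W. X N W \<partial>gauss) \<le> (\<integral>y. (MAX n\<in>{..N}. d n \<bullet> y) \<partial>gauss)"
      unfolding X_def d_def by (intro Sudakov_Fernique norm_outer_diff_le) auto
    \<comment> \<open>Comparing a process with itself makes the distance hypothesis trivial and
      leaves the integrability statement.\<close>
    have intX: "integrable gauss (X N)"
      unfolding X_def by (rule Sudakov_Fernique(2)[where d="\<lambda>n. outer (b n) (a n)"]) auto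
    have intY: "integrable gauss (\<lambda>y. MAX n\<in>{..N}. d n \<bullet> y)"
      by (rule Sudakov_Fernique(2)[where d=d]) auto
    have Y0: "(MAX n\<in>{..N}. d n \<bullet> y) \<ge> 0" for y
    proof -
      have "0 \<in> (\<lambda>n. d n \<bullet> y) ` {..N}" by (rule image_eqI[where x=0]) (simp_all add: d0)
      then show ?thesis by (intro Max_ge) auto
    qed
    have "(\<integral>\<^sup>+W. ennreal (X N W) \<partial>gauss) = ennreal (\<integral>W. X N W \<partial>gauss)"
      using intX X0 by (intro nn_integral_eq_integral) auto
    also have "\<dots> \<le> ennreal (\<integral>y. (MAX n\<in>{..N}. d n \<bullet> y) \<partial>gauss)"
      using le by (rule ennreal_leI)
    also have "\<dots> = (\<integral>\<^sup>+y. ennreal (MAX n\<in>{..N}. d n \<bullet> y) \<partial>gauss)"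
      using intY Y0 by (intro nn_integral_eq_integral[symmetric]) auto
    also have "\<dots> \<le> (\<integral>\<^sup>+y. ennreal \<beta> * ennreal (u (fst y)) + ennreal \<alpha> * ennreal (v (snd y)) \<partial>gauss)"
    proof (rule nn_integral_mono)
      fix y :: "(real^'l) \<times> (real^'n)"
      have "d n \<bullet> y \<le> \<beta> * u (fst y) + \<alpha> * v (snd y)" for n
      proof -
        have "norm (b n) * (a n \<bullet> fst y) \<le> norm (b n) * u (fst y)" using u by (intro mult_left_mono) auto
        also have "\<dots> \<le> \<beta> * u (fst y)" using b u0 by (intro mult_right_mono) auto
        finally have 1: "norm (b n) * (a n \<bullet> fst y) \<le> \<beta> * u (fst y)" .
        have "norm (a n) * (b n \<bullet> snd y) \<le> norm (a n) * v (snd y)" using v by (intro mult_left_mono) auto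
        also have "\<dots> \<le> \<alpha> * v (snd y)" using a v0 by (intro mult_right_mono) auto
        finally show ?thesis using 1 by (simp add: d_def inner_prod_def)
      qed
      then have "(MAX n\<in>{..N}. d n \<bullet> y) \<le> \<beta> * u (fst y) + \<alpha> * v (snd y)" by (subst Max_le_iff) auto
      then show "ennreal (MAX n\<in>{..N}. d n \<bullet> y) \<le> ennreal \<beta> * ennreal (u (fst y)) + ennreal \<alpha> * ennreal (v (snd y))"
        using ab u0 v0 by (subst ennreal_mult[symmetric], simp, simp)+ (simp add: ennreal_plus[symmetric] ennreal_leI del: ennreal_plus)
    qed
    also have "\<dots> = ?B"
    proof -
      note [measurable] = borel_measurable_fst_snd
      have 1: "(\<integral>\<^sup>+y. ennreal (u (fst y)) \<partial>(gauss :: ((real^'l) \<times> (real^'n)) measure)) = (\<integral>\<^sup>+h. ennreal (u h) \<partial>gauss)"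
        by (rule nn_integral_gauss_coisometry[where f'="\<lambda>x. (x, 0)"]) (auto simp: inner_prod_def)
      have 2: "(\<integral>\<^sup>+y. ennreal (v (snd y)) \<partial>(gauss :: ((real^'l) \<times> (real^'n)) measure)) = (\<integral>\<^sup>+h. ennreal (v h) \<partial>gauss)"
        by (rule nn_integral_gauss_coisometry[where f'="\<lambda>x. (0, x)"]) (auto simp: inner_prod_def)
      show ?thesis by (simp add: nn_integral_add nn_integral_cmult 1 2)
    qed
    finally show ?thesis .
  qed
  have meas: "(\<lambda>W. ennreal (X N W)) \<in> borel_measurable gauss" for N
    unfolding X_def by (intro measurable_compose[OF _ measurable_ennreal] borel_measurable_Max) auto
  have mono: "X N W \<le> X N' W" if "N \<le> N'" for N N' W
    unfolding X_def using that by (intro Max_mono) auto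
  have "(\<integral>\<^sup>+W. (SUP n. ennreal (outer (b n) (a n) \<bullet> W)) \<partial>gauss) \<le> (\<integral>\<^sup>+W. (SUP N. ennreal (X N W)) \<partial>gauss)"
  proof (intro nn_integral_mono SUP_mono)
    fix W n
    show "\<exists>N\<in>UNIV. ennreal (outer (b n) (a n) \<bullet> W) \<le> ennreal (X N W)"
      by (intro bexI[of _ n] ennreal_leI) (auto simp: X_def)
  qed
  also have "\<dots> = (SUP N. \<integral>\<^sup>+W. ennreal (X N W) \<partial>gauss)"
    using mono meas by (intro nn_integral_monotone_convergence_SUP) (auto simp: incseq_def le_fun_def intro!: ennreal_leI)
  also have "\<dots> \<le> ?B" using bound by (intro SUP_least)
  finally show ?thesis .
qed

text \<open>With \<open>Z\<close> the matrix of columns \<open>z i\<close> and \<open>S\<close> the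
  diagonal matrix of the \<open>s j\<close>, the summed expression is the bilinear form of
  \<open>S W Z\<close> at \<open>\<beta> n\<close> and \<open>y n\<close>; for sequences dense in
  the unit balls the supremum is the norm. The majorants are \<open>u h = |Z^T h|\<close> and
  \<open>v g = |S g|\<close>, and by Jensen their means are at most the Frobenius norms of
  \<open>Z\<close> and \<open>S\<close>.\<close>

lemma Chevet:
  fixes z :: "'k::finite \<Rightarrow> real^'l" and s :: "'n::finite \<Rightarrow> real" and y :: "nat \<Rightarrow> real^'k" and \<beta> :: "nat \<Rightarrow> real^'n"
  assumes y: "\<And>n. norm (y n) \<le> 1" "y 0 = 0" and \<beta>: "\<And>n. norm (\<beta> n) \<le> 1"
    and s: "\<And>j. 0 \<le> s j" "\<And>j. s j \<le> \<sigma>"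
    and \<zeta>: "\<And>n. norm (\<Sum>i\<in>UNIV. y n $ i *\<^sub>R z i) \<le> \<zeta>"
  shows "(\<integral>\<^sup>+W. (SUP n. ennreal (\<Sum>j\<in>UNIV. s j * \<beta> n $ j * (W $ j \<bullet> (\<Sum>i\<in>UNIV. y n $ i *\<^sub>R z i)))) \<partial>gauss)
    \<le> ennreal \<sigma> * ennreal (sqrt (\<Sum>i\<in>UNIV. (norm (z i))\<^sup>2)) + ennreal \<zeta> * ennreal (sqrt (\<Sum>j\<in>UNIV. (s j)\<^sup>2))"
proof -
  define a where "a n = (\<Sum>i\<in>UNIV. y n $ i *\<^sub>R z i)" for n
  define b where "b n = (\<chi> j. s j * \<beta> n $ j)" for n
  define u where "u h = sqrt (\<Sum>i\<in>UNIV. (z i \<bullet> h)\<^sup>2)" for h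
  define v where "v g = sqrt (\<Sum>j\<in>UNIV. (s j * g $ j)\<^sup>2)" for g :: "real^'n"
  have \<sigma>: "\<sigma> \<ge> 0" using s order_trans by blast
  have cs: "x \<bullet> (\<chi> i. f i) \<le> sqrt (\<Sum>i\<in>UNIV. (f i)\<^sup>2)" if "norm x \<le> 1" for x :: "real^'i::finite" and f
  proof -
    have "x \<bullet> (\<chi> i. f i) \<le> norm x * norm (\<chi> i. f i)" by (rule norm_cauchy_schwarz)
    also have "\<dots> \<le> norm ((\<chi> i. f i) :: real^'i)" using that by (simp add: mult_left_le_one_le)
    finally show ?thesis by (simp add: norm_vec_def L2_set_def)
  qed
  have "a n \<bullet> h \<le> u h" for n h
    using cs[OF y(1)[of n], of "\<lambda>i. z i \<bullet> h"] by (simp add: a_def u_def inner_sum_left inner_vec_def[of "y n"])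
  moreover have "b n \<bullet> g \<le> v g" for n g
    using cs[OF \<beta>[of n], of "\<lambda>j. s j * g $ j"] by (simp add: b_def v_def inner_vec_def mult_ac)
  moreover have "norm (b n) \<le> \<sigma>" for n
  proof -
    have "norm (b n) \<le> norm (\<sigma> *\<^sub>R \<beta> n)"
      using s \<sigma> by (intro norm_le_componentwise_cart) (auto simp: b_def abs_mult intro!: mult_right_mono)
    also have "\<dots> \<le> \<sigma>" using \<beta>[of n] \<sigma> by (simp add: mult_left_le)
    finally show ?thesis .
  qed
  moreover have "norm (a n) \<le> \<zeta>" for n using \<zeta> by (simp add: a_def)
  moreover have "a 0 = 0" using y(2) by (simp add: a_def)
  moreover have "v g \<ge> 0" for g by (simp add: v_def sum_nonneg)
  moreover have [measurable]: "u \<in> borel_measurable borel" "v \<in> borel_measurable borel"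
    unfolding u_def v_def by measurable
  ultimately have "(\<integral>\<^sup>+W. (SUP n. ennreal (outer (b n) (a n) \<bullet> W)) \<partial>gauss)
      \<le> ennreal \<sigma> * (\<integral>\<^sup>+h. ennreal (u h) \<partial>gauss) + ennreal \<zeta> * (\<integral>\<^sup>+g. ennreal (v g) \<partial>gauss)"
    by (intro nn_integral_gauss_SUP_outer_le)
  also have "(\<integral>\<^sup>+h. ennreal (u h) \<partial>gauss) \<le> ennreal (sqrt (\<Sum>i\<in>UNIV. (norm (z i))\<^sup>2))"
    unfolding u_def
    by (intro gauss.nn_integral_sqrt_le)
      (auto simp: sum_nonneg nn_integral_sum sum_ennreal[symmetric] nn_integral_gauss_inner_sq simp del: sum_ennreal)
  also have "(\<integral>\<^sup>+g. ennreal (v g) \<partial>gauss) \<le> ennreal (sqrt (\<Sum>j\<in>UNIV. (s j)\<^sup>2))"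
  proof -
    have "s j * g $ j = axis j (s j) \<bullet> g" for j and g :: "real^'n"
      by (simp add: inner_axis inner_commute[of "axis j (s j)"] mult.commute)
    moreover have "(norm (axis j (s j) :: real^'n))\<^sup>2 = (s j)\<^sup>2" for j
      unfolding power2_norm_eq_inner inner_axis_axis by (simp add: power2_eq_square)
    ultimately show ?thesis
      unfolding v_def
      by (intro gauss.nn_integral_sqrt_le)
        (auto simp: sum_nonneg nn_integral_sum sum_ennreal[symmetric] nn_integral_gauss_inner_sq simp del: sum_ennreal)
  qed
  finally show ?thesis
    by (simp add: outer_inner a_def b_def add_mono mult_left_mono mult.assoc)
qed

section \<open>Singular values\<close>

text \<open>A maximiser of the Rayleigh quotient on the unit sphere of the invariant subspace is an eigenvector.\<close>

lemma selfadjoint_eigenbasis: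
  fixes T :: "'a::euclidean_space \<Rightarrow> 'a"
  assumes lin: "linear T" and adj: "\<And>x y. T x \<bullet> y = x \<bullet> T y"
    and "subspace S" and "\<And>x. x \<in> S \<Longrightarrow> T x \<in> S"
  shows "\<exists>E. E \<subseteq> S \<and> pairwise orthogonal E \<and> (\<forall>b\<in>E. norm b = 1 \<and> (\<exists>l. T b = l *\<^sub>R b)) \<and> span E = S"
  using assms(3,4)
proof (induction "dim S" arbitrary: S rule: less_induct)
  case less
  note S = \<open>subspace S\<close> and inv = less.prems(2)
  show ?case
  proof (cases "S = {0}")
    case True
    then show ?thesis by (intro exI[of _ "{}"]) auto
  next
    case False
    then obtain x0 where x0: "x0 \<in> S" "x0 \<noteq> 0" using subspace_0[OF S] by auto
    have "compact (S \<inter> sphere 0 1)"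
      using closed_subspace[OF S] by (simp add: compact_Int_closed Int_commute[of S] compact_sphere closed_Int_compact)
    moreover have "x0 /\<^sub>R norm x0 \<in> S \<inter> sphere 0 1"
      using x0 subspace_scale[OF S] by simp
    moreover have "continuous_on (S \<inter> sphere 0 1) (\<lambda>x. x \<bullet> T x)"
      using lin by (intro continuous_intros linear_continuous_on) (simp add: linear_conv_bounded_linear)
    ultimately obtain v where v: "v \<in> S" "norm v = 1" and max: "\<And>x. x \<in> S \<Longrightarrow> norm x = 1 \<Longrightarrow> x \<bullet> T x \<le> v \<bullet> T v"
      using continuous_attains_sup[of "S \<inter> sphere 0 1" "\<lambda>x. x \<bullet> T x"] by fastforce
    define l where "l = v \<bullet> T v"
    have le: "x \<bullet> T x \<le> l * (x \<bullet> x)" if "x \<in> S" for x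
    proof (cases "x = 0")
      case False
      have "(x /\<^sub>R norm x) \<bullet> T (x /\<^sub>R norm x) \<le> l"
        unfolding l_def using that False by (intro max subspace_scale[OF S]) auto
      then have "(x \<bullet> T x) / (norm x)\<^sup>2 \<le> l"
        by (simp add: linear_scale[OF lin] power2_eq_square divide_inverse mult_ac)
      then show ?thesis using False by (simp add: divide_le_eq power2_norm_eq_inner)
    qed simp
    have vv: "v \<bullet> v = 1" using v by (simp add: norm_eq_1)
    have perp: "T v \<bullet> w = 0" if w: "w \<in> S" "v \<bullet> w = 0" for w
    proof (rule ccontr)
      assume c: "T v \<bullet> w \<noteq> 0"
      define d where "d = l * (w \<bullet> w) - w \<bullet> T w"
      have d: "d \<ge> 0" using le[OF w(1)] by (simp add: d_def)
      \<comment> \<open>The quadratic inequality derived below would hold for every real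
        \<open>t\<close>, so its linear coefficient must vanish. This value of \<open>t\<close>
        exposes the contradiction, and the summand 1 keeps the denominator positive.\<close>
      define t where "t = (T v \<bullet> w) / (d + 1)"
      have "v + t *\<^sub>R w \<in> S" using v w S by (simp add: subspace_add subspace_scale)
      from le[OF this] have "0 \<le> - 2 * t * (T v \<bullet> w) + t\<^sup>2 * d"
      proof -
        have "w \<bullet> T v = T v \<bullet> w" "v \<bullet> T w = T v \<bullet> w" "w \<bullet> v = 0" using w by (metis adj inner_commute)+
        with \<open>(v + t *\<^sub>R w) \<bullet> T (v + t *\<^sub>R w) \<le> l * ((v + t *\<^sub>R w) \<bullet> (v + t *\<^sub>R w))\<close> show ?thesis
          using w vv by (simp add: d_def l_def linear_add[OF lin] linear_scale[OF lin] inner_add_left inner_add_right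
            power2_eq_square algebra_simps)
      qed
      also have "T v \<bullet> w = t * (d + 1)" using d by (simp add: t_def)
      also have "- 2 * t * (t * (d + 1)) + t\<^sup>2 * d = - (t\<^sup>2 * (d + 2))"
        by (simp add: power2_eq_square algebra_simps)
      also have "\<dots> < 0" using d c by (simp add: t_def)
      finally show False by simp
    qed
    have Tv: "T v = l *\<^sub>R v"
    proof -
      \<comment> \<open>The part of \<open>T v\<close> orthogonal to \<open>v\<close> is itself an
        admissible \<open>w\<close>; hence it is orthogonal to \<open>T v\<close> and therefore to
        itself.\<close>
      define u where "u = T v - l *\<^sub>R v"
      have "u \<in> S" using v S inv by (simp add: u_def subspace_diff subspace_scale)
      moreover have vu: "v \<bullet> u = 0" using vv by (simp add: u_def l_def inner_diff_right)
      ultimately have "T v \<bullet> u = 0" by (rule perp)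
      then have "u \<bullet> u = 0" using vu by (subst (1) u_def) (simp add: inner_diff_left)
      then show ?thesis by (simp add: u_def)
    qed
    define S' where "S' = S \<inter> {x. v \<bullet> x = 0}"
    have S': "subspace S'" unfolding S'_def by (intro subspace_inter S subspace_hyperplane)
    have "dim S' < dim S"
    proof (rule dim_psubset)
      have "v \<in> S - S'" using v vv by (simp add: S'_def)
      moreover have "S' \<subseteq> S" by (auto simp: S'_def)
      ultimately have "S' \<subset> S" by blast
      then show "span S' \<subset> span S" using S S' by (simp add: span_eq_iff[THEN iffD2])
    qed
    moreover have "T x \<in> S'" if "x \<in> S'" for x
      using that inv by (auto simp: S'_def adj[symmetric] Tv)
    ultimately obtain E where E: "E \<subseteq> S'" "pairwise orthogonal E"
      "\<And>b. b \<in> E \<Longrightarrow> norm b = 1 \<and> (\<exists>l. T b = l *\<^sub>R b)" "span E = S'"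
      using less.hyps[OF _ S'] by metis
    have "span (insert v E) = S"
    proof
      show "span (insert v E) \<subseteq> S" using E v S by (intro span_minimal) (auto simp: S'_def)
      show "S \<subseteq> span (insert v E)"
      proof
        fix x assume "x \<in> S"
        then have "x - (v \<bullet> x) *\<^sub>R v \<in> span E"
          using v S vv by (simp add: E(4) S'_def subspace_diff subspace_scale inner_diff_right)
        then show "x \<in> span (insert v E)" by (auto simp: span_insert)
      qed
    qed
    moreover have "pairwise orthogonal (insert v E)"
      using E(1,2) by (auto simp: pairwise_insert orthogonal_def S'_def inner_commute)
    ultimately show ?thesis
      using E v Tv by (intro exI[of _ "insert v E"]) (auto simp: S'_def)
  qed
qed

lemma orthonormal_independent:
  fixes E :: "'a::euclidean_space set"
  assumes "pairwise orthogonal E" and "\<And>b. b \<in> E \<Longrightarrow> norm b = 1"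
  shows "independent E"
proof (rule pairwise_orthogonal_independent[OF assms(1)])
  show "0 \<notin> E" using assms(2)[of 0] by auto
qed

lemma sum_mset_singleton: "finite S \<Longrightarrow> (\<Sum>x\<in>S. {#a#}) = replicate_mset (card S) a"
  by (induction S rule: finite_induct) auto

lemma gram_inner: "((transpose B ** B) *v x) \<bullet> y = (B *v x) \<bullet> (B *v y)" for B :: "real^'n^'m"
  by (metis dot_lmul_matrix matrix_vector_mul_assoc transpose_transpose vector_transpose_matrix)

text \<open>Every eigenspace is spanned by the basis vectors lying in it, so its dimension counts
  them, and the eigenvalue at \<open>b\<close> is the square of \<open>norm (B *v b)\<close>. The
  multiset behind \<open>singular_values\<close> can thus be read off from any orthonormal
  eigenbasis.\<close>

lemma singular_values_eigenbasis:
  fixes B :: "real^'n^'m" and E :: "(real^'n) set"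
  assumes E: "pairwise orthogonal E" "\<And>b. b \<in> E \<Longrightarrow> norm b = 1" "span E = UNIV"
    and eig: "\<And>b. b \<in> E \<Longrightarrow> \<exists>l. (transpose B ** B) *v b = l *\<^sub>R b"
  shows "(\<Sum>\<mu> \<in> eigenvalues (transpose B ** B).
      replicate_mset (dim (eigenspace (transpose B ** B) \<mu>)) (sqrt \<mu>))
    = image_mset (\<lambda>b. norm (B *v b)) (mset_set E)"
proof -
  let ?C = "transpose B ** B"
  note adj = gram_inner[of B]
  have ind: "independent E"
    using E(1,2) by (rule orthonormal_independent)
  then have fin: "finite E" by (rule independent_imp_finite)
  define lam where "lam b = (norm (B *v b))\<^sup>2" for b
  have Cb: "?C *v b = lam b *\<^sub>R b" if "b \<in> E" for b
  proof -
    obtain l where l: "?C *v b = l *\<^sub>R b" using eig[OF \<open>b \<in> E\<close>] by auto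
    have "lam b = (?C *v b) \<bullet> b" by (simp add: adj lam_def power2_norm_eq_inner)
    also have "\<dots> = l" using E(2)[OF that] by (simp add: l norm_eq_1)
    finally show ?thesis using l by simp
  qed
  have expand: "(\<Sum>b\<in>E. (x \<bullet> b) *\<^sub>R b) = x" for x
    using E fin by (intro orthonormal_basis_expand) auto
  have key: "lam b = \<mu>" if "x \<in> eigenspace ?C \<mu>" "b \<in> E" "x \<bullet> b \<noteq> 0" for x b \<mu>
  proof -
    have "\<mu> * (x \<bullet> b) = (?C *v x) \<bullet> b" using that by (simp add: eigenspace_def)
    also have "\<dots> = x \<bullet> (?C *v b)" by (metis adj inner_commute)
    also have "\<dots> = lam b * (x \<bullet> b)" using Cb that by simp
    finally show ?thesis using that by simp
  qed
  have ev: "eigenvalues ?C = lam ` E"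
  proof
    show "lam ` E \<subseteq> eigenvalues ?C"
      using Cb E(2) by (fastforce simp: eigenvalues_def eigenspace_def)
    show "eigenvalues ?C \<subseteq> lam ` E"
    proof
      fix \<mu> assume "\<mu> \<in> eigenvalues ?C"
      then obtain x where x: "x \<in> eigenspace ?C \<mu>" "x \<noteq> 0" by (auto simp: eigenvalues_def)
      have "\<exists>b\<in>E. x \<bullet> b \<noteq> 0"
        using expand[of x] x(2) by (metis (no_types, lifting) scaleR_zero_left sum.neutral)
      then show "\<mu> \<in> lam ` E" using key[OF x(1)] by blast
    qed
  qed
  have es: "eigenspace ?C \<mu> = span {b \<in> E. lam b = \<mu>}" for \<mu>
  proof
    show "span {b \<in> E. lam b = \<mu>} \<subseteq> eigenspace ?C \<mu>"
    proof (rule span_minimal)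
      show "{b \<in> E. lam b = \<mu>} \<subseteq> eigenspace ?C \<mu>" using Cb by (auto simp: eigenspace_def)
      show "subspace (eigenspace ?C \<mu>)"
        by (auto simp: subspace_def eigenspace_def matrix_vector_right_distrib matrix_vector_mult_scaleR scaleR_right_distrib)
    qed
    show "eigenspace ?C \<mu> \<subseteq> span {b \<in> E. lam b = \<mu>}"
    proof
      fix x assume x: "x \<in> eigenspace ?C \<mu>"
      have "(\<Sum>b\<in>E. (x \<bullet> b) *\<^sub>R b) = (\<Sum>b\<in>{b \<in> E. lam b = \<mu>}. (x \<bullet> b) *\<^sub>R b)"
        using fin key[OF x] by (intro sum.mono_neutral_right) auto
      also have "\<dots> \<in> span {b \<in> E. lam b = \<mu>}" by (intro span_sum span_scale span_base)
      finally show "x \<in> span {b \<in> E. lam b = \<mu>}" by (simp add: expand)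
    qed
  qed
  have dim: "dim (eigenspace ?C \<mu>) = card {b \<in> E. lam b = \<mu>}" for \<mu>
    unfolding es dim_span
    by (intro dim_eq_card_independent independent_mono[OF ind]) auto
  have "(\<Sum>\<mu> \<in> eigenvalues ?C. replicate_mset (dim (eigenspace ?C \<mu>)) (sqrt \<mu>))
      = (\<Sum>\<mu> \<in> lam ` E. \<Sum>b \<in> {b \<in> E. lam b = \<mu>}. {#norm (B *v b)#})"
    unfolding ev dim
  proof (intro sum.cong refl)
    fix \<mu>
    have "(\<Sum>b \<in> {b \<in> E. lam b = \<mu>}. {#norm (B *v b)#}) = (\<Sum>b \<in> {b \<in> E. lam b = \<mu>}. {#sqrt \<mu>#})"
      by (intro sum.cong) (auto simp: lam_def)
    then show "replicate_mset (card {b \<in> E. lam b = \<mu>}) (sqrt \<mu>) = (\<Sum>b \<in> {b \<in> E. lam b = \<mu>}. {#norm (B *v b)#})"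
      using fin by (simp add: sum_mset_singleton)
  qed
  also have "\<dots> = (\<Sum>b\<in>E. {#norm (B *v b)#})"
    using fin by (intro sum.group) auto
  also have "\<dots> = image_mset (\<lambda>b. norm (B *v b)) (mset_set E)"
    using fin by (induction E rule: finite_induct) auto
  finally show ?thesis .
qed

text \<open>Right singular vectors in decreasing order, counted from 0, so
  \<open>norm (B *v v i)\<close> is the singular value number i + 1. Left singular vectors do not
  occur: orthogonality of the images replaces them and gives vanishing singular values no special
  status. All n vectors are kept, also for m < n.\<close>

definition singular_system :: "real^'n^'m \<Rightarrow> (nat \<Rightarrow> real^'n) \<Rightarrow> bool" where
  "singular_system B v \<longleftrightarrow>
    (\<forall>i<CARD('n). \<forall>j<CARD('n). v i \<bullet> v j = (if i = j then 1 else 0)) \<and>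
    (\<forall>i<CARD('n). \<forall>j<CARD('n). i \<noteq> j \<longrightarrow> (B *v v i) \<bullet> (B *v v j) = 0) \<and>
    (\<forall>i j. i \<le> j \<longrightarrow> j < CARD('n) \<longrightarrow> norm (B *v v j) \<le> norm (B *v v i)) \<and>
    singular_values B = map (\<lambda>i. norm (B *v v i)) [0..<min CARD('m) CARD('n)]"

lemma singular_system_exists:
  fixes B :: "real^'n^'m"
  shows "\<exists>v. singular_system B v"
proof -
  let ?C = "transpose B ** B" and ?f = "\<lambda>b. norm (B *v b)"
  note adj = gram_inner[of B]
  obtain E where E: "pairwise orthogonal E" "\<And>b. b \<in> E \<Longrightarrow> norm b = 1" "span E = UNIV"
    and eig: "\<And>b. b \<in> E \<Longrightarrow> \<exists>l. ?C *v b = l *\<^sub>R b"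
  proof -
    have "(?C *v x) \<bullet> y = x \<bullet> (?C *v y)" for x y by (metis adj inner_commute)
    then show ?thesis using that selfadjoint_eigenbasis[of "(*v) ?C" UNIV] by auto
  qed
  have ind: "independent E"
    using E(1,2) by (rule orthonormal_independent)
  then have fin: "finite E" by (rule independent_imp_finite)
  have card: "card E = CARD('n)"
    using dim_eq_card[of E UNIV] ind E(3) by simp
  obtain L0 where L0: "set L0 = E" "distinct L0" using finite_distinct_list[OF fin] by auto
  define L where "L = sort_key (\<lambda>b. - ?f b) L0"
  have L: "set L = E" "distinct L" "length L = CARD('n)" "sorted (map (\<lambda>b. - ?f b) L)"
    using L0 distinct_card[of L0] card by (auto simp: L_def)
  define v where "v i = L ! i" for i
  have vE: "v i \<in> E" if "i < CARD('n)" for i using that L by (auto simp: v_def)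
  have inj: "v i = v j \<longleftrightarrow> i = j" if "i < CARD('n)" "j < CARD('n)" for i j
    using that L by (simp add: v_def nth_eq_iff_index_eq)
  have 1: "v i \<bullet> v j = (if i = j then 1 else 0)" if "i < CARD('n)" "j < CARD('n)" for i j
  proof (cases "i = j")
    case True
    then show ?thesis using E(2)[OF vE[OF that(1)]] by (simp add: norm_eq_1)
  next
    case False
    then show ?thesis using E(1) vE that inj by (auto simp: pairwise_def orthogonal_def)
  qed
  have 2: "(B *v v i) \<bullet> (B *v v j) = 0" if "i < CARD('n)" "j < CARD('n)" "i \<noteq> j" for i j
  proof -
    obtain l where "?C *v v i = l *\<^sub>R v i" using eig[OF vE[OF \<open>i < CARD('n)\<close>]] by blast
    then show ?thesis using 1[of i j] that by (simp add: adj[symmetric])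
  qed
  have 3: "?f (v j) \<le> ?f (v i)" if "i \<le> j" "j < CARD('n)" for i j
    using sorted_nth_mono[OF L(4), of i j] that L(3) by (simp add: v_def)
  have "mset (map ?f L) = image_mset ?f (mset_set E)"
    using L by (metis mset_map mset_set_set)
  then have ms: "(\<Sum>\<mu> \<in> eigenvalues ?C. replicate_mset (dim (eigenspace ?C \<mu>)) (sqrt \<mu>)) = mset (map ?f L)"
    using singular_values_eigenbasis[OF E eig] by simp
  have "sort (map ?f L) = rev (map ?f L)"
  proof (rule properties_for_sort)
    have "sorted_wrt (\<lambda>x y. - x \<le> - y) (map ?f L)" using L(4) by (simp add: sorted_wrt_map)
    then show "sorted (rev (map ?f L))" by (simp add: sorted_wrt_rev)
  qed simp
  then have "singular_values B = take (min CARD('m) CARD('n)) (map ?f L)"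
    unfolding singular_values_def ms by (simp only: sorted_list_of_multiset_mset rev_rev_ident)
  also have "\<dots> = map (\<lambda>i. ?f (v i)) [0..<min CARD('m) CARD('n)]"
    using L(3) by (intro nth_equalityI) (auto simp: v_def)
  finally show ?thesis using 1 2 3 by (intro exI[of _ v]) (auto simp: singular_system_def)
qed

context
  fixes B :: "real^'n^'m" and v :: "nat \<Rightarrow> real^'n"
  assumes sys: "singular_system B v"
begin

lemma singular_system_inner: "i < CARD('n) \<Longrightarrow> j < CARD('n) \<Longrightarrow> v i \<bullet> v j = (if i = j then 1 else 0)"
  and singular_system_orth: "i < CARD('n) \<Longrightarrow> j < CARD('n) \<Longrightarrow> i \<noteq> j \<Longrightarrow> (B *v v i) \<bullet> (B *v v j) = 0"
  and singular_system_mono: "i \<le> j \<Longrightarrow> j < CARD('n) \<Longrightarrow> norm (B *v v j) \<le> norm (B *v v i)"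
  and singular_system_values: "singular_values B = map (\<lambda>i. norm (B *v v i)) [0..<min CARD('m) CARD('n)]"
  using sys by (auto simp: singular_system_def)

lemma singular_system_value: "i < min CARD('m) CARD('n) \<Longrightarrow> singular_value B (Suc i) = norm (B *v v i)"
  by (simp add: singular_value_def singular_system_values)

lemma singular_system_expand: "(\<Sum>i<CARD('n). (v i \<bullet> x) *\<^sub>R v i) = x"
proof -
  have inj: "inj_on v {..<CARD('n)}"
    using singular_system_inner by (auto simp: inj_on_def) (metis zero_neq_one)
  have orth: "pairwise orthogonal (v ` {..<CARD('n)})"
    using singular_system_inner by (auto simp: pairwise_def orthogonal_def)
  have nrm: "norm b = 1" if "b \<in> v ` {..<CARD('n)}" for b
    using that singular_system_inner by (auto simp: norm_eq_1)
  have "independent (v ` {..<CARD('n)})"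
    using orth nrm by (rule orthonormal_independent)
  then have "span (v ` {..<CARD('n)}) = UNIV"
    using card_ge_dim_independent[of "v ` {..<CARD('n)}" UNIV] inj by (auto simp: card_image)
  then have "(\<Sum>b\<in>v ` {..<CARD('n)}. (x \<bullet> b) *\<^sub>R b) = x"
    using orth nrm by (intro orthonormal_basis_expand) auto
  then show ?thesis by (simp add: sum.reindex[OF inj] inner_commute)
qed

lemma singular_system_norm_comb:
  assumes "I \<subseteq> {..<CARD('n)}"
  shows "(norm (\<Sum>i\<in>I. c i *\<^sub>R v i))\<^sup>2 = (\<Sum>i\<in>I. (c i)\<^sup>2)"
    and "(norm (B *v (\<Sum>i\<in>I. c i *\<^sub>R v i)))\<^sup>2 = (\<Sum>i\<in>I. (c i)\<^sup>2 * (norm (B *v v i))\<^sup>2)"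
proof -
  have fin: "finite I" using assms finite_subset by blast
  have 1: "(norm (\<Sum>i\<in>I. u i))\<^sup>2 = (\<Sum>i\<in>I. (norm (u i))\<^sup>2)"
    if "\<And>i j. i \<in> I \<Longrightarrow> j \<in> I \<Longrightarrow> i \<noteq> j \<Longrightarrow> u i \<bullet> u j = 0" for u :: "nat \<Rightarrow> 'c::real_inner"
    using fin that by (intro norm_sum_Pythagorean) (auto simp: pairwise_def orthogonal_def)
  have n1: "norm (v i) = 1" if "i \<in> I" for i using singular_system_inner that assms by (auto simp: norm_eq_1)
  show "(norm (\<Sum>i\<in>I. c i *\<^sub>R v i))\<^sup>2 = (\<Sum>i\<in>I. (c i)\<^sup>2)"
    using assms singular_system_inner by (subst 1) (auto simp: n1 power_mult_distrib subset_iff)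
  show "(norm (B *v (\<Sum>i\<in>I. c i *\<^sub>R v i)))\<^sup>2 = (\<Sum>i\<in>I. (c i)\<^sup>2 * (norm (B *v v i))\<^sup>2)"
    unfolding linear_sum[OF matrix_vector_mul_linear] matrix_vector_mult_scaleR
    using assms singular_system_orth by (subst 1) (auto simp: power_mult_distrib subset_iff)
qed

lemma singular_system_norm:
  "(norm x)\<^sup>2 = (\<Sum>i<CARD('n). (v i \<bullet> x)\<^sup>2)" 
  "(norm (B *v x))\<^sup>2 = (\<Sum>i<CARD('n). (v i \<bullet> x)\<^sup>2 * (norm (B *v v i))\<^sup>2)"
  using singular_system_norm_comb[of "{..<CARD('n)}" "\<lambda>i. v i \<bullet> x"] by (simp_all add: singular_system_expand)

text \<open>By monotonicity a nonzero image at index i forces nonzero images at all earlier indices,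
  and these would be more than m orthogonal nonzero vectors in m dimensions.\<close>

lemma singular_system_zero:
  assumes "CARD('m) \<le> i" "i < CARD('n)"
  shows "B *v v i = 0"
proof (rule ccontr)
  assume "B *v v i \<noteq> 0"
  then have nz: "B *v v j \<noteq> 0" if "j \<le> i" for j
    using singular_system_mono[OF that assms(2)] by auto
  let ?S = "(\<lambda>j. B *v v j) ` {..i}"
  have orth: "(B *v v j) \<bullet> (B *v v l) = 0" if "j \<le> i" "l \<le> i" "j \<noteq> l" for j l
    using singular_system_orth that assms by auto
  have "inj_on (\<lambda>j. B *v v j) {..i}"
    using orth nz by (auto simp: inj_on_def) (metis inner_eq_zero_iff)
  moreover have "independent ?S"
  proof (rule pairwise_orthogonal_independent)
    show "pairwise orthogonal ?S"
      unfolding pairwise_image orthogonal_def using orth by (intro pairwiseI) auto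
  qed (use nz in auto)
  moreover from this have "card ?S \<le> CARD('m)"
    using independent_bound[of ?S] by simp
  ultimately show False using assms by (simp add: card_image)
qed

end

text \<open>These properties identify the largest singular value with the operator norm; all later
  arguments about the spectral norm rest on them.\<close>

lemma spectral_norm_nonneg: "spectral_norm B \<ge> 0"
  and spectral_norm_bound: "norm (B *v x) \<le> spectral_norm B * norm x"
  and spectral_norm_attained: "\<exists>x. norm x = 1 \<and> spectral_norm B = norm (B *v x)"
  for B :: "real^'n^'m"
proof -
  obtain v where v: "singular_system B v" using singular_system_exists by blast
  have s: "spectral_norm B = norm (B *v v 0)"
    using singular_system_value[OF v, of 0] by (simp add: spectral_norm_def)
  show "spectral_norm B \<ge> 0" by (simp add: s)
  have "(norm (B *v x))\<^sup>2 \<le> (\<Sum>i<CARD('n). (v i \<bullet> x)\<^sup>2 * (norm (B *v v 0))\<^sup>2)"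
    unfolding singular_system_norm(2)[OF v, of x] using singular_system_mono[OF v, of 0]
    by (intro sum_mono mult_left_mono power_mono) auto
  also have "\<dots> = (spectral_norm B * norm x)\<^sup>2"
    by (simp add: s power_mult_distrib singular_system_norm(1)[OF v, of x] sum_distrib_left mult.commute)
  finally show "norm (B *v x) \<le> spectral_norm B * norm x"
    by (rule power2_le_imp_le) (simp add: s)
  show "\<exists>x. norm x = 1 \<and> spectral_norm B = norm (B *v x)"
    using s singular_system_inner[OF v, of 0 0] by (intro exI[of _ "v 0"]) (simp add: norm_eq_1)
qed

section \<open>The pseudo-inverse of a Gaussian matrix\<close>

lemma spectral_norm_eqI:
  assumes "\<And>x. norm (B *v x) \<le> c * norm x" and "norm y = 1" "c \<le> norm (B *v y)"
  shows "spectral_norm B = c"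
proof (rule antisym)
  show "spectral_norm B \<le> c" using spectral_norm_attained[of B] assms(1) by (metis mult.right_neutral)
  show "c \<le> spectral_norm B" using spectral_norm_bound[of B y] assms by simp
qed

section \<open>Dense sequences and measurability of matrix operations\<close>

lemma dense_sequence_cball:
  obtains y :: "nat \<Rightarrow> 'a::euclidean_space" where "y 0 = 0" "\<And>n. norm (y n) \<le> 1" "cball 0 1 \<subseteq> closure (range y)"
proof -
  obtain T :: "'a set" where T: "countable T" "T \<subseteq> cball 0 1" "cball 0 1 \<subseteq> closure T"
    by (rule separable)
  have ne: "T \<noteq> {}" using T(3) by auto
  \<comment> \<open>The zero put in front later provides the index at which the Gaussian processes
    vanish.\<close>
  define y where "y n = (case n of 0 \<Rightarrow> 0 | Suc n \<Rightarrow> from_nat_into T n)" for n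
  have "T \<subseteq> range y"
  proof
    fix x assume "x \<in> T"
    then obtain n where "x = from_nat_into T n" using from_nat_into_surj[OF T(1)] by metis
    then show "x \<in> range y" by (intro image_eqI[of _ _ "Suc n"]) (simp_all add: y_def)
  qed
  then have "cball 0 1 \<subseteq> closure (range y)" using T(3) closure_mono by blast
  moreover have "norm (y n) \<le> 1" for n
    using subsetD[OF T(2) from_nat_into[OF ne]] by (cases n) (simp_all add: y_def)
  ultimately show thesis using that[of y] by (simp add: y_def)
qed

lemma le_SUP_dense:
  fixes f :: "'a::topological_space \<Rightarrow> real"
  assumes "continuous_on UNIV f" and "x \<in> closure (range y)"
  shows "ennreal (f x) \<le> (SUP n. ennreal (f (y n)))"
proof -
  let ?C = "{x. ennreal (f x) \<le> (SUP n. ennreal (f (y n)))}"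
  have "closed ?C"
    using assms(1) by (intro closed_Collect_le continuous_intros continuous_on_ennreal)
  moreover have "range y \<subseteq> ?C" by (auto intro: SUP_upper)
  ultimately have "closure (range y) \<subseteq> ?C" by (rule closure_minimal[rotated])
  then show ?thesis using assms(2) by auto
qed

lemma borel_measurable_matrixI:
  fixes f :: "'a \<Rightarrow> real^'n^'m"
  assumes "\<And>i j. (\<lambda>x. f x $ i $ j) \<in> borel_measurable M"
  shows "f \<in> borel_measurable M"
  using assms by (subst borel_measurable_euclidean_space) (auto simp: Basis_vec_def inner_axis)

lemma borel_measurable_entry:
  fixes f :: "'a \<Rightarrow> real^'n^'m"
  assumes "f \<in> borel_measurable M"
  shows "(\<lambda>x. f x $ i $ j) \<in> borel_measurable M"
proof -
  have "(\<lambda>x. f x \<bullet> axis i (axis j 1)) \<in> borel_measurable M" using assms by measurable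
  then show ?thesis by (simp add: inner_axis)
qed

lemma borel_measurable_det:
  fixes f :: "'a \<Rightarrow> real^'n^'n"
  assumes "f \<in> borel_measurable M"
  shows "(\<lambda>x. det (f x)) \<in> borel_measurable M"
  unfolding det_def using borel_measurable_entry[OF assms] by measurable

lemma borel_measurable_matrix_mult:
  fixes f :: "'a \<Rightarrow> real^'n^'m" and g :: "'a \<Rightarrow> real^'l^'n"
  assumes "f \<in> borel_measurable M" "g \<in> borel_measurable M"
  shows "(\<lambda>x. f x ** g x) \<in> borel_measurable M"
  using assms[THEN borel_measurable_entry] by (intro borel_measurable_matrixI) (simp add: matrix_matrix_mult_def)

lemma borel_measurable_matrix_transpose:
  fixes f :: "'a \<Rightarrow> real^'n^'m"
  assumes "f \<in> borel_measurable M"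
  shows "(\<lambda>x. transpose (f x)) \<in> borel_measurable M"
  using assms[THEN borel_measurable_entry] by (intro borel_measurable_matrixI) (simp add: transpose_def)

lemma matrix_inv_right:
  fixes A :: "real^'n^'n"
  assumes "det A \<noteq> 0"
  shows "A ** matrix_inv A = mat 1" and "matrix_inv A ** A = mat 1"
proof -
  have "\<exists>A'. A ** A' = mat 1 \<and> A' ** A = mat 1"
    using assms by (simp add: invertible_det_nz[symmetric] invertible_def)
  then have "A ** matrix_inv A = mat 1 \<and> matrix_inv A ** A = mat 1"
    unfolding matrix_inv_def by (rule someI_ex)
  then show "A ** matrix_inv A = mat 1" "matrix_inv A ** A = mat 1" by auto
qed

text \<open>On singular matrices \<open>matrix_inv\<close> is the choice from an empty predicate, hence one and the same junk value.\<close>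

lemma matrix_inv_singular:
  fixes A :: "real^'n^'n"
  assumes "det A = 0"
  shows "matrix_inv A = matrix_inv 0"
proof -
  have "matrix_inv B = (SOME A'. False)" if "det B = 0" for B :: "real^'n^'n"
    unfolding matrix_inv_def using that invertible_det_nz[of B]
    by (intro arg_cong[where f=Eps] ext) (auto simp: invertible_def)
  moreover have "det (0 :: real^'n^'n) = 0" 
    by (subst det_diagonal) simp_all
  ultimately show ?thesis using assms by metis
qed

text \<open>Where the determinant is nonzero, Cramer's rule writes the entry (i, j) as a quotient of
  determinants, the numerator having column \<open>i\<close> replaced by \<open>axis j 1\<close>.
  Elsewhere the inverse is a fixed matrix by \<open>matrix_inv_singular\<close>.\<close>

lemma borel_measurable_matrix_inv:
  fixes f :: "'a \<Rightarrow> real^'n^'n"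
  assumes f: "f \<in> borel_measurable M"
  shows "(\<lambda>x. matrix_inv (f x)) \<in> borel_measurable M"
proof (rule borel_measurable_matrixI)
  fix i j
  note [measurable] = borel_measurable_det[OF f] borel_measurable_entry[OF f]
  let ?c = "\<lambda>x. \<chi> a b. if b = i then (axis j 1 :: real^'n) $ a else f x $ a $ b"
  have eq: "matrix_inv (f x) $ i $ j = (if det (f x) \<noteq> 0 then det (?c x) / det (f x) else matrix_inv 0 $ i $ j)" for x
  proof (cases "det (f x) = 0")
    case False
    have "f x *v (matrix_inv (f x) *v axis j 1) = axis j 1"
      by (simp add: matrix_vector_mul_assoc matrix_inv_right[OF False])
    then have "matrix_inv (f x) *v axis j 1 = (\<chi> k. det (\<chi> a b. if b = k then axis j 1 $ a else f x $ a $ b) / det (f x))"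
      using cramer[OF False] by blast
    moreover have "matrix_inv (f x) $ i $ j = (matrix_inv (f x) *v axis j 1) $ i"
      by (simp add: matrix_vector_mult_basis column_def)
    ultimately show ?thesis using False by simp
  qed (simp add: matrix_inv_singular)
  have "?c \<in> borel_measurable M"
    by (rule borel_measurable_matrixI) simp
  then show "(\<lambda>x. matrix_inv (f x) $ i $ j) \<in> borel_measurable M"
    unfolding eq using borel_measurable_det[of ?c M] by measurable
qed

lemma borel_measurable_norm_matrix_vector_mult:
  fixes f :: "'a \<Rightarrow> real^'n^'m"
  assumes "f \<in> borel_measurable M"
  shows "(\<lambda>x. norm (f x *v y)) \<in> borel_measurable M"
  using borel_measurable_entry[OF assms] unfolding norm_vec_def L2_set_def matrix_vector_mult_def by simp

text \<open>The operator norm is a countable supremum over a dense sequence of the unit ball, by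
  continuity of \<open>norm (B *v x)\<close> in \<open>x\<close>.\<close>

lemma borel_measurable_spectral_norm:
  fixes f :: "'a \<Rightarrow> real^'n^'m"
  assumes "f \<in> borel_measurable M"
  shows "(\<lambda>x. spectral_norm (f x)) \<in> borel_measurable M"
proof -
  obtain y :: "nat \<Rightarrow> real^'n" where y: "\<And>n. norm (y n) \<le> 1" "cball 0 1 \<subseteq> closure (range y)"
    by (metis dense_sequence_cball)
  have "ennreal (spectral_norm B) = (SUP n. ennreal (norm (B *v y n)))" for B :: "real^'n^'m"
  proof (rule antisym)
    obtain x where x: "norm x = 1" "spectral_norm B = norm (B *v x)" using spectral_norm_attained by blast
    have "ennreal (norm (B *v x)) \<le> (SUP n. ennreal (norm (B *v y n)))"
      using x y(2) by (intro le_SUP_dense[where f="\<lambda>x. norm (B *v x)"] continuous_intros matrix_vector_mult_linear_continuous_on) auto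
    then show "ennreal (spectral_norm B) \<le> (SUP n. ennreal (norm (B *v y n)))" by (simp add: x)
    show "(SUP n. ennreal (norm (B *v y n))) \<le> ennreal (spectral_norm B)"
    proof (intro SUP_least ennreal_leI)
      fix n
      have "norm (B *v y n) \<le> spectral_norm B * norm (y n)" by (rule spectral_norm_bound)
      also have "\<dots> \<le> spectral_norm B" using y(1) spectral_norm_nonneg by (rule mult_left_le)
      finally show "norm (B *v y n) \<le> spectral_norm B" .
    qed
  qed
  then have "spectral_norm (f x) = enn2real (SUP n. ennreal (norm (f x *v y n)))" for x
    by (metis enn2real_ennreal spectral_norm_nonneg)
  then show ?thesis using borel_measurable_norm_matrix_vector_mult[OF assms] by simp
qed

text \<open>For \<open>H\<close> of full column rank this is the pseudo-inverse of the transpose of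
  \<open>H\<close>, not of \<open>H\<close> itself: a right inverse of \<open>transpose H\<close>
  whose range lies in that of \<open>H\<close>.\<close>

definition pinv :: "real^'k^'l \<Rightarrow> real^'k^'l" where
  "pinv H = H ** matrix_inv (transpose H ** H)"

lemma borel_measurable_pinv:
  assumes "f \<in> borel_measurable M"
  shows "(\<lambda>x. pinv (f x)) \<in> borel_measurable M"
  unfolding pinv_def
  by (intro borel_measurable_matrix_mult borel_measurable_matrix_inv borel_measurable_matrix_transpose assms)

lemma transpose_inner: "(transpose H *v x) \<bullet> y = x \<bullet> (H *v y)" for H :: "real^'k^'l"
  by (metis dot_lmul_matrix transpose_transpose vector_transpose_matrix)

lemma inner_transpose: "y \<bullet> (transpose H *v x) = (H *v y) \<bullet> x" for H :: "real^'k^'l"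
  using transpose_inner[of H x y] by (simp add: inner_commute)

context
  fixes H :: "real^'k^'l"
  assumes full: "det (transpose H ** H) \<noteq> 0"
begin

lemma transpose_mult_pinv: "transpose H *v (pinv H *v y) = y"
  by (simp add: pinv_def matrix_vector_mul_assoc matrix_mul_assoc matrix_inv_right[OF full])

lemma pinv_mult_gram: "pinv H *v (transpose H *v (H *v y)) = H *v y"
  by (metis matrix_inv_right(2)[OF full] matrix_mul_assoc matrix_vector_mul_assoc matrix_mul_rid pinv_def)

lemma pinv_range: "\<exists>c. pinv H *v y = H *v c"
  by (simp add: pinv_def matrix_vector_mul_assoc[symmetric]) blast

lemma full_rank_mult_eq_0: "H *v x = 0 \<Longrightarrow> x = 0"
  by (metis matrix_inv_right(2)[OF full] matrix_vector_mul_assoc matrix_vector_mul_lid matrix_vector_mult_0_right)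

text \<open>A column of the pseudo-inverse has length the inverse of the distance of the corresponding column of \<open>H\<close>
  from the span of the others; \<open>R\<close> only has to be orthogonal to that span.\<close>

lemma norm_column_pinv_le:
  fixes R :: "(real^'l) set"
  assumes R: "finite R" "pairwise orthogonal R" "\<And>w. w \<in> R \<Longrightarrow> norm w = 1"
    and orth: "\<And>w j. w \<in> R \<Longrightarrow> j \<noteq> i \<Longrightarrow> w \<bullet> column j H = 0"
  shows "ennreal ((norm (column i (pinv H)))\<^sup>2) \<le> inverse (ennreal (\<Sum>w\<in>R. (w \<bullet> column i H)\<^sup>2))"
proof -
  define z where "z = column i (pinv H)"
  have z: "z = pinv H *v axis i 1" by (simp add: z_def matrix_vector_mult_basis)
  obtain c where c: "z = H *v c" unfolding z using pinv_range by blast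
  have Hz: "transpose H *v z = axis i 1" unfolding z by (rule transpose_mult_pinv)
  \<comment> \<open>As \<open>z\<close> lies in the range of \<open>H\<close>, pairing it with
    itself and using \<open>transpose H *v z = axis i 1\<close> reads off one coefficient.\<close>
  have zz: "(norm z)\<^sup>2 = c $ i"
  proof -
    have "(norm z)\<^sup>2 = z \<bullet> (H *v c)" unfolding power2_norm_eq_inner by (subst (2) c) (rule refl)
    also have "\<dots> = axis i 1 \<bullet> c" by (metis transpose_inner Hz)
    finally show ?thesis by (simp add: inner_axis')
  qed
  have wz: "w \<bullet> z = (norm z)\<^sup>2 * (w \<bullet> column i H)" if "w \<in> R" for w
  proof -
    have "w \<bullet> z = (\<Sum>j\<in>UNIV. c $ j * (w \<bullet> column j H))"
      unfolding c matrix_mult_sum by (simp add: inner_sum_right scalar_mult_eq_scaleR)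
    also have "\<dots> = (\<Sum>j\<in>{i}. c $ j * (w \<bullet> column j H))"
      using orth[OF that] by (intro sum.mono_neutral_right) auto
    finally show ?thesis by (simp add: zz)
  qed
  define S where "S = (\<Sum>w\<in>R. (w \<bullet> column i H)\<^sup>2)"
  have S: "S \<ge> 0" by (simp add: S_def sum_nonneg)
  \<comment> \<open>The projection of \<open>z\<close> to the span of \<open>R\<close>, so Bessel's
    inequality applies. By \<open>wz\<close> its squared norm is \<open>|z|^4 S\<close>, and
    dividing by \<open>|z|^2\<close> gives the claim.\<close>
  define q where "q = (\<Sum>w\<in>R. (w \<bullet> z) *\<^sub>R w)"
  have "(norm q)\<^sup>2 = (\<Sum>w\<in>R. (norm ((w \<bullet> z) *\<^sub>R w))\<^sup>2)"
    unfolding q_def using R by (intro norm_sum_Pythagorean) (auto simp: pairwise_def orthogonal_def)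
  also have "\<dots> = (\<Sum>w\<in>R. (w \<bullet> z)\<^sup>2)" using R(3) by (simp add: power_mult_distrib)
  finally have q: "(norm q)\<^sup>2 = (\<Sum>w\<in>R. (w \<bullet> z)\<^sup>2)" .
  have "z \<bullet> q = (\<Sum>w\<in>R. (w \<bullet> z)\<^sup>2)"
    by (simp add: q_def inner_sum_right power2_eq_square inner_commute)
  then have "(norm q)\<^sup>2 \<le> norm z * norm q" using q norm_cauchy_schwarz[of z q] by simp
  then have "norm q \<le> norm z" by (cases "q = 0") (simp_all add: power2_eq_square)
  then have "(norm q)\<^sup>2 \<le> (norm z)\<^sup>2" by (intro power_mono) auto
  moreover have "(norm q)\<^sup>2 = ((norm z)\<^sup>2)\<^sup>2 * S"
    unfolding q S_def using wz by (simp add: power_mult_distrib sum_distrib_left)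
  moreover have "(norm z)\<^sup>2 > 0"
  proof -
    have "z \<noteq> 0" using Hz by (auto simp: axis_eq_0_iff)
    then show ?thesis by simp
  qed
  ultimately have "(norm z)\<^sup>2 * ((norm z)\<^sup>2 * S) \<le> (norm z)\<^sup>2 * 1" and "(norm z)\<^sup>2 > 0"
    by (simp_all only: power2_eq_square[of "(norm z)\<^sup>2"] mult.assoc mult_1_right)
  then have le: "(norm z)\<^sup>2 * S \<le> 1" by (simp only: mult_le_cancel_left_pos)
  show ?thesis
  proof (cases "S = 0")
    case True
    then show ?thesis by (simp add: S_def)
  next
    case False
    then have "(norm z)\<^sup>2 \<le> inverse S" using le S by (simp add: field_simps)
    then show ?thesis using False S by (simp add: S_def[symmetric] z_def[symmetric] inverse_ennreal ennreal_leI)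
  qed
qed

end

lemma full_rank_iff: "det (transpose H ** H) \<noteq> 0 \<longleftrightarrow> (\<forall>x. H *v x = 0 \<longrightarrow> x = 0)" for H :: "real^'k^'l"
proof
  assume "det (transpose H ** H) \<noteq> 0"
  then show "\<forall>x. H *v x = 0 \<longrightarrow> x = 0" using full_rank_mult_eq_0 by blast
next
  assume *: "\<forall>x. H *v x = 0 \<longrightarrow> x = 0"
  have "x = 0" if "(transpose H ** H) *v x = 0" for x
  proof -
    have "(H *v x) \<bullet> (H *v x) = ((transpose H ** H) *v x) \<bullet> x"
      by (metis matrix_vector_mul_assoc transpose_inner)
    then show ?thesis using that * by simp
  qed
  then show "det (transpose H ** H) \<noteq> 0"
    using matrix_left_invertible_ker[of "transpose H ** H"] invertible_left_inverse[of "transpose H ** H"]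
    by (simp add: invertible_det_nz)
qed

section \<open>Moments of the columns of the pseudo-inverse, and almost sure full rank\<close>

lemma exists_orthonormal_complement:
  fixes C :: "'a::euclidean_space set"
  assumes "finite C" "card C + q \<le> DIM('a)"
  shows "\<exists>R. finite R \<and> card R = q \<and> pairwise orthogonal R \<and> (\<forall>w\<in>R. norm w = 1 \<and> (\<forall>x\<in>C. w \<bullet> x = 0))"
proof -
  let ?O = "{y. \<forall>x\<in>span C. orthogonal x y}"
  have "dim ?O + dim (span C) = DIM('a)"
    using dim_subspace_orthogonal_to_vectors[of "span C" UNIV] by simp
  moreover have "dim (span C) \<le> card C" using assms(1) by (simp add: dim_le_card')
  ultimately have d: "q \<le> dim ?O" using assms(2) by linarith
  have sub: "subspace ?O" by (auto simp: subspace_def orthogonal_def inner_add_right)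
  obtain B where B: "B \<subseteq> ?O" "pairwise orthogonal B" "\<And>x. x \<in> B \<Longrightarrow> norm x = 1" "independent B" "card B = dim ?O" "span B = ?O"
    by (rule orthonormal_basis_subspace[OF sub]) (rule that; blast)
  obtain R where R: "R \<subseteq> B" "card R = q" "finite R"
    using d unfolding B(5)[symmetric] by (rule obtain_subset_with_card_n)
  have "w \<bullet> x = 0" if "w \<in> R" "x \<in> C" for w x
    using that R B(1) span_base[of x C] by (auto simp: orthogonal_def inner_commute)
  then show ?thesis using R B by (intro exI[of _ R]) (auto intro: pairwise_subset)
qed

definition replace_column :: "'k \<Rightarrow> real^'k^'l \<Rightarrow> real^'l \<Rightarrow> real^'k^'l" where
  "replace_column i H u = (\<chi> l j. if j = i then u $ l else H $ l $ j)"

lemma column_replace_column: "column j (replace_column i H u) = (if j = i then u else column j H)"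
  by (simp add: column_def replace_column_def vec_eq_iff)

text \<open>The columns of a Gaussian matrix are independent, so one of them may be resampled. The
  adjoint of the replacement extracts that column and sets it to zero in the matrix.\<close>

lemma nn_integral_gauss_replace_column:
  fixes \<phi> :: "real^'k^'l \<Rightarrow> ennreal"
  assumes [measurable]: "\<phi> \<in> borel_measurable borel"
  shows "(\<integral>\<^sup>+H. \<phi> H \<partial>gauss) = (\<integral>\<^sup>+H. (\<integral>\<^sup>+u. \<phi> (replace_column i H u) \<partial>gauss) \<partial>gauss)"
proof -
  let ?f = "\<lambda>z :: (real^'k^'l) \<times> (real^'l). replace_column i (fst z) (snd z)"
  let ?f' = "\<lambda>X :: real^'k^'l. (replace_column i X 0, column i X)"
  have adj: "?f z \<bullet> X = z \<bullet> ?f' X" for z X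
  proof -
    have "(if j = i then snd z $ l else fst z $ l $ j) * X $ l $ j
        = fst z $ l $ j * (if j = i then 0 else X $ l $ j) + (if j = i then snd z $ l * X $ l $ j else 0)" for l j
      by simp
    then show ?thesis
      by (simp add: inner_prod_def inner_vec_def replace_column_def column_def sum.distrib cong: if_cong)
  qed
  have inv: "?f (?f' X) = X" for X
    by (simp add: replace_column_def column_def vec_eq_iff)
  have "(\<integral>\<^sup>+H. \<phi> H \<partial>gauss) = (\<integral>\<^sup>+z. \<phi> (?f z) \<partial>gauss)"
    using adj inv by (intro nn_integral_gauss_coisometry[symmetric]) auto
  also have "\<dots> = (\<integral>\<^sup>+H. (\<integral>\<^sup>+u. \<phi> (replace_column i H u) \<partial>gauss) \<partial>gauss)"
  proof (subst nn_integral_gauss_prod)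
    have "?f \<in> borel_measurable borel" using gauss_distr_coisometry(2)[of ?f ?f'] adj inv by blast
    then show "(\<lambda>z. \<phi> (?f z)) \<in> borel_measurable borel" by measurable
  qed simp
  finally show ?thesis .
qed

text \<open>With the other columns, at most k - 1 vectors, held fixed, there are
  \<open>q = l - k + 1\<close> orthonormal directions orthogonal to them. The resampled column has
  independent standard coordinates along these, so the bound is the inverse chi-squared mean 1 / (q
  - 2). The hypothesis on the dimensions is exactly q >= 3.\<close>

lemma nn_integral_column_pinv_le:
  fixes i :: "'k::finite"
  assumes "CARD('l::finite) \<ge> CARD('k) + 2"
  shows "(\<integral>\<^sup>+H. (if det (transpose H ** H) \<noteq> 0 then ennreal ((norm (column i (pinv (H :: real^'k^'l))))\<^sup>2) else 0) \<partial>gauss)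
    \<le> ennreal (1 / (real CARD('l) - real CARD('k) - 1))"
proof -
  let ?\<phi> = "\<lambda>H :: real^'k^'l. if det (transpose H ** H) \<noteq> 0 then ennreal ((norm (column i (pinv H)))\<^sup>2) else 0"
  define q where "q = CARD('l) - CARD('k) + 1"
  have q: "q \<ge> 3" "real q - 2 = real CARD('l) - real CARD('k) - 1"
    using assms by (simp_all add: q_def of_nat_diff)
  have id: "(\<lambda>H. H) \<in> borel_measurable (borel :: (real^'k^'l) measure)" by simp
  have "(\<lambda>H. norm (pinv H *v axis i 1)) \<in> borel_measurable (borel :: (real^'k^'l) measure)"
    by (intro borel_measurable_norm_matrix_vector_mult borel_measurable_pinv id)
  then have [measurable]: "(\<lambda>H. norm (column i (pinv H))) \<in> borel_measurable (borel :: (real^'k^'l) measure)"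
    by (simp add: matrix_vector_mult_basis)
  have [measurable]: "(\<lambda>H. det (transpose H ** H)) \<in> borel_measurable (borel :: (real^'k^'l) measure)"
    by (intro borel_measurable_det borel_measurable_matrix_mult borel_measurable_matrix_transpose id)
  have "(\<integral>\<^sup>+H. ?\<phi> H \<partial>gauss) = (\<integral>\<^sup>+H. (\<integral>\<^sup>+u. ?\<phi> (replace_column i H u) \<partial>gauss) \<partial>gauss)"
    by (rule nn_integral_gauss_replace_column) measurable
  also have "\<dots> \<le> (\<integral>\<^sup>+(H :: real^'k^'l). ennreal (1 / (real q - 2)) \<partial>gauss)"
  proof (rule nn_integral_mono)
    fix H :: "real^'k^'l"
    have "card ((\<lambda>j. column j H) ` (UNIV - {i})) \<le> CARD('k) - 1"
      using card_image_le[of "UNIV - {i}" "\<lambda>j. column j H"] by (simp add: card_Diff_singleton)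
    moreover have "CARD('k) \<ge> 1" by (simp add: Suc_le_eq)
    moreover have "q + CARD('k) = CARD('l) + 1" using assms by (simp add: q_def)
    ultimately have "card ((\<lambda>j. column j H) ` (UNIV - {i})) + q \<le> CARD('l)" by linarith
    then have "card ((\<lambda>j. column j H) ` (UNIV - {i})) + q \<le> DIM(real^'l)" by simp
    then obtain R where R: "finite R" "card R = q" "pairwise orthogonal R" "\<And>w. w \<in> R \<Longrightarrow> norm w = 1"
      "\<And>w j. w \<in> R \<Longrightarrow> j \<noteq> i \<Longrightarrow> w \<bullet> column j H = 0"
      using exists_orthonormal_complement[of "(\<lambda>j. column j H) ` (UNIV - {i})" q] by auto
    have "(\<integral>\<^sup>+u. ?\<phi> (replace_column i H u) \<partial>gauss) \<le> (\<integral>\<^sup>+u. inverse (ennreal (\<Sum>w\<in>R. (w \<bullet> u)\<^sup>2)) \<partial>gauss)"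
    proof (rule nn_integral_mono)
      fix u
      show "?\<phi> (replace_column i H u) \<le> inverse (ennreal (\<Sum>w\<in>R. (w \<bullet> u)\<^sup>2))"
      proof (cases "det (transpose (replace_column i H u) ** replace_column i H u) = 0")
        case False
        have "ennreal ((norm (column i (pinv (replace_column i H u))))\<^sup>2)
            \<le> inverse (ennreal (\<Sum>w\<in>R. (w \<bullet> column i (replace_column i H u))\<^sup>2))"
          using R by (intro norm_column_pinv_le[OF False]) (auto simp: column_replace_column)
        then show ?thesis using False by (simp add: column_replace_column)
      qed simp
    qed
    also have "\<dots> = ennreal (1 / (real q - 2))"
      using R q(1) nn_integral_gauss_inverse_sum_squares[of R] by simp
    finally show "(\<integral>\<^sup>+u. ?\<phi> (replace_column i H u) \<partial>gauss) \<le> ennreal (1 / (real q - 2))" .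
  qed
  also have "\<dots> = ennreal (1 / (real CARD('l) - real CARD('k) - 1))"
    using gauss.emeasure_space_1[where 'a="real^'k^'l"] by (simp add: q(2))
  finally show ?thesis .
qed

text \<open>The Leibniz expansion is a polynomial in t. It is not zero, since at t = |Y| + 1 a
  kernel vector would be stretched by \<open>Y\<close> by more than its norm allows.\<close>

lemma det_add_scaled_mat_poly:
  fixes Y :: "real^'k^'k"
  shows "\<exists>P. P \<noteq> 0 \<and> (\<forall>t. det (Y + t *\<^sub>R mat 1) = poly P t)"
proof -
  define P where "P = (\<Sum>p | p permutes (UNIV :: 'k set). [:of_int (sign p):] * (\<Prod>i\<in>UNIV. [:Y $ i $ p i, if i = p i then 1 else 0:]))"
  have P: "det (Y + t *\<^sub>R mat 1) = poly P t" for t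
    by (simp add: det_def P_def poly_sum poly_prod mat_def if_distrib[where f="\<lambda>q. poly q t"] if_distrib[where f="\<lambda>x. _ + t * x"] cong: if_cong)
  moreover have "P \<noteq> 0"
  proof
    assume "P = 0"
    then have "det (Y + (spectral_norm Y + 1) *\<^sub>R mat 1) = 0" using P by simp
    then obtain x where x: "x \<noteq> 0" "(Y + (spectral_norm Y + 1) *\<^sub>R mat 1) *v x = 0"
      using matrix_left_invertible_ker[of "Y + (spectral_norm Y + 1) *\<^sub>R mat 1"]
        invertible_left_inverse[of "Y + (spectral_norm Y + 1) *\<^sub>R mat 1"] by (auto simp: invertible_det_nz)
    then have "Y *v x = - ((spectral_norm Y + 1) *\<^sub>R x)"
      by (simp add: matrix_vector_mult_add_rdistrib scaleR_matrix_vector_assoc[symmetric] eq_neg_iff_add_eq_0)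
    then have "norm (Y *v x) = (spectral_norm Y + 1) * norm x"
      using spectral_norm_nonneg[of Y] by simp
    then show False using spectral_norm_bound[of Y x] x(1) by (simp add: distrib_right)
  qed
  ultimately show ?thesis by blast
qed

lemma emeasure_gauss_real_finite:
  assumes "finite (T :: real set)"
  shows "emeasure gauss T = 0"
proof -
  have "T \<in> null_sets lborel" using assms by (rule finite_imp_null_set_lborel)
  then have "T \<in> null_sets std_normal_distribution"
    by (subst null_sets_density_iff) (auto simp: AE_iff_null_sets dest: AE_not_in)
  then show ?thesis by (simp add: gauss_real null_setsD1)
qed

text \<open>Along a suitable direction \<open>W\<close>, a square block of \<open>H\<close> runs through \<open>Y + t I\<close>, which is singular for
  finitely many \<open>t\<close> only.\<close>

lemma AE_gauss_full_rank:
  assumes "CARD('k::finite) \<le> CARD('l::finite)"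
  shows "AE H in gauss. det (transpose H ** (H :: real^'k^'l)) \<noteq> 0"
proof -
  obtain \<iota> :: "'k \<Rightarrow> 'l" where inj: "inj \<iota>" 
    using card_le_inj[of "UNIV :: 'k set" "UNIV :: 'l set"] assms by auto
  define blk where "blk H = (\<chi> i j. H $ (\<iota> i) $ j)" for H :: "real^'k^'l"
  define W :: "real^'k^'l" where "W = (\<chi> l j. if l = \<iota> j then 1 else 0)"
  have bW: "blk W = mat 1" using inj by (auto simp: blk_def W_def mat_def vec_eq_iff inj_eq)
  have "W $ \<iota> i $ i = 1" for i by (simp add: W_def)
  then have "W \<noteq> 0" by (metis zero_index zero_neq_one)
  \<comment> \<open>Resampling a direction requires a unit vector; the normalisation only rescales
    the exceptional values of the parameter by the factor \<open>c\<close>.\<close>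
  define c where "c = inverse (norm W)"
  have c: "c > 0" "norm (c *\<^sub>R W) = 1" using \<open>W \<noteq> 0\<close> by (simp_all add: c_def)
  have [measurable]: "(\<lambda>H. det (blk H)) \<in> borel_measurable borel"
    unfolding blk_def by (intro borel_measurable_det borel_measurable_matrixI) (simp add: borel_measurable_entry)
  let ?Z = "{H. det (blk H) = 0}"
  have "emeasure gauss ?Z = (\<integral>\<^sup>+H. indicator ?Z H \<partial>gauss)" by simp
  also have "\<dots> = (\<integral>\<^sup>+H. (\<integral>\<^sup>+t. indicator ?Z (H - ((c *\<^sub>R W) \<bullet> H) *\<^sub>R (c *\<^sub>R W) + t *\<^sub>R (c *\<^sub>R W)) \<partial>gauss) \<partial>gauss)"
    using c(2) by (rule nn_integral_gauss_replace_direction) measurable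
  also have "\<dots> = (\<integral>\<^sup>+(H :: real^'k^'l). 0 \<partial>gauss)"
  proof (rule nn_integral_cong)
    fix H :: "real^'k^'l"
    let ?Y = "H - ((c *\<^sub>R W) \<bullet> H) *\<^sub>R (c *\<^sub>R W)"
    obtain P where P: "P \<noteq> 0" "\<And>t. det (blk ?Y + t *\<^sub>R mat 1) = poly P t" using det_add_scaled_mat_poly by blast
    let ?T = "(\<lambda>s. s / c) ` {s. poly P s = 0}"
    have T: "finite ?T" using poly_roots_finite[OF P(1)] by simp
    have "blk (?Y + t *\<^sub>R (c *\<^sub>R W)) = blk ?Y + (t * c) *\<^sub>R blk W" for t
      by (simp add: blk_def vec_eq_iff)
    then have "(indicator ?Z (?Y + t *\<^sub>R (c *\<^sub>R W)) :: ennreal) = indicator ?T t" for t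
      using c(1) P(2)[of "t * c"] by (auto simp: bW indicator_def image_iff)
    then show "(\<integral>\<^sup>+t. indicator ?Z (?Y + t *\<^sub>R (c *\<^sub>R W)) \<partial>gauss) = 0"
      using emeasure_gauss_real_finite[OF T] T by (simp add: finite_imp_closed)
  qed
  finally have "AE H in gauss. H \<notin> ?Z" by (intro AE_not_in) (simp add: null_sets_def)
  then show ?thesis
  proof eventually_elim
    case (elim H)
    have "x = 0" if "H *v x = 0" for x
    proof -
      have "blk H *v x = 0" using that by (simp add: blk_def matrix_vector_mult_def vec_eq_iff)
      then show ?thesis using elim matrix_left_invertible_ker[of "blk H"] invertible_left_inverse[of "blk H"]
        by (auto simp: invertible_det_nz)
    qed
    then show ?case by (simp add: full_rank_iff)
  qed
qed

section \<open>The deterministic error bound\<close>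

text \<open>For \<open>H\<close> of full rank both norms are the reciprocal of the smallest singular
  value. Otherwise \<open>S\<close> is singular and \<open>matrix_inv S\<close> takes its default
  value. Spelling out that value makes the right side a function of \<open>H\<close> alone, whose
  law is known.\<close>

lemma spectral_norm_inv_diagonal_of_singular_values:
  fixes H :: "real^'k^'l" and S :: "real^'k^'k"
  assumes S: "diagonal_of_singular_values S H" and le: "CARD('k) \<le> CARD('l)"
  shows "spectral_norm (matrix_inv S) =
    (if det (transpose H ** H) \<noteq> 0 then spectral_norm (pinv H) else spectral_norm (matrix_inv (0 :: real^'k^'k)))"
proof -
  obtain v where v: "singular_system H v" using singular_system_exists by blast
  define s where "s i = norm (H *v v i)" for i
  \<comment> \<open>The last index when counting from 0, hence that of the smallest singular
    value.\<close>
  define r where "r = CARD('k) - 1"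
  define \<sigma> where "\<sigma> = s r"
  have r: "r < CARD('k)" by (simp add: r_def)
  have s_ge: "\<sigma> \<le> s i" if "i < CARD('k)" for i
    using singular_system_mono[OF v, of i r] that r by (simp add: s_def \<sigma>_def r_def)
  have \<sigma>0: "\<sigma> \<ge> 0" by (simp add: \<sigma>_def s_def)
  define d where "d i = S $ i $ i" for i
  have diag: "S $ i $ j = 0" if "i \<noteq> j" for i j
    using S that by (simp add: diagonal_of_singular_values_def)
  have "image_mset d (mset_set UNIV) = mset (map s [0..<CARD('k)])"
    using S le unfolding diagonal_of_singular_values_def singular_system_values[OF v]
    by (simp add: d_def[abs_def] s_def[abs_def] min_absorb2)
  then have "set_mset (image_mset d (mset_set UNIV)) = set_mset (mset (map s [0..<CARD('k)]))" by simp
  then have d_range: "range d = s ` {..<CARD('k)}" by (simp add: atLeast0LessThan)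
  have d_ge: "\<sigma> \<le> d i" for i
  proof -
    have "d i \<in> s ` {..<CARD('k)}" using d_range by blast
    then show ?thesis using s_ge by auto
  qed
  obtain i0 where i0: "d i0 = \<sigma>"
  proof -
    have "\<sigma> \<in> range d" using r by (auto simp: d_range \<sigma>_def)
    then show ?thesis using that by auto
  qed
  have H_ge: "\<sigma> * norm c \<le> norm (H *v c)" for c
  proof -
    have "(\<sigma> * norm c)\<^sup>2 = (\<Sum>i<CARD('k). (v i \<bullet> c)\<^sup>2 * \<sigma>\<^sup>2)"
      by (simp add: power_mult_distrib singular_system_norm(1)[OF v, of c] sum_distrib_left mult.commute)
    also have "\<dots> \<le> (norm (H *v c))\<^sup>2"
      unfolding singular_system_norm(2)[OF v, of c] using s_ge \<sigma>0
      by (intro sum_mono mult_left_mono power_mono) (auto simp: s_def)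
    finally show ?thesis by (rule power2_le_imp_le) simp
  qed
  show ?thesis
  proof (cases "det (transpose H ** H) = 0")
    case True
    then obtain x where x: "H *v x = 0" "x \<noteq> 0" using full_rank_iff by blast
    then have "\<sigma> * norm x \<le> 0" using H_ge[of x] by simp
    then have "\<sigma> = 0" using x \<sigma>0 by (simp add: mult_le_0_iff)
    then have "det S = 0"
      using i0 diag by (subst det_diagonal) (auto simp: d_def)
    then show ?thesis using True by (simp add: matrix_inv_singular)
  next
    case full: False
    have "v r \<noteq> 0" using singular_system_inner[OF v r r] by auto
    then have "H *v v r \<noteq> 0" using full_rank_mult_eq_0[OF full] by blast
    then have \<sigma>: "\<sigma> > 0" by (simp add: \<sigma>_def s_def)
    have "spectral_norm (pinv H) = 1 / \<sigma>"
    proof (rule spectral_norm_eqI)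
      fix y
      let ?u = "pinv H *v y"
      obtain c where c: "?u = H *v c" using pinv_range[OF full] by blast
      have "(norm ?u)\<^sup>2 = (transpose H *v ?u) \<bullet> c"
        unfolding power2_norm_eq_inner transpose_inner c[symmetric] ..
      also have "\<dots> = y \<bullet> c" by (simp only: transpose_mult_pinv[OF full])
      also have "\<dots> \<le> norm y * norm c" by (rule norm_cauchy_schwarz)
      finally have "\<sigma> * (norm ?u)\<^sup>2 \<le> \<sigma> * (norm y * norm c)" using \<sigma>0 by (rule mult_left_mono)
      also have "\<dots> = norm y * (\<sigma> * norm c)" by simp
      also have "\<dots> \<le> norm y * norm ?u" unfolding c by (intro mult_left_mono H_ge) simp
      finally have "norm ?u * (\<sigma> * norm ?u) \<le> norm ?u * norm y" by (simp add: power2_eq_square mult_ac)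
      then have "\<sigma> * norm ?u \<le> norm y" by (cases "?u = 0") auto
      then show "norm ?u \<le> 1 / \<sigma> * norm y" using \<sigma> by (simp add: field_simps)
    next
      show "norm (v r) = 1" using singular_system_inner[OF v r r] by (simp add: norm_eq_1)
      \<comment> \<open>Expanding in the singular system shows that \<open>v r\<close> is an
        eigenvector of the Gram matrix. The pseudo-inverse therefore stretches it by
        \<open>\<sigma> / \<sigma>^2\<close>, and the upper bound is attained.\<close>
      let ?g = "transpose H *v (H *v v r)"
      have "?g = (\<Sum>i<CARD('k). (v i \<bullet> ?g) *\<^sub>R v i)"
        by (rule singular_system_expand[OF v, symmetric])
      also have "\<dots> = (\<Sum>i<CARD('k). if i = r then (s r)\<^sup>2 *\<^sub>R v i else 0)"
        using singular_system_orth[OF v] r unfolding inner_transpose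
        by (intro sum.cong refl) (auto simp: s_def power2_norm_eq_inner)
      finally have "?g = \<sigma>\<^sup>2 *\<^sub>R v r" using r by (simp add: \<sigma>_def)
      then have "\<sigma>\<^sup>2 *\<^sub>R (pinv H *v v r) = H *v v r"
        using pinv_mult_gram[OF full, of "v r"] by (simp add: matrix_vector_mult_scaleR)
      then have "norm (\<sigma>\<^sup>2 *\<^sub>R (pinv H *v v r)) = \<sigma>" by (simp add: \<sigma>_def s_def)
      then have "\<sigma> * (\<sigma> * norm (pinv H *v v r)) = \<sigma> * 1" by (simp add: power2_eq_square mult.assoc)
      then show "1 / \<sigma> \<le> norm (pinv H *v v r)" using \<sigma> by (simp add: field_simps)
    qed
    moreover have "spectral_norm (matrix_inv S) = 1 / \<sigma>"
    proof -
      define D :: "real^'k^'k" where "D = (\<chi> i j. if i = j then 1 / d i else 0)"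
      have "S ** D = mat 1"
      proof -
        have "(\<Sum>a\<in>UNIV. S $ i $ a * D $ a $ j) = (if i = j then 1 else 0)" for i j
        proof -
          have "(\<Sum>a\<in>UNIV. S $ i $ a * D $ a $ j) = (\<Sum>a\<in>{j}. S $ i $ a * D $ a $ j)"
            by (intro sum.mono_neutral_right) (auto simp: D_def)
          then show ?thesis using diag[of i j] d_ge[of j] \<sigma> by (auto simp: D_def d_def)
        qed
        then show ?thesis by (simp add: matrix_matrix_mult_def mat_def vec_eq_iff)
      qed
      then have "det S \<noteq> 0" "matrix_inv S = D"
        using invertible_right_inverse[of S] matrix_inv_right(2)[of S]
        by (auto simp: invertible_det_nz) (metis matrix_mul_assoc matrix_mul_lid matrix_mul_rid)
      have Dx: "(D *v x) $ i = x $ i / d i" for x i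
      proof -
        have "(D *v x) $ i = (\<Sum>j\<in>{i}. D $ i $ j * x $ j)"
          unfolding matrix_vector_mult_def vec_lambda_beta by (intro sum.mono_neutral_right) (auto simp: D_def)
        then show ?thesis by (simp add: D_def)
      qed
      have "spectral_norm D = 1 / \<sigma>"
      proof (rule spectral_norm_eqI)
        fix x
        have "norm (D *v x) \<le> norm ((1 / \<sigma>) *\<^sub>R x)"
        proof (rule norm_le_componentwise_cart)
          fix i
          have "\<bar>x $ i\<bar> / d i \<le> \<bar>x $ i\<bar> / \<sigma>" using d_ge[of i] \<sigma> by (intro divide_left_mono) auto
          then show "norm ((D *v x) $ i) \<le> norm (((1 / \<sigma>) *\<^sub>R x) $ i)"
            using d_ge[of i] \<sigma> by (simp add: Dx)
        qed
        then show "norm (D *v x) \<le> 1 / \<sigma> * norm x" using \<sigma> by simp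
      next
        show "norm (axis i0 1 :: real^'k) = 1" by (simp add: norm_eq_1 inner_axis_axis)
        show "1 / \<sigma> \<le> norm (D *v axis i0 1)"
          using component_le_norm_cart[of "D *v axis i0 1" i0] \<sigma> by (simp add: Dx i0)
      qed
      then show ?thesis by (simp add: \<open>matrix_inv S = D\<close>)
    qed
    ultimately show ?thesis using full by simp
  qed
qed

lemma times_transpose_mult: "times_transpose Q *v u = (\<Sum>q\<leftarrow>Q. (q \<bullet> u) *\<^sub>R q)"
proof (induction Q)
  case Nil
  then show ?case by (simp add: times_transpose_def)
next
  case (Cons a Q)
  have "(\<chi> i j. a $ i * a $ j) *v u = (a \<bullet> u) *\<^sub>R a"
    by (simp add: matrix_vector_mult_def vec_eq_iff inner_vec_def sum_distrib_left mult_ac)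
  then show ?case using Cons.IH by (simp add: times_transpose_def matrix_vector_mult_add_rdistrib)
qed

text \<open>The projector enters the error bound only by fixing the range of \<open>A ** G\<close>
  and by its residual not being longer than the original vector.\<close>

lemma orthonormal_basis_projection:
  assumes Q: "orthonormal_basis Q V"
  shows "u \<in> V \<Longrightarrow> times_transpose Q *v u = u" and "norm (u - times_transpose Q *v u) \<le> norm u"
proof -
  have inner: "Q ! i \<bullet> Q ! j = (if i = j then 1 else 0)" if "i < length Q" "j < length Q" for i j
    using Q that by (simp add: orthonormal_basis_def)
  have dist: "distinct Q"
    unfolding distinct_conv_nth using inner by (metis zero_neq_one)
  have T: "times_transpose Q *v u = (\<Sum>q\<in>set Q. (u \<bullet> q) *\<^sub>R q)" for u
    using dist by (simp add: times_transpose_mult sum_list_distinct_conv_sum_set inner_commute)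
  have orth: "pairwise orthogonal (set Q)"
    using inner by (fastforce simp: pairwise_def orthogonal_def in_set_conv_nth)
  have nrm: "norm q = 1" if "q \<in> set Q" for q
    using that inner by (auto simp: in_set_conv_nth norm_eq_1)
  show "u \<in> V \<Longrightarrow> times_transpose Q *v u = u"
    unfolding T using Q orth nrm by (intro orthonormal_basis_expand) (auto simp: orthonormal_basis_def)
  define t where "t = times_transpose Q *v u"
  have "(norm t)\<^sup>2 = (\<Sum>q\<in>set Q. (norm ((u \<bullet> q) *\<^sub>R q))\<^sup>2)"
    unfolding t_def T using orth by (intro norm_sum_Pythagorean) (auto simp: pairwise_def orthogonal_def)
  also have "\<dots> = (\<Sum>q\<in>set Q. (u \<bullet> q)\<^sup>2)" using nrm by (simp add: power_mult_distrib)
  also have "\<dots> = u \<bullet> t" by (simp add: t_def T inner_sum_right power2_eq_square)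
  finally have "(norm (u - t))\<^sup>2 = (norm u)\<^sup>2 - (norm t)\<^sup>2"
    by (simp add: power2_norm_eq_inner inner_diff_left inner_diff_right inner_commute)
  then have "(norm (u - t))\<^sup>2 \<le> (norm u)\<^sup>2" by simp
  then show "norm (u - times_transpose Q *v u) \<le> norm u"
    unfolding t_def by (rule power2_le_imp_le) simp
qed

text \<open>\<open>A - A G X\<close> has the same image under \<open>I - Q Q\<^sup>T\<close> as \<open>A\<close>, whatever \<open>X\<close>. With \<open>X = (V\<^sub>1\<^sup>T G)\<^sup>+ V\<^sub>1\<^sup>T\<close> for
  the leading right singular vectors \<open>V\<^sub>1\<close>, here \<open>u = X x\<close>, only the trailing ones contribute to \<open>A (x - G u)\<close>.\<close>

lemma range_projection_error_le:
  fixes A :: "real^'n^'m" and G :: "real^'l^'n"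
  assumes v: "singular_system A v" and k: "k < CARD('n)"
    and Q: "orthonormal_basis Q (range (\<lambda>x. (A ** G) *v x))"
    and u: "\<And>i. i < k \<Longrightarrow> (transpose G *v v i) \<bullet> u = v i \<bullet> x"
    and x: "norm x = 1"
  shows "norm (((mat 1 - times_transpose Q) ** A) *v x)
    \<le> norm (A *v v k) + sqrt (\<Sum>i\<in>{k..<CARD('n)}. (norm (A *v v i) * ((transpose G *v v i) \<bullet> u))\<^sup>2)"
proof -
  let ?T = "times_transpose Q" and ?I = "{k..<CARD('n)}"
  have I: "?I \<subseteq> {..<CARD('n)}" by auto
  let ?r = "x - G *v u"
  have "?T *v ((A ** G) *v u) = (A ** G) *v u"
    by (rule orthonormal_basis_projection(1)[OF Q]) auto
  then have "((mat 1 - ?T) ** A) *v x = (A *v ?r) - ?T *v (A *v ?r)"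
    by (simp add: matrix_vector_mul_assoc[symmetric] matrix_vector_mult_diff_rdistrib matrix_vector_mult_diff_distrib)
  then have le: "norm (((mat 1 - ?T) ** A) *v x) \<le> norm (A *v ?r)"
    using orthonormal_basis_projection(2)[OF Q] by simp
  have vr: "v i \<bullet> ?r = v i \<bullet> x - (transpose G *v v i) \<bullet> u" for i
    unfolding inner_diff_right transpose_inner ..
  have "?r = (\<Sum>i<CARD('n). (v i \<bullet> ?r) *\<^sub>R v i)"
    by (rule singular_system_expand[OF v, symmetric])
  also have "\<dots> = (\<Sum>i\<in>?I. (v i \<bullet> ?r) *\<^sub>R v i)"
    using u unfolding vr by (intro sum.mono_neutral_right) auto
  also have "\<dots> = (\<Sum>i\<in>?I. (v i \<bullet> x) *\<^sub>R v i) - (\<Sum>i\<in>?I. ((transpose G *v v i) \<bullet> u) *\<^sub>R v i)"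
    unfolding vr scaleR_diff_left sum_subtractf ..
  finally have r: "?r = (\<Sum>i\<in>?I. (v i \<bullet> x) *\<^sub>R v i) - (\<Sum>i\<in>?I. ((transpose G *v v i) \<bullet> u) *\<^sub>R v i)" .
  have "norm (A *v ?r) \<le> norm (A *v (\<Sum>i\<in>?I. (v i \<bullet> x) *\<^sub>R v i))
      + norm (A *v (\<Sum>i\<in>?I. ((transpose G *v v i) \<bullet> u) *\<^sub>R v i))"
    unfolding r matrix_vector_mult_diff_distrib by (rule norm_triangle_ineq4)
  moreover have "norm (A *v (\<Sum>i\<in>?I. (v i \<bullet> x) *\<^sub>R v i)) \<le> norm (A *v v k)"
  proof (rule power2_le_imp_le)
    have "(norm (A *v (\<Sum>i\<in>?I. (v i \<bullet> x) *\<^sub>R v i)))\<^sup>2 \<le> (\<Sum>i\<in>?I. (v i \<bullet> x)\<^sup>2 * (norm (A *v v k))\<^sup>2)"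
      unfolding singular_system_norm_comb(2)[OF v I]
      using singular_system_mono[OF v] by (intro sum_mono mult_left_mono power_mono) auto
    also have "\<dots> \<le> (\<Sum>i<CARD('n). (v i \<bullet> x)\<^sup>2 * (norm (A *v v k))\<^sup>2)"
      by (intro sum_mono2 I) auto
    also have "\<dots> = (norm (A *v v k))\<^sup>2"
      using x singular_system_norm(1)[OF v, of x] by (simp add: sum_distrib_right[symmetric])
    finally show "(norm (A *v (\<Sum>i\<in>?I. (v i \<bullet> x) *\<^sub>R v i)))\<^sup>2 \<le> (norm (A *v v k))\<^sup>2" .
  qed simp
  moreover have "norm (A *v (\<Sum>i\<in>?I. ((transpose G *v v i) \<bullet> u) *\<^sub>R v i))
      = sqrt (\<Sum>i\<in>?I. (norm (A *v v i) * ((transpose G *v v i) \<bullet> u))\<^sup>2)"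
  proof -
    have "(\<Sum>i\<in>?I. (norm (A *v v i) * ((transpose G *v v i) \<bullet> u))\<^sup>2)
        = (norm (A *v (\<Sum>i\<in>?I. ((transpose G *v v i) \<bullet> u) *\<^sub>R v i)))\<^sup>2"
      unfolding singular_system_norm_comb(2)[OF v I]
      by (intro sum.cong refl) (simp only: power_mult_distrib mult.commute)
    then show ?thesis by simp
  qed
  ultimately show ?thesis using le by linarith
qed

section \<open>The expected error\<close>

declare transpose_matrix_vector [simp del]

text \<open>The two factors are the coordinates of \<open>G\<close> along the leading and along the remaining elements of an
  orthonormal basis. As there is no type with \<open>n - k\<close> elements, \<open>W\<close> has \<open>n\<close> rows, of which \<open>k\<close> are masked.\<close>

lemma nn_integral_gauss_split_rows:
  fixes v :: "nat \<Rightarrow> real^'n" and \<kappa> :: "'k::finite \<Rightarrow> nat" and e :: "'n \<Rightarrow> nat" and k :: nat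
  assumes orth: "\<And>i j. i < CARD('n) \<Longrightarrow> j < CARD('n) \<Longrightarrow> v i \<bullet> v j = (if i = j then 1 else 0)"
    and expand: "\<And>x. (\<Sum>i<CARD('n). (v i \<bullet> x) *\<^sub>R v i) = x"
    and \<kappa>: "bij_betw \<kappa> UNIV {..<k}" and e: "bij_betw e UNIV {..<CARD('n)}" and k: "k \<le> CARD('n)"
    and \<Phi>: "\<Phi> \<in> borel_measurable borel"
  shows "(\<integral>\<^sup>+(G :: real^'l^'n). \<Phi> ((\<chi> l i. (transpose G *v v (\<kappa> i)) $ l) :: real^'k^'l,
      \<chi> j. if k \<le> e j then transpose G *v v (e j) else 0) \<partial>gauss)
    = (\<integral>\<^sup>+H. (\<integral>\<^sup>+W. \<Phi> (H, \<chi> j. if k \<le> e j then W $ j else 0) \<partial>gauss) \<partial>gauss)"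
proof -
  \<comment> \<open>\<open>F\<close> assembles a matrix from its coordinates and the adjoint
    \<open>F'\<close> extracts them. \<open>F (F' G) = G\<close> makes \<open>F\<close> preserve the
    Gaussian measure, while \<open>F'\<close> after \<open>F\<close> only masks the first k rows of
    \<open>W\<close> in the order given by \<open>e\<close>.\<close>
  define F :: "(real^'k^'l) \<times> (real^'l^'n) \<Rightarrow> real^'l^'n" where
    "F z = (\<Sum>i\<in>UNIV. outer (v (\<kappa> i)) (column i (fst z))) + (\<Sum>j | k \<le> e j. outer (v (e j)) (snd z $ j))" for z
  define F' :: "real^'l^'n \<Rightarrow> (real^'k^'l) \<times> (real^'l^'n)" where
    "F' G = (\<chi> l i. (transpose G *v v (\<kappa> i)) $ l, \<chi> j. if k \<le> e j then transpose G *v v (e j) else 0)" for G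
  have \<kappa>_less: "\<kappa> i < k" for i using \<kappa> by (auto simp: bij_betw_def)
  have \<kappa>_n: "\<kappa> i < CARD('n)" for i using less_le_trans[OF \<kappa>_less k] .
  have e_less: "e j < CARD('n)" for j using e by (auto simp: bij_betw_def)
  have \<kappa>_eq: "\<kappa> i = \<kappa> i' \<longleftrightarrow> i = i'" for i i' using \<kappa> by (auto simp: bij_betw_def inj_eq)
  have e_eq: "e j = e j' \<longleftrightarrow> j = j'" for j j' using e by (auto simp: bij_betw_def inj_eq)
  have outer_G: "outer b a \<bullet> G = a \<bullet> (transpose G *v b)" for a :: "real^'l" and b :: "real^'n" and G
  proof -
    have "outer b a \<bullet> G = b \<bullet> (G *v a)"
      by (simp add: outer_inner inner_vec_def[of b] matrix_vector_mult_def inner_vec_def[of "G $ _"])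
    then show ?thesis by (metis inner_transpose inner_commute)
  qed
  have adj: "F z \<bullet> G = z \<bullet> F' G" for z G
  proof -
    have "fst z \<bullet> fst (F' G) = (\<Sum>l\<in>UNIV. \<Sum>i\<in>UNIV. fst z $ l $ i * (transpose G *v v (\<kappa> i)) $ l)"
      by (simp add: F'_def inner_vec_def)
    also have "\<dots> = (\<Sum>i\<in>UNIV. column i (fst z) \<bullet> (transpose G *v v (\<kappa> i)))"
      by (subst sum.swap) (simp add: inner_vec_def column_def)
    finally have 1: "fst z \<bullet> fst (F' G) = (\<Sum>i\<in>UNIV. outer (v (\<kappa> i)) (column i (fst z)) \<bullet> G)"
      by (simp only: outer_G)
    have "snd z \<bullet> snd (F' G) = (\<Sum>j\<in>UNIV. if k \<le> e j then snd z $ j \<bullet> (transpose G *v v (e j)) else 0)"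
      by (subst inner_vec_def) (auto simp: F'_def intro!: sum.cong)
    also have "\<dots> = (\<Sum>j | k \<le> e j. outer (v (e j)) (snd z $ j) \<bullet> G)"
      by (simp only: outer_G sum.If_cases finite) simp
    finally show ?thesis using 1 by (simp add: F_def inner_prod_def inner_add_left inner_sum_left)
  qed
  have inv: "F (F' G) = G" for G
  proof -
    have col: "column i (fst (F' G)) = transpose G *v v (\<kappa> i)" for i
      by (simp add: F'_def column_def vec_eq_iff)
    let ?h = "\<lambda>i. outer (v i) (transpose G *v v i)"
    have "(\<Sum>i\<in>UNIV. ?h (\<kappa> i)) = (\<Sum>i<k. ?h i)"
      using \<kappa> by (rule sum.reindex_bij_betw)
    moreover have "bij_betw e {j. k \<le> e j} {k..<CARD('n)}"
    proof -
      have "e ` {j. k \<le> e j} = range e \<inter> {k..}" by auto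
      then have "e ` {j. k \<le> e j} = {k..<CARD('n)}" using e by (auto simp: bij_betw_def)
      then show ?thesis using e by (auto simp: bij_betw_def intro: inj_on_subset)
    qed
    then have "(\<Sum>j | k \<le> e j. ?h (e j)) = (\<Sum>i\<in>{k..<CARD('n)}. ?h i)"
      by (rule sum.reindex_bij_betw)
    ultimately have "F (F' G) = (\<Sum>i<k. ?h i) + (\<Sum>i\<in>{k..<CARD('n)}. ?h i)"
      unfolding F_def col by (simp add: F'_def)
    also have "\<dots> = (\<Sum>i<CARD('n). ?h i)"
      using k by (simp add: lessThan_atLeast0 sum.atLeastLessThan_concat)
    also have "\<dots> = G"
    proof -
      have "(\<Sum>i<CARD('n). ?h i) $ a = G $ a" for a
      proof -
        have "(\<Sum>i<CARD('n). ?h i) $ a = (\<Sum>i<CARD('n). (v i \<bullet> axis a 1) *\<^sub>R (transpose G *v v i))"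
          by (simp add: outer_def inner_axis)
        also have "\<dots> = transpose G *v (\<Sum>i<CARD('n). (v i \<bullet> axis a 1) *\<^sub>R v i)"
          unfolding linear_sum[OF matrix_vector_mul_linear] matrix_vector_mult_scaleR ..
        also have "\<dots> = transpose G *v axis a 1" unfolding expand ..
        also have "\<dots> = G $ a" by (simp only: matrix_vector_mult_basis) (simp add: column_def transpose_def vec_eq_iff)
        finally show ?thesis .
      qed
      then show ?thesis by (simp add: vec_eq_iff)
    qed
    finally show ?thesis .
  qed
  have F'_F: "F' (F (H, W)) = (H, \<chi> j. if k \<le> e j then W $ j else 0)" for H W
  proof -
    have outer_T: "transpose (outer b a) *v u = (b \<bullet> u) *\<^sub>R a" for a :: "real^'l" and b u :: "real^'n"
      by (rule vector_eq_ldot[THEN iffD1]) (metis inner_commute inner_scaleR_right mult.commute outer_G outer_inner_outer)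
    have "linear (\<lambda>G :: real^'l^'n. transpose G *v u)" for u
      by (rule linearI) (simp_all add: transpose_def matrix_vector_mult_def vec_eq_iff distrib_right sum.distrib sum_distrib_left mult.assoc)
    note lin = linear_sum[OF this] linear_add[OF this]
    have T: "transpose (F (H, W)) *v u = (\<Sum>i\<in>UNIV. (v (\<kappa> i) \<bullet> u) *\<^sub>R column i H) + (\<Sum>j | k \<le> e j. (v (e j) \<bullet> u) *\<^sub>R W $ j)" for u
      unfolding F_def lin outer_T by simp
    have T1: "transpose (F (H, W)) *v v (\<kappa> i) = column i H" for i
    proof -
      have "(\<Sum>i'\<in>UNIV. (v (\<kappa> i') \<bullet> v (\<kappa> i)) *\<^sub>R column i' H) = (\<Sum>i'\<in>UNIV. if i' = i then column i H else 0)"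
        using \<kappa>_n by (intro sum.cong refl) (auto simp: orth \<kappa>_eq)
      moreover have "(\<Sum>j | k \<le> e j. (v (e j) \<bullet> v (\<kappa> i)) *\<^sub>R W $ j) = 0"
        using \<kappa>_less[of i] \<kappa>_n e_less by (intro sum.neutral) (auto simp: orth)
      ultimately show ?thesis unfolding T by simp
    qed
    have T2: "transpose (F (H, W)) *v v (e j) = W $ j" if "k \<le> e j" for j
    proof -
      have "(\<Sum>i\<in>UNIV. (v (\<kappa> i) \<bullet> v (e j)) *\<^sub>R column i H) = 0"
      proof (intro sum.neutral ballI)
        fix i
        have "\<kappa> i \<noteq> e j" using \<kappa>_less[of i] that by simp
        then show "(v (\<kappa> i) \<bullet> v (e j)) *\<^sub>R column i H = 0" using \<kappa>_n e_less by (simp add: orth)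
      qed
      moreover have "(\<Sum>j' | k \<le> e j'. (v (e j') \<bullet> v (e j)) *\<^sub>R W $ j') = (\<Sum>j' | k \<le> e j'. if j' = j then W $ j else 0)"
        using e_less by (intro sum.cong refl) (auto simp: orth e_eq)
      ultimately show ?thesis using that unfolding T by simp
    qed
    show ?thesis by (simp add: F'_def T1 T2 vec_eq_iff column_def cong: if_cong)
  qed
  have F'm: "F' \<in> borel_measurable borel"
  proof -
    have "linear F'"
    proof (rule linearI)
      show "F' (x + y) = F' x + F' y" for x y
        by (rule vector_eq_ldot[THEN iffD1]) (simp add: adj[symmetric] inner_add_right)
      show "F' (c *\<^sub>R x) = c *\<^sub>R F' x" for c x
        by (rule vector_eq_ldot[THEN iffD1]) (simp add: adj[symmetric])
    qed
    then show ?thesis by (rule borel_measurable_linear)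
  qed
  have Fm: "F \<in> borel_measurable borel" using gauss_distr_coisometry(2)[OF adj inv] .
  note [measurable] = F'm Fm \<Phi>
  have "(\<integral>\<^sup>+G. \<Phi> (F' G) \<partial>gauss) = (\<integral>\<^sup>+z. \<Phi> (F' (F z)) \<partial>gauss)"
    by (rule nn_integral_gauss_coisometry[OF adj inv, symmetric]) measurable
  also have "\<dots> = (\<integral>\<^sup>+H. (\<integral>\<^sup>+W. \<Phi> (F' (F (H, W))) \<partial>gauss) \<partial>gauss)"
    by (rule nn_integral_gauss_prod) measurable
  finally show ?thesis unfolding F'_F unfolding F'_def .
qed

lemma std_gaussian_matrix_nn_integral:
  fixes X :: "'a \<Rightarrow> real^'m^'n"
  assumes "prob_space M" "std_gaussian_matrix M X" and [measurable]: "\<phi> \<in> borel_measurable borel"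
  shows "(\<integral>\<^sup>+\<omega>. \<phi> (X \<omega>) \<partial>M) = (\<integral>\<^sup>+x. \<phi> x \<partial>gauss)"
proof -
  note [measurable] = std_gaussian_matrix_distr(1)[OF assms(1,2)]
  show ?thesis
    by (subst std_gaussian_matrix_distr(2)[OF assms(1,2), symmetric]) (simp_all add: nn_integral_distr)
qed

text \<open>Deliberately crude: it serves to deduce finiteness of the mean of the norm of the
  pseudo-inverse from the second moments of its columns.\<close>

lemma spectral_norm_le_columns: "spectral_norm B \<le> (\<Sum>i\<in>UNIV. 1 + (norm (column i B))\<^sup>2)"
proof -
  obtain x where x: "norm x = 1" "spectral_norm B = norm (B *v x)" using spectral_norm_attained by blast
  have "norm (B *v x) \<le> (\<Sum>i\<in>UNIV. norm (x $ i *s column i B))"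
    unfolding matrix_mult_sum by (rule norm_sum)
  also have "\<dots> \<le> (\<Sum>i\<in>UNIV. 1 + (norm (column i B))\<^sup>2)"
  proof (rule sum_mono)
    fix i
    have "\<bar>x $ i\<bar> \<le> 1" using component_le_norm_cart[of x i] x by simp
    then have "norm (x $ i *s column i B) \<le> norm (column i B)"
      by (simp add: scalar_mult_eq_scaleR mult_left_le_one_le)
    also have "\<dots> \<le> 1 + (norm (column i B))\<^sup>2"
      using zero_le_power2[of "norm (column i B) - 1"] by (simp add: power2_diff)
        (smt (verit) norm_ge_zero)
    finally show "norm (x $ i *s column i B) \<le> 1 + (norm (column i B))\<^sup>2" .
  qed
  finally show ?thesis by (simp add: x)
qed

text \<open>Enumerating pairs lets one countable supremum range over both arguments of a bilinear
  form. As \<open>prod_decode\<close> sends 0 to (0, 0), the first sequence still starts with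
  0.\<close>

lemma dense_sequence_cball_Times:
  "\<exists>(y :: nat \<Rightarrow> 'a::euclidean_space) (z :: nat \<Rightarrow> 'b::euclidean_space).
    y 0 = 0 \<and> (\<forall>n. norm (y n) \<le> 1) \<and> (\<forall>n. norm (z n) \<le> 1) \<and>
    (\<forall>a b. norm a \<le> 1 \<longrightarrow> norm b \<le> 1 \<longrightarrow> (a, b) \<in> closure (range (\<lambda>n. (y n, z n))))"
proof -
  obtain y' :: "nat \<Rightarrow> 'a" where y': "y' 0 = 0" "\<And>n. norm (y' n) \<le> 1" "cball 0 1 \<subseteq> closure (range y')"
    by (metis dense_sequence_cball)
  obtain z' :: "nat \<Rightarrow> 'b" where z': "z' 0 = 0" "\<And>n. norm (z' n) \<le> 1" "cball 0 1 \<subseteq> closure (range z')"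
    by (metis dense_sequence_cball)
  define y z where "y n = y' (fst (prod_decode n))" and "z n = z' (snd (prod_decode n))" for n
  have "range y' \<times> range z' \<subseteq> range (\<lambda>n. (y n, z n))"
  proof clarify
    fix i j
    show "(y' i, z' j) \<in> range (\<lambda>n. (y n, z n))"
      by (rule range_eqI[of _ _ "prod_encode (i, j)"]) (simp add: y_def z_def)
  qed
  then have "closure (range y') \<times> closure (range z') \<subseteq> closure (range (\<lambda>n. (y n, z n)))"
    by (metis closure_Times closure_mono)
  then have "(a, b) \<in> closure (range (\<lambda>n. (y n, z n)))" if "norm a \<le> 1" "norm b \<le> 1" for a b
    using y'(3) z'(3) that by (auto simp: subset_iff)
  moreover have "fst (prod_decode 0) = 0" by (simp add: prod_decode_def prod_decode_aux.simps)
  ultimately show ?thesis using y' z' by (intro exI[of _ y] exI[of _ z]) (auto simp: y_def z_def)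
qed

theorem theorem1p4:
  fixes A :: "real^'n^'m"
    and k p :: nat
    and M :: "'a measure" and G :: "'a \<Rightarrow> real^'l^'n" and Q :: "'a \<Rightarrow> (real^'m) list"
    and N :: "'b measure" and H :: "'b \<Rightarrow> real^'k^'l" and \<Sigma> :: "'b \<Rightarrow> real^'k^'k"
  assumes "k \<ge> 1" and "p \<ge> 2" and "k + p \<le> min CARD('m) CARD('n)"
    and "CARD('k) = k" and "CARD('l) = k + p"
    and "prob_space M" and "std_gaussian_matrix M G"
    and "\<And>\<omega>. \<omega> \<in> space M \<Longrightarrow> orthonormal_basis (Q \<omega>) (range (\<lambda>x. (A ** G \<omega>) *v x))"
    and "prob_space N" and "std_gaussian_matrix N H"
    and "\<And>\<omega>. \<omega> \<in> space N \<Longrightarrow> diagonal_of_singular_values (\<Sigma> \<omega>) (H \<omega>)"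
  shows "(\<integral>\<omega>. spectral_norm ((mat 1 - times_transpose (Q \<omega>)) ** A) \<partial>M)
    \<le> (1 + sqrt (real k / (real p - 1))) * singular_value A (k + 1)
      + (\<integral>\<omega>. spectral_norm (matrix_inv (\<Sigma> \<omega>)) \<partial>N)
        * sqrt (\<Sum>i\<in>{k<..min CARD('m) CARD('n)}. (singular_value A i)\<^sup>2)"
proof -
  let ?f = "\<lambda>\<omega>. spectral_norm ((mat 1 - times_transpose (Q \<omega>)) ** A)"
  let ?full = "\<lambda>H :: real^'k^'l. det (transpose H ** H) \<noteq> 0"
  define E where "E = (\<integral>\<omega>. spectral_norm (matrix_inv (\<Sigma> \<omega>)) \<partial>N)"
  define C where "C = sqrt (\<Sum>i\<in>{k<..min CARD('m) CARD('n)}. (singular_value A i)\<^sup>2)"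
  obtain v where v: "singular_system A v" using singular_system_exists by blast
  define \<sigma> where "\<sigma> = norm (A *v v k)"
  have kn: "k < CARD('n)" "k < CARD('m)" using assms(2,3) by auto
  have \<sigma>: "singular_value A (k + 1) = \<sigma>" "\<sigma> \<ge> 0"
    using singular_system_value[OF v, of k] kn by (simp_all add: \<sigma>_def)
  have E0: "E \<ge> 0" unfolding E_def by (simp add: spectral_norm_nonneg)
  have C0: "C \<ge> 0" by (simp add: C_def sum_nonneg)
  have p1: "real p - 1 > 0" using assms(2) by simp
  obtain \<kappa> :: "'k \<Rightarrow> nat" where \<kappa>: "bij_betw \<kappa> UNIV {..<k}"
    using finite_same_card_bij[of "UNIV :: 'k set" "{..<k}"] assms(4) by auto
  obtain e :: "'n \<Rightarrow> nat" where e: "bij_betw e UNIV {..<CARD('n)}"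
    using finite_same_card_bij[of "UNIV :: 'n set" "{..<CARD('n)}"] by auto
  have e_less: "e j < CARD('n)" for j using e by (auto simp: bij_betw_def)
  have \<kappa>_less: "\<kappa> i < k" for i using \<kappa> by (auto simp: bij_betw_def)
  \<comment> \<open>The diagonal of \<open>S\<close>, with zeros at the k masked rows.\<close>
  define s where "s j = (if k \<le> e j then norm (A *v v (e j)) else 0)" for j
  have s: "0 \<le> s j" "s j \<le> \<sigma>" for j
    using singular_system_mono[OF v, of k "e j"] e_less \<sigma>(2) by (auto simp: s_def \<sigma>_def)
  have sum_e: "(\<Sum>j\<in>UNIV. if k \<le> e j then g (e j) else 0) = (\<Sum>i\<in>{k..<CARD('n)}. g i)" for g :: "nat \<Rightarrow> real"
  proof -
    have "(\<Sum>j\<in>UNIV. if k \<le> e j then g (e j) else 0) = (\<Sum>i<CARD('n). if k \<le> i then g i else 0)"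
      by (rule sum.reindex_bij_betw[OF e])
    also have "\<dots> = (\<Sum>i\<in>{k..<CARD('n)}. g i)"
      by (intro sum.mono_neutral_cong_right) auto
    finally show ?thesis .
  qed
  \<comment> \<open>The sum over the trailing right singular vectors runs up to n; images with index
    at least m vanish, which leaves the \<open>min\<close>. The shift by one passes to indices
    counted from 1.\<close>
  have C: "sqrt (\<Sum>j\<in>UNIV. (s j)\<^sup>2) = C"
  proof -
    have "(\<Sum>j\<in>UNIV. (s j)\<^sup>2) = (\<Sum>i\<in>{k..<CARD('n)}. (norm (A *v v i))\<^sup>2)"
      unfolding sum_e[symmetric] by (intro sum.cong) (auto simp: s_def)
    also have "\<dots> = (\<Sum>i\<in>{k..<min CARD('m) CARD('n)}. (norm (A *v v i))\<^sup>2)"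
      using singular_system_zero[OF v] by (intro sum.mono_neutral_right) auto
    also have "\<dots> = (\<Sum>i\<in>{k..<min CARD('m) CARD('n)}. (singular_value A (Suc i))\<^sup>2)"
      using singular_system_value[OF v] by (intro sum.cong) auto
    also have "\<dots> = (\<Sum>i\<in>{k<..min CARD('m) CARD('n)}. (singular_value A i)\<^sup>2)"
      by (intro sum.reindex_bij_witness[of _ "\<lambda>i. i - 1" Suc]) auto
    finally show ?thesis by (simp add: C_def)
  qed
  obtain y :: "nat \<Rightarrow> real^'k" and \<beta> :: "nat \<Rightarrow> real^'n"
    where y: "y 0 = 0" "\<And>n. norm (y n) \<le> 1" and \<beta>: "\<And>n. norm (\<beta> n) \<le> 1"
      and dense: "\<And>a b. norm a \<le> 1 \<Longrightarrow> norm b \<le> 1 \<Longrightarrow> (a, b) \<in> closure (range (\<lambda>n. (y n, \<beta> n)))"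
    using dense_sequence_cball_Times[where 'a="real^'k" and 'b="real^'n"] by blast
  define X where "X H W a b = (\<Sum>j\<in>UNIV. s j * b $ j * (W $ j \<bullet> (pinv H *v a)))"
    for H :: "real^'k^'l" and W :: "real^'l^'n" and a b
  \<comment> \<open>The value \<open>top\<close> makes the pointwise bound trivial for
    rank-deficient \<open>H\<close>; these form a null set, so the integral does not change.\<close>
  define \<Phi> where "\<Phi> = (\<lambda>(H, W). if ?full H then ennreal \<sigma> + (SUP n. ennreal (X H W (y n) (\<beta> n))) else top)"
  have f_le: "ennreal (?f \<omega>) \<le> \<Phi> (\<chi> l i. (transpose (G \<omega>) *v v (\<kappa> i)) $ l, \<chi> j. if k \<le> e j then transpose (G \<omega>) *v v (e j) else 0)"
    if \<omega>: "\<omega> \<in> space M" for \<omega>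
  proof -
    define H0 :: "real^'k^'l" where "H0 = (\<chi> l i. (transpose (G \<omega>) *v v (\<kappa> i)) $ l)"
    define W0 where "W0 = (\<chi> j. if k \<le> e j then transpose (G \<omega>) *v v (e j) else 0)"
    show ?thesis
    proof (cases "?full H0")
      case True
      obtain x where x: "norm x = 1" "?f \<omega> = norm (((mat 1 - times_transpose (Q \<omega>)) ** A) *v x)"
        using spectral_norm_attained by blast
      \<comment> \<open>The leading coordinates of the maximising \<open>x\<close>; applying the
        pseudo-inverse to them gives the correction \<open>u\<close> required by
        \<open>range_projection_error_le\<close>.\<close>
      define a where "a = (\<chi> i. v (\<kappa> i) \<bullet> x)"
      define u where "u = pinv H0 *v a"
      have u: "(transpose (G \<omega>) *v v i) \<bullet> u = v i \<bullet> x" if "i < k" for i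
      proof -
        have "i \<in> range \<kappa>" using \<kappa> that by (simp add: bij_betw_def)
        then obtain i' where i': "i = \<kappa> i'" by auto
        have "(transpose (G \<omega>) *v v i) \<bullet> u = (transpose H0 *v u) $ i'"
          by (simp only: H0_def i' matrix_vector_mult_def transpose_def inner_vec_def vec_lambda_beta inner_real_def)
        also have "\<dots> = a $ i'" unfolding u_def transpose_mult_pinv[OF True] ..
        finally show ?thesis by (simp add: a_def i')
      qed
      define t where "t = sqrt (\<Sum>j\<in>UNIV. (s j * (W0 $ j \<bullet> u))\<^sup>2)"
      have t: "t \<ge> 0" by (simp add: t_def sum_nonneg)
      have t2: "t\<^sup>2 = (\<Sum>j\<in>UNIV. (s j * (W0 $ j \<bullet> u))\<^sup>2)" by (simp add: t_def sum_nonneg)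
      have "?f \<omega> \<le> \<sigma> + sqrt (\<Sum>i\<in>{k..<CARD('n)}. (norm (A *v v i) * ((transpose (G \<omega>) *v v i) \<bullet> u))\<^sup>2)"
        unfolding x(2) \<sigma>_def by (rule range_projection_error_le[OF v kn(1) assms(8)[OF \<omega>] u x(1)])
      also have "(\<Sum>i\<in>{k..<CARD('n)}. (norm (A *v v i) * ((transpose (G \<omega>) *v v i) \<bullet> u))\<^sup>2)
          = (\<Sum>j\<in>UNIV. (s j * (W0 $ j \<bullet> u))\<^sup>2)"
        unfolding sum_e[symmetric] by (intro sum.cong) (auto simp: s_def W0_def)
      finally have le: "?f \<omega> \<le> \<sigma> + t" by (simp add: t_def)
      \<comment> \<open>The normalised vector \<open>S W0 u\<close>, at which the bilinear form
        equals its norm \<open>t\<close>. For t = 0 the division makes \<open>b\<close> zero, which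
        is still in the unit ball and gives the form the value 0.\<close>
      define b where "b = (\<chi> j. s j * (W0 $ j \<bullet> u) / t)"
      have b: "norm b \<le> 1"
      proof -
        have "b = (\<chi> j. s j * (W0 $ j \<bullet> u)) /\<^sub>R t"
          by (simp add: b_def vec_eq_iff divide_inverse)
        moreover have "norm (\<chi> j. s j * (W0 $ j \<bullet> u)) = t"
          by (simp add: norm_vec_def L2_set_def t_def)
        ultimately show ?thesis using t by (cases "t = 0") simp_all
      qed
      have a1: "norm a \<le> 1"
      proof (rule power2_le_imp_le)
        have "(norm a)\<^sup>2 = (\<Sum>i\<in>UNIV. (v (\<kappa> i) \<bullet> x)\<^sup>2)"
          by (simp add: a_def norm_vec_def L2_set_def sum_nonneg)
        also have "\<dots> = (\<Sum>i<k. (v i \<bullet> x)\<^sup>2)" by (rule sum.reindex_bij_betw[OF \<kappa>])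
        also have "\<dots> \<le> (\<Sum>i<CARD('n). (v i \<bullet> x)\<^sup>2)" using kn by (intro sum_mono2) auto
        also have "\<dots> = 1\<^sup>2" using x singular_system_norm(1)[OF v, of x] by simp
        finally show "(norm a)\<^sup>2 \<le> 1\<^sup>2" .
      qed simp
      have "X H0 W0 a b = (\<Sum>j\<in>UNIV. (s j * (W0 $ j \<bullet> u))\<^sup>2) / t"
        by (simp add: X_def b_def u_def[symmetric] sum_divide_distrib power2_eq_square mult_ac)
      then have Xt: "X H0 W0 a b = t" unfolding t2[symmetric] by (simp add: power2_eq_square)
      have "ennreal (X H0 W0 (fst (a, b)) (snd (a, b))) \<le> (SUP n. ennreal (X H0 W0 (fst (y n, \<beta> n)) (snd (y n, \<beta> n))))"
      proof (rule le_SUP_dense[where f="\<lambda>z. X H0 W0 (fst z) (snd z)"])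
        show "continuous_on UNIV (\<lambda>z. X H0 W0 (fst z) (snd z))"
          unfolding X_def by (intro continuous_intros matrix_vector_mult_linear_continuous_on
            continuous_on_compose2[OF matrix_vector_mult_linear_continuous_on[of UNIV "pinv H0"]]) auto
        show "(a, b) \<in> closure (range (\<lambda>n. (y n, \<beta> n)))" using dense a1 b by blast
      qed
      then have "ennreal t \<le> (SUP n. ennreal (X H0 W0 (y n) (\<beta> n)))" by (simp add: Xt)
      moreover have "ennreal (?f \<omega>) \<le> ennreal \<sigma> + ennreal t"
        using le \<sigma>(2) t by (simp add: ennreal_plus[symmetric] ennreal_leI del: ennreal_plus)
      ultimately have "ennreal (?f \<omega>) \<le> ennreal \<sigma> + (SUP n. ennreal (X H0 W0 (y n) (\<beta> n)))"
        by (meson add_left_mono order_trans)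
      then show ?thesis using True by (simp add: \<Phi>_def H0_def[symmetric] W0_def[symmetric])
    qed (simp add: \<Phi>_def H0_def[symmetric])
  qed
  note [measurable] = borel_measurable_fst_snd
  have \<Phi>_meas: "\<Phi> \<in> borel_measurable borel"
  proof -
    have p: "(\<lambda>z :: (real^'k^'l) \<times> (real^'l^'n). pinv (fst z)) \<in> borel_measurable borel"
      by (intro borel_measurable_pinv) measurable
    have d: "(\<lambda>z :: (real^'k^'l) \<times> (real^'l^'n). det (transpose (fst z) ** fst z)) \<in> borel_measurable borel"
      by (intro borel_measurable_det borel_measurable_matrix_mult borel_measurable_matrix_transpose) measurable
    have w: "(\<lambda>z :: (real^'k^'l) \<times> (real^'l^'n). snd z) \<in> borel_measurable borel" by measurable
    note [measurable] = d borel_measurable_entry[OF p] borel_measurable_entry[OF w]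
    have [measurable]: "(\<lambda>z. X (fst z) (snd z) a b) \<in> borel_measurable borel" for a b
      unfolding X_def inner_vec_def matrix_vector_mult_def by simp
    show ?thesis unfolding \<Phi>_def split_beta by measurable
  qed
  define z2 where "z2 H = (\<Sum>i\<in>UNIV. (norm (column i (pinv H)))\<^sup>2)" for H :: "real^'k^'l"
  have full_meas[measurable]: "(\<lambda>H :: real^'k^'l. det (transpose H ** H)) \<in> borel_measurable borel"
    by (intro borel_measurable_det borel_measurable_matrix_mult borel_measurable_matrix_transpose) measurable
  have pinv_meas: "(pinv :: real^'k^'l \<Rightarrow> _) \<in> borel_measurable borel"
    by (rule borel_measurable_pinv) measurable
  have sn_meas[measurable]: "(\<lambda>H :: real^'k^'l. spectral_norm (pinv H)) \<in> borel_measurable borel"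
    by (rule borel_measurable_spectral_norm[OF pinv_meas])
  have col_meas[measurable]: "(\<lambda>H :: real^'k^'l. norm (column i (pinv H))) \<in> borel_measurable borel" for i
    using borel_measurable_norm_matrix_vector_mult[OF pinv_meas, of "axis i 1"] by (simp add: matrix_vector_mult_basis)
  have z2_meas[measurable]: "z2 \<in> borel_measurable borel" unfolding z2_def[abs_def] by measurable
  have z2_0: "z2 H \<ge> 0" for H by (simp add: z2_def sum_nonneg)
  have full_AE: "AE H in gauss. ?full H"
    using assms(4,5) by (intro AE_gauss_full_rank) simp
  let ?I = "\<integral>\<^sup>+H. ennreal (if ?full H then spectral_norm (pinv H) else 0) \<partial>gauss" and ?Z = "\<integral>\<^sup>+H. ennreal (if ?full H then z2 H else 0) \<partial>gauss"
  have z2_int: "?Z \<le> ennreal (real k / (real p - 1))"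
  proof -
    have "?Z
        = (\<integral>\<^sup>+H. (\<Sum>i\<in>UNIV. if ?full H then ennreal ((norm (column i (pinv H)))\<^sup>2) else 0) \<partial>gauss)"
      by (intro nn_integral_cong) (simp add: z2_def)
    also have "\<dots> = (\<Sum>i\<in>UNIV. \<integral>\<^sup>+H. (if ?full H then ennreal ((norm (column i (pinv H)))\<^sup>2) else 0) \<partial>gauss)"
      by (rule nn_integral_sum) measurable
    also have "\<dots> \<le> (\<Sum>i\<in>(UNIV :: 'k set). ennreal (1 / (real CARD('l) - real CARD('k) - 1)))"
      using assms(2,4,5) by (intro sum_mono nn_integral_column_pinv_le) simp
    also have "\<dots> = ennreal (real k / (real p - 1))"
      using p1 assms(4,5) by (subst sum_ennreal) (auto simp: assms(5))
    finally show ?thesis .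
  qed
  \<comment> \<open>Finiteness matters here: \<open>E\<close> is a Bochner integral and would be 0
    if the expectation diverged, whereas the estimate needs the true nonnegative integral.\<close>
  have N_int: "?I = ennreal E"
  proof -
    let ?c = "spectral_norm (matrix_inv (0 :: real^'k^'k))"
    let ?h = "\<lambda>H :: real^'k^'l. if ?full H then spectral_norm (pinv H) else ?c"
    let ?J = "\<integral>\<^sup>+\<omega>. ennreal (?h (H \<omega>)) \<partial>N"
    note Hm[measurable] = std_gaussian_matrix_distr(1)[OF assms(9,10)]
    have eq: "spectral_norm (matrix_inv (\<Sigma> \<omega>)) = ?h (H \<omega>)" if "\<omega> \<in> space N" for \<omega>
      using spectral_norm_inv_diagonal_of_singular_values[OF assms(11)[OF that]] assms(4,5) by simp
    have h_meas: "?h \<in> borel_measurable borel" by measurable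
    have "?I = (\<integral>\<^sup>+H. ennreal (?h H) \<partial>gauss)"
      by (rule nn_integral_cong_AE) (rule eventually_mono[OF full_AE], simp)
    also have "\<dots> = ?J"
      using h_meas by (intro std_gaussian_matrix_nn_integral[OF assms(9,10), symmetric]) measurable
    finally have 1: "?I = ?J" .
    have "?I
        \<le> (\<integral>\<^sup>+(H :: real^'k^'l). ennreal (real k) + ennreal (if ?full H then z2 H else 0) \<partial>gauss)"
    proof (rule nn_integral_mono)
      fix H :: "real^'k^'l"
      have "spectral_norm (pinv H) \<le> real k + z2 H"
        using spectral_norm_le_columns[of "pinv H"] assms(4) by (simp add: z2_def sum.distrib)
      then have "ennreal (spectral_norm (pinv H)) \<le> ennreal (real k) + ennreal (z2 H)"
        using z2_0 by (simp add: ennreal_plus[symmetric] ennreal_leI del: ennreal_plus)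
      then show "ennreal (if ?full H then spectral_norm (pinv H) else 0) \<le> ennreal (real k) + ennreal (if ?full H then z2 H else 0)"
        by simp
    qed
    also have "\<dots> = ennreal (real k) + ?Z"
      using gauss.emeasure_space_1[where 'a="real^'k^'l"] by (subst nn_integral_add) simp_all
    also have "\<dots> < \<infinity>"
      using z2_int by (auto simp: less_top[symmetric] top_unique)
    finally have "?J < \<infinity>" by (simp only: 1)
    moreover have "E = enn2real ?J"
    proof -
      have "E = (\<integral>\<omega>. ?h (H \<omega>) \<partial>N)"
        unfolding E_def by (rule Bochner_Integration.integral_cong[OF refl eq])
      also have "\<dots> = enn2real ?J"
      proof (rule integral_eq_nn_integral)
        show "(\<lambda>\<omega>. ?h (H \<omega>)) \<in> borel_measurable N"
          by (rule measurable_compose[OF Hm h_meas])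
      qed (simp add: spectral_norm_nonneg)
      finally show ?thesis .
    qed
    ultimately show ?thesis unfolding 1 by (simp add: less_top)
  qed
  have entry_meas: "(\<lambda>W :: real^'l^'n. W $ i $ j) \<in> borel_measurable borel" for i j
    by (rule borel_measurable_entry) simp
  have inner_le: "(\<integral>\<^sup>+W. \<Phi> (H, \<chi> j. if k \<le> e j then W $ j else 0) \<partial>gauss)
      \<le> ennreal \<sigma> + (ennreal \<sigma> * ennreal (sqrt (if ?full H then z2 H else 0)) + ennreal (if ?full H then spectral_norm (pinv H) else 0) * ennreal C)"
    if full: "?full H" for H
  proof -
    have z: "(\<Sum>i\<in>UNIV. a $ i *\<^sub>R column i (pinv H)) = pinv H *v a" for a
      by (simp add: matrix_mult_sum scalar_mult_eq_scaleR)
    have eqX: "X H (\<chi> j. if k \<le> e j then W $ j else 0) a b = X H W a b" for W a b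
      unfolding X_def by (intro sum.cong) (auto simp: s_def)
    have [measurable]: "(\<lambda>W. X H W a b) \<in> borel_measurable borel" for a b
      unfolding X_def inner_vec_def using entry_meas by simp
    have "(\<integral>\<^sup>+W. \<Phi> (H, \<chi> j. if k \<le> e j then W $ j else 0) \<partial>gauss)
        = (\<integral>\<^sup>+W. ennreal \<sigma> + (SUP n. ennreal (X H W (y n) (\<beta> n))) \<partial>gauss)"
      using full by (simp add: \<Phi>_def eqX)
    also have "\<dots> = ennreal \<sigma> + (\<integral>\<^sup>+W. (SUP n. ennreal (X H W (y n) (\<beta> n))) \<partial>gauss)"
      using gauss.emeasure_space_1[where 'a="real^'l^'n"] by (subst nn_integral_add) simp_all
    also have "(\<integral>\<^sup>+W. (SUP n. ennreal (X H W (y n) (\<beta> n))) \<partial>gauss)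
        \<le> ennreal \<sigma> * ennreal (sqrt (z2 H)) + ennreal (spectral_norm (pinv H)) * ennreal (sqrt (\<Sum>j\<in>UNIV. (s j)\<^sup>2))"
      unfolding X_def z2_def z[symmetric]
    proof (rule Chevet[where y=y and \<beta>=\<beta> and s=s and \<sigma>=\<sigma> and z="\<lambda>i. column i (pinv H)", OF y(2,1) \<beta> s])
      fix n
      have "norm (pinv H *v y n) \<le> spectral_norm (pinv H) * norm (y n)" by (rule spectral_norm_bound)
      also have "\<dots> \<le> spectral_norm (pinv H)" using y(2) spectral_norm_nonneg by (rule mult_left_le)
      finally show "norm (\<Sum>i\<in>UNIV. y n $ i *\<^sub>R column i (pinv H)) \<le> spectral_norm (pinv H)" by (simp add: z)
    qed
    finally show ?thesis using full by (simp add: C)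
  qed
  have main: "(\<integral>\<^sup>+\<omega>. ennreal (?f \<omega>) \<partial>M) \<le> ennreal (\<sigma> + (\<sigma> * sqrt (real k / (real p - 1)) + E * C))"
  proof -
    let ?\<Psi> = "\<lambda>G :: real^'l^'n. \<Phi> (\<chi> l i. (transpose G *v v (\<kappa> i)) $ l, \<chi> j. if k \<le> e j then transpose G *v v (e j) else 0)"
    have \<Psi>_meas: "?\<Psi> \<in> borel_measurable borel"
    proof (rule measurable_compose[OF _ \<Phi>_meas])
      have T: "(\<lambda>G :: real^'l^'n. (transpose G *v u) $ l) \<in> borel_measurable borel" for u l
        unfolding matrix_vector_mult_def transpose_def using entry_meas by simp
      have 1: "(\<lambda>G :: real^'l^'n. (\<chi> l i. (transpose G *v v (\<kappa> i)) $ l) :: real^'k^'l) \<in> borel_measurable borel"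
        using T by (intro borel_measurable_matrixI) simp
      have 2: "(\<lambda>G :: real^'l^'n. (\<chi> j. if k \<le> e j then transpose G *v v (e j) else 0) :: real^'l^'n) \<in> borel_measurable borel"
      proof (rule borel_measurable_matrixI)
        show "(\<lambda>G :: real^'l^'n. (\<chi> j. if k \<le> e j then transpose G *v v (e j) else 0) $ i $ j) \<in> borel_measurable borel" for i j
          using T by (cases "k \<le> e i") simp_all
      qed
      show "(\<lambda>G :: real^'l^'n. ((\<chi> l i. (transpose G *v v (\<kappa> i)) $ l) :: real^'k^'l, (\<chi> j. if k \<le> e j then transpose G *v v (e j) else 0) :: real^'l^'n)) \<in> borel_measurable borel"
        using 1 2 by (rule borel_measurable_Pair)
    qed
    have "(\<integral>\<^sup>+\<omega>. ennreal (?f \<omega>) \<partial>M) \<le> (\<integral>\<^sup>+\<omega>. ?\<Psi> (G \<omega>) \<partial>M)"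
      by (rule nn_integral_mono) (rule f_le)
    also have "\<dots> = (\<integral>\<^sup>+G. ?\<Psi> G \<partial>gauss)"
      by (rule std_gaussian_matrix_nn_integral[OF assms(6,7) \<Psi>_meas])
    also have "\<dots> = (\<integral>\<^sup>+H. (\<integral>\<^sup>+W. \<Phi> (H, \<chi> j. if k \<le> e j then W $ j else 0) \<partial>gauss) \<partial>gauss)"
      using kn by (intro nn_integral_gauss_split_rows singular_system_inner[OF v] singular_system_expand[OF v] \<kappa> e \<Phi>_meas) auto
    also have "\<dots> \<le> (\<integral>\<^sup>+H. ennreal \<sigma> + (ennreal \<sigma> * ennreal (sqrt (if ?full H then z2 H else 0))
        + ennreal (if ?full H then spectral_norm (pinv H) else 0) * ennreal C) \<partial>gauss)"
      by (rule nn_integral_mono_AE) (rule eventually_mono[OF full_AE], rule inner_le)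
    also have "\<dots> = ennreal \<sigma> + (ennreal \<sigma> * (\<integral>\<^sup>+H. ennreal (sqrt (if ?full H then z2 H else 0)) \<partial>gauss)
        + ?I * ennreal C)"
      using gauss.emeasure_space_1[where 'a="real^'k^'l"]
      by (simp add: nn_integral_add nn_integral_cmult nn_integral_multc)
    also have "\<dots> \<le> ennreal \<sigma> + (ennreal \<sigma> * ennreal (sqrt (real k / (real p - 1))) + ennreal E * ennreal C)"
    proof -
      have "(\<integral>\<^sup>+H. ennreal (sqrt (if ?full H then z2 H else 0)) \<partial>gauss) \<le> ennreal (sqrt (real k / (real p - 1)))"
        using z2_int p1 z2_0 by (intro gauss.nn_integral_sqrt_le) auto
      then show ?thesis unfolding N_int by (intro add_mono mult_left_mono) auto
    qed
    also have "\<dots> = ennreal (\<sigma> + (\<sigma> * sqrt (real k / (real p - 1)) + E * C))"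
      using \<sigma>(2) E0 C0 p1 by (simp add: ennreal_mult ennreal_plus)
    finally show ?thesis .
  qed
  have rhs: "0 \<le> \<sigma> + (\<sigma> * sqrt (real k / (real p - 1)) + E * C)"
    using \<sigma>(2) E0 C0 p1 by simp
  have "(\<integral>\<omega>. ?f \<omega> \<partial>M) \<le> \<sigma> + (\<sigma> * sqrt (real k / (real p - 1)) + E * C)"
  \<comment> \<open>If the error were not integrable, its Bochner integral would be 0 by convention
    and nonnegativity of the right side would suffice.\<close>
  proof (cases "integrable M ?f")
    case True
    then have "ennreal (\<integral>\<omega>. ?f \<omega> \<partial>M) = (\<integral>\<^sup>+\<omega>. ennreal (?f \<omega>) \<partial>M)"
      by (intro nn_integral_eq_integral[symmetric]) (auto simp: spectral_norm_nonneg)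
    then have "ennreal (\<integral>\<omega>. ?f \<omega> \<partial>M) \<le> ennreal (\<sigma> + (\<sigma> * sqrt (real k / (real p - 1)) + E * C))"
      using main by (simp only:)
    then show ?thesis by (simp only: ennreal_le_iff[OF rhs])
  next
    case False
    then show ?thesis using rhs by (simp add: not_integrable_integral_eq)
  qed
  then show ?thesis
    unfolding \<sigma>(1) E_def[symmetric] C_def[symmetric] by (simp add: algebra_simps)
qed

end
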